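(* Let $S$ be a finitely-generated, nonexceptional, nonelementary semigroup. Then $S$ is semidiscrete if and only if every two-generator semigroup contained in $S$ is semidiscrete.
   Context: $\mathbb{H}$ is the upper half-plane, $\overline{\mathbb{R}}=\mathbb{R}\cup\{\infty\}$, $\overline{\mathbb{H}}=\mathbb{H}\cup\overline{\mathbb{R}}$. $\mathcal{M}\cong\mathrm{PSL}(2,\mathbb{R})$ is the topological group of real Möbius transformations $z\mapsto (az+b)/(cz+d)$ ($a,b,c,d\in\mathbb{R}$, $ad-bc>0$), with identity $I$. A semigroup is a nonempty subset of $\mathcal{M}$ closed under composition. It is generated by a subset $T$ if each of its elements is a finite composition of elements of $T$ (and $T\subset S$); it is finitely generated if it is generated by a finite set, and it is an $n$-generator semigroup if the smallest set generating it has $n$ elements. $S$ is semidiscrete if $I$ is not an accumulation point of $S$ in $\mathcal{M}$. $S$ is elementary if it has a finite orbit in its action on $\overline{\mathbb{H}}$, and nonelementary otherwise. A closed interval is a closed interval in the circle $\overline{\mathbb{R}}$ that is neither a singleton nor all of $\overline{\mathbb{R}}$; $\mathcal{M}(J)=\{h\in\mathcal{M}:h(J)\subset J\}$. A semigroup $S$ is exceptional if there is a closed interval $J$ such that $S\subset\mathcal{M}(J)$, the elements $h\in S$ with $h(J)=J$ form a nontrivial discrete group, and some element of $S$ outside this discrete group fixes one of the end points of $J$. Otherwise $S$ is nonexceptional. *)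

theory Defs
  imports "HOL-Analysis.Analysis" "HOL-Algebra.Group"
begin

section \<open>Real Moebius transformations\<close>

text \<open>
  Points of the Riemann sphere are values of type \<^typ>\<open>complex option\<close>, with \<^term>\<open>None\<close> as
  the point at infinity; \<^typ>\<open>real option\<close> plays the same role for the extended real line, which
  is embedded in the sphere by \<open>ext_of_real\<close>.
\<close>

definition ext_of_real :: "real option \<Rightarrow> complex option" where
  "ext_of_real = map_option complex_of_real"

definition ext_reals :: "complex option set" where
  "ext_reals = range ext_of_real"

definition closed_half_plane :: "complex option set" where
  "closed_half_plane = Some ` {z. Im z > 0} \<union> ext_reals"

text \<open>
  The transformation \<open>z \<mapsto> (a z + b) / (c z + d)\<close> for a matrix with rows \<open>(a, b)\<close> and \<open>(c, d)\<close>.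
\<close>

definition mobius :: "real^2^2 \<Rightarrow> complex option \<Rightarrow> complex option" where
  "mobius A p =
    (let a = complex_of_real (A$1$1); b = complex_of_real (A$1$2);
         c = complex_of_real (A$2$1); d = complex_of_real (A$2$2)
     in case p of
          None \<Rightarrow> if c = 0 then None else Some (a / c)
        | Some z \<Rightarrow> if c * z + d = 0 then None else Some ((a * z + b) / (c * z + d)))"

definition mobius_maps :: "(complex option \<Rightarrow> complex option) set" where
  "mobius_maps = mobius ` {A. det A > 0}"

definition mobius_group :: "(complex option \<Rightarrow> complex option) monoid" where
  "mobius_group = \<lparr>carrier = mobius_maps, monoid.mult = (\<circ>), one = id\<rparr>"

text \<open>
  The topology of \<open>PSL(2,\<real>)\<close>: the quotient topology under \<^const>\<open>mobius\<close>, restricted to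
  \<open>SL(2,\<real>)\<close> with its topology as a subspace of the space of matrices.
\<close>

definition SL2 :: "(real^2^2) set" where
  "SL2 = {A. det A = 1}"

definition mobius_topology :: "(complex option \<Rightarrow> complex option) topology" where
  "mobius_topology =
    topology (\<lambda>U. U \<subseteq> mobius ` SL2 \<and> openin (top_of_set SL2) {A \<in> SL2. mobius A \<in> U})"

lemma openin_mobius_topology:
  "openin mobius_topology U \<longleftrightarrow>
    U \<subseteq> mobius ` SL2 \<and> openin (top_of_set SL2) {A \<in> SL2. mobius A \<in> U}"
proof -
  have "istopology (\<lambda>U. U \<subseteq> mobius ` SL2 \<and> openin (top_of_set SL2) {A \<in> SL2. mobius A \<in> U})"
    (is "istopology ?P")
    unfolding istopology_def
  proof (intro conjI allI impI)
    fix U V assume "?P U" "?P V"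
    moreover have "{A \<in> SL2. mobius A \<in> U \<inter> V} = {A \<in> SL2. mobius A \<in> U} \<inter> {A \<in> SL2. mobius A \<in> V}"
      by auto
    ultimately show "U \<inter> V \<subseteq> mobius ` SL2"
      and "openin (top_of_set SL2) {A \<in> SL2. mobius A \<in> U \<inter> V}"
      by (auto intro: openin_Int)
  next
    fix K assume K: "\<forall>U\<in>K. ?P U"
    then show "\<Union>K \<subseteq> mobius ` SL2" by blast
    have "{A \<in> SL2. mobius A \<in> \<Union>K} = \<Union>((\<lambda>U. {A \<in> SL2. mobius A \<in> U}) ` K)"
      by auto
    then show "openin (top_of_set SL2) {A \<in> SL2. mobius A \<in> \<Union>K}"
      using K by (auto intro!: openin_Union)
  qed
  then show ?thesis
    by (simp add: mobius_topology_def)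
qed

lemma mobius_scale:
  assumes "k \<noteq> 0"
  shows "mobius (k *\<^sub>R A) = mobius A"
proof
  fix p
  have eq: "complex_of_real k * u * z + complex_of_real k * v = complex_of_real k * (u * z + v)" for u v z
    by (simp add: algebra_simps)
  show "mobius (k *\<^sub>R A) p = mobius A p"
    using assms by (cases p) (simp_all add: mobius_def Let_def eq)
qed

lemma mobius_image_SL2: "mobius ` SL2 = mobius_maps"
proof
  show "mobius ` SL2 \<subseteq> mobius_maps"
    by (auto simp: SL2_def mobius_maps_def)
  show "mobius_maps \<subseteq> mobius ` SL2"
  proof
    fix f assume "f \<in> mobius_maps"
    then obtain A where A: "det A > 0" "f = mobius A"
      by (auto simp: mobius_maps_def)
    define k where "k = 1 / sqrt (det A)"
    have k: "k \<noteq> 0" "k * k * det A = 1"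
      using A by (auto simp: k_def)
    have "det (k *\<^sub>R A) = k * k * det A"
      by (simp add: det_2 algebra_simps)
    then have "k *\<^sub>R A \<in> SL2"
      using k by (simp add: SL2_def)
    then show "f \<in> mobius ` SL2"
      using mobius_scale[OF k(1), of A] A(2) by (metis imageI)
  qed
qed

lemma topspace_mobius_topology: "topspace mobius_topology = mobius_maps"
proof -
  have "{A \<in> SL2. mobius A \<in> mobius ` SL2} = SL2"
    by auto
  then have "openin mobius_topology mobius_maps"
    unfolding openin_mobius_topology mobius_image_SL2[symmetric] by simp
  then show ?thesis
    using openin_mobius_topology[of "topspace mobius_topology"] mobius_image_SL2
    by (auto dest: openin_subset)
qed

lemma mobius_compose:
  assumes "det A > 0" "det B > 0"
  shows "mobius A \<circ> mobius B = mobius (A ** B)"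
proof
  fix p :: "complex option"
  define a where "a = complex_of_real (A$1$1)"
  define b where "b = complex_of_real (A$1$2)"
  define c where "c = complex_of_real (A$2$1)"
  define d where "d = complex_of_real (A$2$2)"
  note A = a_def b_def c_def d_def
  define e where "e = complex_of_real (B$1$1)"
  define f where "f = complex_of_real (B$1$2)"
  define g where "g = complex_of_real (B$2$1)"
  define h where "h = complex_of_real (B$2$2)"
  note B = e_def f_def g_def h_def
  have AB: "complex_of_real ((A ** B)$1$1) = a * e + b * g"
    "complex_of_real ((A ** B)$1$2) = a * f + b * h"
    "complex_of_real ((A ** B)$2$1) = c * e + d * g"
    "complex_of_real ((A ** B)$2$2) = c * f + d * h"
    by (simp_all add: matrix_matrix_mult_def UNIV_2 A B)
  have "a * d - b * c = complex_of_real (det A)" "e * h - f * g = complex_of_real (det B)"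
    by (simp_all add: A B det_2)
  then have nz: "a * d - b * c \<noteq> 0" "e * h - f * g \<noteq> 0"
    using assms by simp_all
  text \<open>A point with homogeneous coordinates \<open>(u, v)\<close>.\<close>
  define hp :: "complex \<Rightarrow> complex \<Rightarrow> complex option"
    where "hp u v = (if v = 0 then None else Some (u / v))" for u v
  have actA: "mobius A (hp u v) = hp (a * u + b * v) (c * u + d * v)" if "u \<noteq> 0 \<or> v \<noteq> 0" for u v
  proof (cases "v = 0")
    case True
    with that show ?thesis
      by (simp add: mobius_def hp_def A[symmetric])
  next
    case False
    have "c * (u / v) + d = (c * u + d * v) / v" "a * (u / v) + b = (a * u + b * v) / v"
      using False by (simp_all add: field_simps)
    then show ?thesis
      using False by (simp add: mobius_def hp_def A[symmetric])
  qed
  define u where "u = (case p of None \<Rightarrow> (1::complex) | Some z \<Rightarrow> z)"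
  define v where "v = (case p of None \<Rightarrow> 0 | Some z \<Rightarrow> (1::complex))"
  note uv = u_def v_def
  have uv0: "u \<noteq> 0 \<or> v \<noteq> 0"
    by (simp add: uv split: option.split)
  have mB: "mobius B p = hp (e * u + f * v) (g * u + h * v)"
    by (simp add: mobius_def hp_def B[symmetric] uv Let_def split: option.split)
  have nzB: "e * u + f * v \<noteq> 0 \<or> g * u + h * v \<noteq> 0"
  proof (rule ccontr)
    assume "\<not> ?thesis"
    then have 0: "e * u + f * v = 0" "g * u + h * v = 0"
      by simp_all
    have "(e * h - f * g) * u = h * (e * u + f * v) - f * (g * u + h * v)"
      "(e * h - f * g) * v = e * (g * u + h * v) - g * (e * u + f * v)"
      by (simp_all add: algebra_simps)
    then have "(e * h - f * g) * u = 0" "(e * h - f * g) * v = 0"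
      by (simp_all add: 0)
    with nz uv0 show False by simp
  qed
  have "mobius (A ** B) p = hp ((a * e + b * g) * u + (a * f + b * h) * v) ((c * e + d * g) * u + (c * f + d * h) * v)"
    unfolding mobius_def AB by (simp add: hp_def uv Let_def split: option.split)
  also have "\<dots> = hp (a * (e * u + f * v) + b * (g * u + h * v)) (c * (e * u + f * v) + d * (g * u + h * v))"
    by (simp add: algebra_simps)
  finally show "(mobius A \<circ> mobius B) p = mobius (A ** B) p"
    using actA[OF nzB] mB by simp
qed

lemma mobius_one: "mobius (mat 1) = id"
  by (auto simp: mobius_def mat_def fun_eq_iff split: option.split)

lemma group_mobius_group: "group mobius_group"
proof (rule groupI)
  show "x \<otimes>\<^bsub>mobius_group\<^esub> y \<in> carrier mobius_group"
    if "x \<in> carrier mobius_group" "y \<in> carrier mobius_group" for x y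
    using that by (auto simp: mobius_group_def mobius_maps_def mobius_compose det_mul)
  show "\<one>\<^bsub>mobius_group\<^esub> \<in> carrier mobius_group"
    by (auto simp: mobius_group_def mobius_maps_def mobius_one[symmetric] intro!: imageI)
  show "\<exists>y\<in>carrier mobius_group. y \<otimes>\<^bsub>mobius_group\<^esub> x = \<one>\<^bsub>mobius_group\<^esub>"
    if "x \<in> carrier mobius_group" for x
  proof -
    obtain A where A: "det A > 0" "x = mobius A"
      using \<open>x \<in> carrier mobius_group\<close> by (auto simp: mobius_group_def mobius_maps_def)
    then obtain B where B: "B ** A = mat 1"
      by (metis invertible_det_nz invertible_def less_irrefl)
    then have "det B * det A = 1"
      by (metis det_mul det_I)
    then have "det B > 0"
      using A(1) by (metis less_numeral_extra(1) zero_less_mult_pos2)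
    with A B show ?thesis
      by (auto simp: mobius_group_def mobius_maps_def mobius_compose mobius_one
          intro!: bexI[of _ "mobius B"])
  qed
qed (auto simp: mobius_group_def)


section \<open>Semigroups of Moebius transformations\<close>

definition mobius_semigroup :: "(complex option \<Rightarrow> complex option) set \<Rightarrow> bool" where
  "mobius_semigroup S \<longleftrightarrow>
    S \<noteq> {} \<and> S \<subseteq> mobius_maps \<and> (\<forall>f\<in>S. \<forall>g\<in>S. f \<circ> g \<in> S)"

text \<open>Compositions of finitely many, but at least one, elements of \<open>T\<close>.\<close>

inductive_set compositions :: "('a \<Rightarrow> 'a) set \<Rightarrow> ('a \<Rightarrow> 'a) set" for T where
  base: "f \<in> T \<Longrightarrow> f \<in> compositions T"
| comp: "f \<in> T \<Longrightarrow> g \<in> compositions T \<Longrightarrow> f \<circ> g \<in> compositions T"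

definition generated_by :: "('a \<Rightarrow> 'a) set \<Rightarrow> ('a \<Rightarrow> 'a) set \<Rightarrow> bool" where
  "generated_by S T \<longleftrightarrow> T \<subseteq> S \<and> (\<forall>f\<in>S. f \<in> compositions T)"

definition finitely_generated :: "('a \<Rightarrow> 'a) set \<Rightarrow> bool" where
  "finitely_generated S \<longleftrightarrow> (\<exists>T. finite T \<and> generated_by S T)"

text \<open>The least cardinality of a generating set is exactly \<open>n\<close>.\<close>

definition n_generator :: "nat \<Rightarrow> ('a \<Rightarrow> 'a) set \<Rightarrow> bool" where
  "n_generator n S \<longleftrightarrow>
    (\<exists>T. finite T \<and> card T = n \<and> generated_by S T) \<and>
    (\<forall>T. finite T \<and> generated_by S T \<longrightarrow> n \<le> card T)"

definition semidiscrete :: "(complex option \<Rightarrow> complex option) set \<Rightarrow> bool" where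
  "semidiscrete S \<longleftrightarrow> id \<notin> mobius_topology derived_set_of S"

definition elementary :: "(complex option \<Rightarrow> complex option) set \<Rightarrow> bool" where
  "elementary S \<longleftrightarrow> (\<exists>p\<in>closed_half_plane. finite ((\<lambda>f. f p) ` S))"


section \<open>Closed intervals and exceptional semigroups\<close>

text \<open>
  \<open>ext_arc p q\<close> is the closed arc of the extended real line that runs from \<open>p\<close> to \<open>q\<close> in the
  positive direction. For \<open>p \<noteq> q\<close> it is neither a singleton nor the whole circle, and every such
  closed interval arises in this way from exactly one ordered pair of distinct end points.
\<close>

fun ext_arc :: "real option \<Rightarrow> real option \<Rightarrow> real option set" where
  "ext_arc (Some a) (Some b) =
    (if a \<le> b then Some ` {a..b} else insert None (Some ` ({a..} \<union> {..b})))"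
| "ext_arc (Some a) None = insert None (Some ` {a..})"
| "ext_arc None (Some b) = insert None (Some ` {..b})"
| "ext_arc None None = {None}"

definition closed_interval :: "complex option \<Rightarrow> complex option \<Rightarrow> complex option set \<Rightarrow> bool" where
  "closed_interval u v J \<longleftrightarrow>
    (\<exists>p q. p \<noteq> q \<and> u = ext_of_real p \<and> v = ext_of_real q \<and> J = ext_of_real ` ext_arc p q)"

definition maps_into :: "complex option set \<Rightarrow> (complex option \<Rightarrow> complex option) set" where
  "maps_into J = {h \<in> mobius_maps. h ` J \<subseteq> J}"

text \<open>
  In the definition below \<open>u\<close> and \<open>v\<close> are the end points of \<open>J\<close>. A group is discrete if the
  topology it inherits from the group of all real Moebius transformations is discrete.
\<close>

definition exceptional :: "(complex option \<Rightarrow> complex option) set \<Rightarrow> bool" where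
  "exceptional S \<longleftrightarrow>
    (\<exists>J u v. closed_interval u v J \<and> S \<subseteq> maps_into J \<and>
      (let G = {h \<in> S. h ` J = J} in
        subgroup G mobius_group \<and> G \<noteq> {id} \<and>
        subtopology mobius_topology G = discrete_topology G \<and>
        (\<exists>h\<in>S - G. h u = u \<or> h v = v)))"

end

theory Submission
  imports Defs
begin

text \<open>
  Let \<open>\<Sigma>\<close> be the set of lifts of \<open>S\<close> to \<open>SL(2, \<real>)\<close>, and suppose that every two-generator semigroup in \<open>S\<close>
  is semidiscrete but \<open>S\<close> is not.

  The closure of \<open>\<Sigma>\<close> contains no elliptic element of infinite order. Otherwise it contains all
  rotations about a point, hence (for \<open>f \<in> \<Sigma>\<close> not fixing this point) also \<open>f\<^sup>-\<^sup>1\<close> and all rotations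
  about a second point; so \<open>\<Sigma>\<close> contains elliptic elements \<open>A\<close>, \<open>B\<close> of small rotation angles without
  common fixed point. These have finite order by the hypothesis on pairs, so they generate a group,
  which is not discrete because it violates Jorgensen's inequality.

  Suitable powers of elements of \<open>\<Sigma>\<close> tending to the identity converge to a one-parameter semigroup
  \<open>E\<^sub>t\<close> in the closure, which must be parabolic or hyperbolic. The trace of \<open>f E\<^sub>s g E\<^sub>t\<close> depends
  continuously on \<open>t\<close> and cannot pass through the values of irrational rotations; letting \<open>s\<close> and \<open>t\<close>
  tend to infinity, this yields sign conditions on the matrices \<open>f\<close> and \<open>g\<close> which provide a sector of
  the plane that \<open>\<Sigma>\<close> preserves up to sign, that is, a closed interval preserved by \<open>S\<close>.

  In a basis adapted to the sector all lifts are nonnegative. A word in finitely many nonnegative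
  matrices that is close to the identity has only triangular letters, and there must be diagonal
  letters of both kinds, expanding and contracting. By the hypothesis on pairs the dilations in \<open>S\<close>
  form a discrete group, and since \<open>S\<close> is nonexceptional all triangular letters are diagonal: a
  contradiction.
\<close>

section \<open>Two by two matrices\<close>

text \<open>The hypothesis speaks of two-generator semigroups and says nothing directly about cyclic
  ones. To control a single element it has to be paired with a second one, so that the two do not
  lie in a common cyclic semigroup. Positivity of \<open>gam A B\<close> ensures this; for elliptic
  \<open>A\<close> it means that \<open>B\<close> moves the fixed point of \<open>A\<close>. A map
  determines its matrix only up to sign, so the sign conditions compare lifts normalised by making
  one chosen entry positive: that entry must be nonnegative in every product of two such lifts. For
  parabolic \<open>E\<^sub>t\<close> fixing \<infinity> this reads: images of \<infinity> lie on one
  side of its preimages, and the sector begins where the two sets are separated. For hyperbolic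
  \<open>E\<^sub>t\<close> the sector is the cone dual to the normalised first rows. Finite
  generation is used twice: minima over the finitely many letters bound words away from the
  identity, and a product over the diagonal letters gives a common denominator for the logarithms of
  all dilations.\<close>

definition M2 :: "real \<Rightarrow> real \<Rightarrow> real \<Rightarrow> real \<Rightarrow> real^2^2" where
  "M2 a b c d = vector [vector [a, b], vector [c, d]]"

text \<open>The adjugate is the inverse when the determinant is 1. Its entries are those of
  \<open>A\<close> up to position and sign, so continuity and sign conditions can be read off
  directly.\<close>

definition adj2 :: "real^2^2 \<Rightarrow> real^2^2" where
  "adj2 A = M2 (A$2$2) (- A$1$2) (- A$2$1) (A$1$1)"

lemma M2_nth [simp]:
  "M2 a b c d $ 1 $ 1 = a" "M2 a b c d $ 1 $ 2 = b"
  "M2 a b c d $ 2 $ 1 = c" "M2 a b c d $ 2 $ 2 = d"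
  by (simp_all add: M2_def)

lemma mat2_eq_iff:
  "A = B \<longleftrightarrow> A$1$1 = B$1$1 \<and> A$1$2 = B$1$2 \<and> A$2$1 = B$2$1 \<and> A$2$2 = B$2$2"
  for A B :: "'a^2^2"
  by (auto simp: vec_eq_iff forall_2)

lemma matrix_mult_2 [simp]:
  fixes A B :: "real^2^2"
  shows "(A ** B)$1$1 = A$1$1 * B$1$1 + A$1$2 * B$2$1"
    "(A ** B)$1$2 = A$1$1 * B$1$2 + A$1$2 * B$2$2"
    "(A ** B)$2$1 = A$2$1 * B$1$1 + A$2$2 * B$2$1"
    "(A ** B)$2$2 = A$2$1 * B$1$2 + A$2$2 * B$2$2"
  by (simp_all add: matrix_matrix_mult_def sum_2)

lemma mat1_2 [simp]:
  "(mat 1 :: real^2^2)$1$1 = 1" "(mat 1 :: real^2^2)$1$2 = 0"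
  "(mat 1 :: real^2^2)$2$1 = 0" "(mat 1 :: real^2^2)$2$2 = 1"
  by (simp_all add: mat_def)

lemma trace_2: "trace (A :: real^2^2) = A$1$1 + A$2$2"
  by (simp add: trace_def sum_2)

lemma det_M2 [simp]: "det (M2 a b c d) = a * d - b * c"
  by (simp add: det_2)

lemma det_neg_2 [simp]: "det (- A) = det (A :: real^2^2)"
  by (simp add: det_2)

lemma adj2_nth [simp]:
  "adj2 A $ 1 $ 1 = A$2$2" "adj2 A $ 1 $ 2 = - A$1$2"
  "adj2 A $ 2 $ 1 = - A$2$1" "adj2 A $ 2 $ 2 = A$1$1"
  by (simp_all add: adj2_def)

lemma adj2_inverse:
  assumes "det A = 1"
  shows "A ** adj2 A = mat 1" "adj2 A ** A = mat 1"
  using assms by (auto simp: mat2_eq_iff det_2 algebra_simps)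

lemma det_adj2 [simp]: "det (adj2 A) = det A"
  by (simp add: det_2)

lemma adj2_mult: "adj2 (A ** B) = adj2 B ** adj2 A"
  by (simp add: mat2_eq_iff algebra_simps)

lemma adj2_adj2 [simp]: "adj2 (adj2 A) = A"
  by (simp add: mat2_eq_iff)

lemma matrix_neg_mult_2:
  fixes A B :: "real^2^2"
  shows "(- A) ** B = - (A ** B)" "A ** (- B) = - (A ** B)"
  by (simp_all add: mat2_eq_iff)

lemma tendsto_mat2I:
  fixes F :: "'a \<Rightarrow> real^2^2"
  assumes "((\<lambda>n. F n $ 1 $ 1) \<longlongrightarrow> A$1$1) net" "((\<lambda>n. F n $ 1 $ 2) \<longlongrightarrow> A$1$2) net"
    "((\<lambda>n. F n $ 2 $ 1) \<longlongrightarrow> A$2$1) net" "((\<lambda>n. F n $ 2 $ 2) \<longlongrightarrow> A$2$2) net"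
  shows "(F \<longlongrightarrow> A) net"
proof (rule vec_tendstoI)
  fix i :: 2
  show "((\<lambda>x. F x $ i) \<longlongrightarrow> A $ i) net"
  proof (rule vec_tendstoI)
    fix j :: 2
    show "((\<lambda>x. F x $ i $ j) \<longlongrightarrow> A $ i $ j) net"
      using exhaust_2[of i] exhaust_2[of j] assms by auto
  qed
qed

lemma tendsto_matrix_mult_2:
  fixes F G :: "'a \<Rightarrow> real^2^2"
  assumes "(F \<longlongrightarrow> A) net" "(G \<longlongrightarrow> B) net"
  shows "((\<lambda>x. F x ** G x) \<longlongrightarrow> A ** B) net"
  by (rule tendsto_mat2I) (auto intro!: tendsto_intros assms)

lemma tendsto_adj2:
  assumes "(F \<longlongrightarrow> A) net"
  shows "((\<lambda>x. adj2 (F x)) \<longlongrightarrow> adj2 A) net"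
  by (rule tendsto_mat2I) (auto intro!: tendsto_intros assms)

lemma tendsto_trace_2:
  fixes F :: "'a \<Rightarrow> real^2^2"
  assumes "(F \<longlongrightarrow> A) net"
  shows "((\<lambda>x. trace (F x)) \<longlongrightarrow> trace A) net"
  unfolding trace_2 by (auto intro!: tendsto_intros assms)

lemma tendsto_det_2:
  fixes F :: "'a \<Rightarrow> real^2^2"
  assumes "(F \<longlongrightarrow> A) net"
  shows "((\<lambda>x. det (F x)) \<longlongrightarrow> det A) net"
  unfolding det_2 by (auto intro!: tendsto_intros assms)

lemma trace_conj:
  fixes A P Q :: "real^2^2"
  assumes "P ** Q = mat 1"
  shows "trace (Q ** A ** P) = trace A"
  by (metis assms matrix_mul_assoc matrix_mul_lid trace_mul_sym)

lemma det_conj: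
  fixes A P Q :: "real^2^2"
  assumes "P ** Q = mat 1"
  shows "det (Q ** A ** P) = det A"
proof -
  have "det P * det Q = 1" by (metis assms det_mul det_I)
  then show ?thesis by (simp add: det_mul algebra_simps)
qed

lemma conj_cancel:
  fixes A P Q :: "real^2^2"
  assumes "P ** Q = mat 1"
  shows "P ** (Q ** A ** P) ** Q = A"
  by (metis assms matrix_mul_assoc matrix_mul_lid matrix_mul_rid)

lemma conj_mult:
  fixes A B P Q :: "real^2^2"
  assumes "P ** Q = mat 1"
  shows "Q ** (A ** B) ** P = (Q ** A ** P) ** (Q ** B ** P)"
  by (metis assms matrix_mul_assoc matrix_mul_lid)

lemma matrix_inverse_swap:
  fixes P Q :: "real^2^2"
  assumes "P ** Q = mat 1"
  shows "Q ** P = mat 1"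
  using assms matrix_left_right_inverse[of P Q] by simp

lemma conj_neg: "Q ** (- A) ** P = - (Q ** A ** P)" for A P Q :: "real^2^2"
  by (simp add: matrix_neg_mult_2)

section \<open>Powers, generated semigroups and closures of sets of matrices\<close>

primrec mpow :: "real^2^2 \<Rightarrow> nat \<Rightarrow> real^2^2" where
  "mpow A 0 = mat 1"
| "mpow A (Suc n) = A ** mpow A n"

lemma mpow_conj:
  assumes "P ** Q = mat 1"
  shows "mpow (Q ** A ** P) n = Q ** mpow A n ** P"
  by (induction n) (simp_all add: matrix_inverse_swap[OF assms] conj_mult[OF assms])

lemma mpow_add: "mpow A (m + n) = mpow A m ** mpow A n"
  by (induction m) (simp_all add: matrix_mul_assoc)

definition msemi :: "(real^2^2) set \<Rightarrow> bool" where
  "msemi X \<longleftrightarrow> (\<forall>A\<in>X. \<forall>B\<in>X. A ** B \<in> X)"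

inductive_set msg :: "(real^2^2) set \<Rightarrow> (real^2^2) set" for T where
  base: "A \<in> T \<Longrightarrow> A \<in> msg T"
| mult: "A \<in> T \<Longrightarrow> B \<in> msg T \<Longrightarrow> A ** B \<in> msg T"

lemma msemi_msg: "msemi (msg T)"
proof -
  have "A ** B \<in> msg T" if "A \<in> msg T" "B \<in> msg T" for A B
    using that
  proof (induction)
    case (mult A C)
    then show ?case by (metis matrix_mul_assoc msg.mult)
  qed (rule msg.mult)
  then show ?thesis by (auto simp: msemi_def)
qed

lemma mpow_mem:
  assumes "msemi X" "A \<in> X" "n > 0"
  shows "mpow A n \<in> X"
  using assms(3)
proof (induction n)
  case (Suc n)
  with assms show ?case by (cases n) (auto simp: msemi_def)
qed simp

lemma msemi_closure:
  assumes "msemi X"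
  shows "msemi (closure X)"
  unfolding msemi_def
proof (intro ballI)
  fix A B assume "A \<in> closure X" "B \<in> closure X"
  then obtain f g where "\<And>n. f n \<in> X" "f \<longlonglongrightarrow> A" "\<And>n. g n \<in> X" "g \<longlonglongrightarrow> B"
    unfolding closure_sequential by metis
  then show "A ** B \<in> closure X"
    unfolding closure_sequential using assms
    by (intro exI[of _ "\<lambda>n. f n ** g n"]) (auto simp: msemi_def intro: tendsto_matrix_mult_2)
qed

lemma neg_closure:
  fixes X :: "(real^2^2) set"
  assumes "\<And>A. A \<in> X \<Longrightarrow> - A \<in> X" "A \<in> closure X"
  shows "- A \<in> closure X"
  using assms unfolding closure_sequential by (metis tendsto_minus)

lemma det_closure:
  assumes "\<And>A. A \<in> X \<Longrightarrow> det A = 1" "A \<in> closure X"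
  shows "det (A :: real^2^2) = 1"
proof -
  obtain f where f: "\<And>n. f n \<in> X" "f \<longlonglongrightarrow> A"
    using assms(2) unfolding closure_sequential by metis
  have "(\<lambda>n. det (f n)) \<longlonglongrightarrow> det A" by (rule tendsto_det_2[OF f(2)])
  then show ?thesis using f(1) assms(1) by (simp add: LIMSEQ_const_iff)
qed

section \<open>Rotations about \<i> and elliptic elements\<close>

definition rot :: "real \<Rightarrow> real^2^2" where
  "rot t = M2 (cos t) (- sin t) (sin t) (cos t)"

lemma rot_add: "rot (s + t) = rot s ** rot t"
  by (simp add: rot_def mat2_eq_iff cos_add sin_add)

lemma rot_0 [simp]: "rot 0 = mat 1"
  by (simp add: rot_def mat2_eq_iff)

lemma det_rot [simp]: "det (rot t) = 1"
  by (simp add: rot_def power2_eq_square[symmetric])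

lemma mpow_rot: "mpow (rot t) n = rot (real n * t)"
  by (induction n) (simp_all add: rot_add[symmetric] algebra_simps)

lemma rot_periodic: "rot (t + 2 * pi * of_int m) = rot t"
  using sin_cos_eq_iff[of "t + 2 * pi * of_int m" t] by (auto simp: rot_def)

lemma continuous_rot: "isCont rot t"
  unfolding isCont_def rot_def
  by (rule tendsto_mat2I) (auto intro!: tendsto_intros)

lemma adj2_rot: "adj2 (rot t) = rot (- t)"
  by (simp add: rot_def mat2_eq_iff)

text \<open>\<open>A\<close> has one fixed point in the upper half-plane, and the affine map given
  by \<open>P\<close> carries \<i> there. Conjugation by \<open>P\<close> therefore turns
  \<open>A\<close> into an element fixing \<i>, that is, a rotation matrix.\<close>

lemma elliptic_conj_rot:
  fixes A :: "real^2^2"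
  assumes det: "det A = 1" and tr: "trace A = 2 * cos t" and t: "sin t \<noteq> 0"
  obtains P Q s where "P ** Q = mat 1" "det P > 0" "A = P ** rot s ** Q" "s = t \<or> s = - t"
proof -
  define a where "a = A$1$1"
  define b where "b = A$1$2"
  define c where "c = A$2$1"
  define d where "d = A$2$2"
  note abcd = a_def b_def c_def d_def
  have ad: "a * d - b * c = 1" using det by (simp add: det_2 abcd)
  have sum: "a + d = 2 * cos t" using tr by (simp add: trace_2 abcd)
  have sc: "(sin t)\<^sup>2 = 1 - (cos t)\<^sup>2" by (simp add: sin_squared_eq)
  have c: "c \<noteq> 0"
  proof
    assume "c = 0"
    then have "a * d = 1" using ad by simp
    have "(a - d)\<^sup>2 = (a + d)\<^sup>2 - 4 * (a * d)" by (simp add: power2_eq_square algebra_simps)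
    also have "\<dots> = 4 * (cos t)\<^sup>2 - 4"
      unfolding sum \<open>a * d = 1\<close> by (simp add: power2_eq_square)
    finally have "(a - d)\<^sup>2 = 4 * (cos t)\<^sup>2 - 4" .
    then have "(a - d)\<^sup>2 = - 4 * (sin t)\<^sup>2" using sc by simp
    then show False using t by (smt (verit) zero_le_power2 zero_less_power2)
  qed
  \<comment> \<open>The fixed point is \<open>x + y * \<i>\<close> with
    \<open>y = sin s / c\<close>. The sign of \<open>s\<close> is the one that makes
    \<open>y\<close> positive, so that \<open>det P > 0\<close>.\<close>
  define s where "s = (if c * sin t > 0 then t else - t)"
  have st: "s = t \<or> s = - t" by (auto simp: s_def)
  then have cs: "cos s = cos t" by auto
  have ss: "(sin s)\<^sup>2 = 1 - (cos t)\<^sup>2" using st sc by auto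
  have s: "c * sin s > 0" using c t by (auto simp: s_def not_less mult_le_0_iff zero_less_mult_iff)
  define y where "y = sin s / c"
  have y: "y > 0" using s c by (auto simp: y_def zero_less_divide_iff zero_less_mult_iff)
  have yc: "y * c = sin s" using c by (simp add: y_def)
  define x where "x = (a - d) / (2 * c)"
  have xc: "2 * (x * c) = a - d" using c by (simp add: x_def)
  define P where "P = M2 y x 0 1"
  define Q where "Q = M2 (1/y) (- x/y) 0 1"
  have PQ: "P ** Q = mat 1" using y by (simp add: P_def Q_def mat2_eq_iff)
  have a': "a = cos s + x * c" and d': "d = cos s - x * c" using sum xc cs by auto
  have "P ** rot s = A ** P"
  proof -
    have e: "c * (a * x + b) = c * (x * cos s - y * sin s)"
    proof -
      have "b * c = a * d - 1" using ad by simp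
      also have "\<dots> = (cos s)\<^sup>2 - (x * c)\<^sup>2 - 1"
        by (simp add: a' d' algebra_simps power2_eq_square)
      finally have bc: "b * c = (cos s)\<^sup>2 - (x * c)\<^sup>2 - 1" .
      have "c * (a * x + b) = a * (x * c) + b * c" by (simp add: algebra_simps)
      also have "\<dots> = (cos s + x * c) * (x * c) + ((cos s)\<^sup>2 - (x * c)\<^sup>2 - 1)"
        by (simp add: bc a')
      also have "\<dots> = (x * c) * cos s - (sin s)\<^sup>2"
        using ss cs by (simp add: algebra_simps power2_eq_square)
      also have "\<dots> = c * (x * cos s - y * sin s)"
        by (simp add: yc[symmetric] algebra_simps power2_eq_square)
      finally show ?thesis .
    qed
    then have "a * x + b = x * cos s - y * sin s" using c by simp
    then show ?thesis using yc a' d'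
      by (simp add: P_def rot_def mat2_eq_iff abcd[symmetric] algebra_simps)
  qed
  then have "P ** rot s ** Q = A"
    by (metis PQ matrix_mul_assoc matrix_mul_rid)
  moreover have "det P > 0" using y by (simp add: P_def)
  ultimately show thesis using that PQ st by blast
qed

text \<open>Dirichlet approximation of \<open>t / (2 * pi)\<close> yields a multiple of
  \<open>t\<close> close to a multiple of \<open>2 * pi\<close>. Rational values are allowed, in
  which case the power found may be the identity itself.\<close>

lemma rot_recurrent:
  assumes "e > 0"
  obtains n :: nat where "n > 0" "dist (rot (real n * t)) (mat 1) < e"
proof -
  obtain d where d: "d > 0" "\<And>s. dist s 0 < d \<Longrightarrow> dist (rot s) (rot 0) < e"
    using continuous_rot[of 0] assms unfolding continuous_at_eps_delta by blast
  obtain N :: nat where N: "N > 0" "2 * pi / d < N"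
    by (metis d(1) divide_pos_pos gr_zeroI mult_pos_pos of_nat_0 order_less_asym pi_gt_zero reals_Archimedean2 zero_less_numeral)
  obtain h k where hk: "0 < k" "\<bar>of_int k * (t / (2 * pi)) - of_int h\<bar> < 1 / N"
    using Dirichlet_approx[OF N(1)] by blast
  define n where "n = nat k"
  have "real n * t + 2 * pi * of_int (- h) = 2 * pi * (of_int k * (t / (2 * pi)) - of_int h)"
    using hk(1) by (simp add: n_def field_simps)
  moreover have "\<bar>2 * pi * (of_int k * (t / (2 * pi)) - of_int h)\<bar> < 2 * pi * (1 / N)"
    using mult_strict_left_mono[OF hk(2), of "2 * pi"] by (simp add: abs_mult)
  moreover have "2 * pi * (1 / N) < d" using N d(1) by (simp add: field_simps)
  ultimately have "dist (real n * t + 2 * pi * of_int (- h)) 0 < d" by simp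
  then have "dist (rot (real n * t + 2 * pi * of_int (- h))) (rot 0) < e" by (rule d(2))
  then show thesis using that[of n] hk(1) by (simp only: rot_periodic rot_0) (simp add: n_def)
qed

lemma rot_dense:
  assumes "t / (2 * pi) \<notin> \<rat>" "e > 0"
  obtains n :: nat where "n > 0" "dist (rot (real n * t)) (rot s) < e"
proof -
  obtain d where d: "d > 0" "\<And>u. dist u s < d \<Longrightarrow> dist (rot u) (rot s) < e"
    using continuous_rot[of s] assms unfolding continuous_at_eps_delta by blast
  have "d / (2 * pi) > 0" using d by simp
  then obtain h k where hk: "k > 0" "\<bar>of_int k * (t / (2 * pi)) - of_int h - s / (2 * pi)\<bar> < d / (2 * pi)"
    using sequence_of_fractional_parts_is_dense[OF assms(1)] by metis
  define n where "n = nat k"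
  have "real n * t + 2 * pi * of_int (- h) - s = 2 * pi * (of_int k * (t / (2 * pi)) - of_int h - s / (2 * pi))"
    using hk(1) by (simp add: n_def field_simps)
  moreover have "\<bar>2 * pi * (of_int k * (t / (2 * pi)) - of_int h - s / (2 * pi))\<bar> < 2 * pi * (d / (2 * pi))"
    using mult_strict_left_mono[OF hk(2), of "2 * pi"] by (simp add: abs_mult)
  ultimately have "dist (real n * t + 2 * pi * of_int (- h)) s < d" by (simp add: dist_real_def)
  then have "dist (rot (real n * t + 2 * pi * of_int (- h))) (rot s) < e" by (rule d(2))
  then show thesis using that[of n] hk(1) by (simp only: rot_periodic) (simp add: n_def)
qed

section \<open>Elliptic elements and Jorgensen's inequality\<close>

text \<open>For \<open>det B = 1\<close> and \<open>\<rho>\<close> the hyperbolic distance from \<open>\<i>\<close> to its image under \<open>B\<close>, \<open>disp B\<close> is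
  \<open>2 cosh \<rho> - 2\<close>; \<open>gam\<close> is the parameter that Gehring and Martin write as \<open>\<gamma>(A, B)\<close>.\<close>

definition disp :: "real^2^2 \<Rightarrow> real" where
  "disp B = (B$1$1 - B$2$2)\<^sup>2 + (B$1$2 + B$2$1)\<^sup>2"

definition gam :: "real^2^2 \<Rightarrow> real^2^2 \<Rightarrow> real" where
  "gam A B = trace (A ** B ** adj2 A ** adj2 B) - 2"

lemma disp_nonneg: "disp B \<ge> 0"
  by (simp add: disp_def)

lemma adj2_unique:
  assumes "det A = 1" "A ** B = mat 1"
  shows "B = adj2 A"
  by (metis adj2_inverse(2) assms matrix_mul_assoc matrix_mul_lid matrix_mul_rid)

lemma adj2_conj:
  assumes "P ** Q = mat 1" "det A = 1"
  shows "adj2 (Q ** A ** P) = Q ** adj2 A ** P"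
proof (rule adj2_unique[symmetric])
  show "det (Q ** A ** P) = 1" by (simp add: det_conj[OF assms(1)] assms(2))
  show "Q ** A ** P ** (Q ** adj2 A ** P) = mat 1"
    unfolding conj_mult[OF assms(1), symmetric] adj2_inverse(1)[OF assms(2)]
    by (simp add: matrix_inverse_swap[OF assms(1)])
qed

lemma gam_conj:
  assumes "P ** Q = mat 1" "det A = 1" "det B = 1"
  shows "gam (Q ** A ** P) (Q ** B ** P) = gam A B"
proof -
  have "Q ** A ** P ** (Q ** B ** P) ** adj2 (Q ** A ** P) ** adj2 (Q ** B ** P)
      = Q ** (A ** B ** adj2 A ** adj2 B) ** P"
    by (simp add: adj2_conj assms conj_mult)
  then show ?thesis by (simp add: gam_def trace_conj[OF assms(1)])
qed

lemma tendsto_gam: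
  assumes "(F \<longlongrightarrow> A) net" "(G \<longlongrightarrow> B) net"
  shows "((\<lambda>x. gam (F x) (G x)) \<longlongrightarrow> gam A B) net"
  unfolding gam_def
  by (intro tendsto_intros tendsto_trace_2 tendsto_matrix_mult_2 tendsto_adj2 assms)

lemma gam_rot:
  assumes "det B = 1"
  shows "gam (rot t) B = (sin t)\<^sup>2 * disp B"
proof -
  define a where "a = B$1$1"
  define b where "b = B$1$2"
  define c where "c = B$2$1"
  define d where "d = B$2$2"
  note B = a_def b_def c_def d_def
  define x y where xy: "x = cos t" "y = sin t"
  have ad: "a * d - b * c = 1" using assms by (simp add: det_2 B)
  have sc: "x * x + y * y = 1"
    unfolding xy by (metis power2_eq_square sin_cos_squared_add2)
  have "gam (rot t) B = 2 * (x * x) * (a * d - b * c) + (y * y) * (a * a + b * b + c * c + d * d) - 2"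
    by (simp add: gam_def trace_2 rot_def B[symmetric] xy[symmetric] algebra_simps)
  also have "\<dots> = y * y * (a * a + b * b + c * c + d * d - 2)"
  proof -
    have "x * x = 1 - y * y" using sc by simp
    then show ?thesis unfolding ad by (simp add: algebra_simps)
  qed
  also have "a * a + b * b + c * c + d * d - 2 = disp B"
    using ad by (simp add: disp_def B[symmetric] power2_eq_square algebra_simps)
  finally show ?thesis by (simp add: xy power2_eq_square)
qed

text \<open>With \<open>K = M2 0 (-1) 1 0\<close> one has \<open>rot t = cos t + sin t K\<close>,
  and \<open>B K adj2 B = B B^T K\<close> because \<open>det B = 1\<close>. The numbers
  \<open>v\<close>, \<open>u\<close>, \<open>w\<close> are the entries of the symmetric matrix
  \<open>B B^T\<close> of determinant 1.\<close>

lemma conj_rot_entries: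
  assumes "det B = 1"
  defines "u \<equiv> B$1$1 * B$2$1 + B$1$2 * B$2$2"
    and "v \<equiv> (B$1$1)\<^sup>2 + (B$1$2)\<^sup>2" and "w \<equiv> (B$2$1)\<^sup>2 + (B$2$2)\<^sup>2"
  shows "B ** rot t ** adj2 B = M2 (cos t + sin t * u) (- sin t * v) (sin t * w) (cos t - sin t * u)"
    and "v * w - u\<^sup>2 = 1" and "v + w = disp B + 2"
proof -
  have ad: "B$1$1 * B$2$2 - B$1$2 * B$2$1 = 1" using assms by (simp add: det_2)
  have "B ** rot t ** adj2 B = M2 (cos t * (B$1$1 * B$2$2 - B$1$2 * B$2$1) + sin t * u) (- sin t * v) (sin t * w)
     (cos t * (B$1$1 * B$2$2 - B$1$2 * B$2$1) - sin t * u)"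
    by (simp add: mat2_eq_iff rot_def u_def v_def w_def power2_eq_square algebra_simps)
  then show "B ** rot t ** adj2 B = M2 (cos t + sin t * u) (- sin t * v) (sin t * w) (cos t - sin t * u)"
    by (simp add: ad)
  have "v * w - u\<^sup>2 = (B$1$1 * B$2$2 - B$1$2 * B$2$1)\<^sup>2"
    by (simp add: u_def v_def w_def power2_eq_square algebra_simps)
  then show "v * w - u\<^sup>2 = 1" by (simp add: ad)
  show "v + w = disp B + 2"
    using ad by (simp add: disp_def v_def w_def power2_eq_square algebra_simps)
qed

text \<open>The recursion behind Jorgensen's inequality: one conjugation step multiplies the
  displacement by \<open>(sin t)\<^sup>2 * (disp B + 4)\<close>, which is a contraction when this
  factor is below 1.\<close>

lemma disp_conj_rot:
  assumes "det B = 1"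
  shows "disp (B ** rot t ** adj2 B) = (sin t)\<^sup>2 * (disp B * (disp B + 4))"
proof -
  define u where "u = B$1$1 * B$2$1 + B$1$2 * B$2$2"
  define v where "v = (B$1$1)\<^sup>2 + (B$1$2)\<^sup>2"
  define w where "w = (B$2$1)\<^sup>2 + (B$2$2)\<^sup>2"
  note e = conj_rot_entries[OF assms, folded u_def v_def w_def]
  have "disp (B ** rot t ** adj2 B) = (sin t)\<^sup>2 * (4 * u\<^sup>2 + (v - w)\<^sup>2)"
    unfolding e(1) by (simp add: disp_def power2_eq_square algebra_simps)
  also have "4 * u\<^sup>2 + (v - w)\<^sup>2 = (v + w)\<^sup>2 - 4 * (v * w - u\<^sup>2)"
    by (simp add: power2_eq_square algebra_simps)
  also have "\<dots> = disp B * (disp B + 4)"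
    unfolding e(2,3) by (simp add: power2_eq_square algebra_simps)
  finally show ?thesis .
qed

lemma tendsto_zero_square:
  fixes f :: "nat \<Rightarrow> real"
  assumes "(\<lambda>n. (f n)\<^sup>2) \<longlonglongrightarrow> 0"
  shows "f \<longlonglongrightarrow> 0"
  using tendsto_real_sqrt[OF assms] by (simp add: tendsto_rabs_zero_iff)

text \<open>The matrices \<open>F n\<close> only approach the group of rotations about \<i> and need
  not converge. Since rotations commute with \<open>rot t\<close>, the conjugates converge
  nevertheless: \<open>u\<close> and \<open>v - w\<close> tend to 0, and \<open>v + w\<close> to
  2.\<close>

lemma conj_rot_tendsto:
  fixes F :: "nat \<Rightarrow> real^2^2"
  assumes det: "\<And>n. det (F n) = 1" and lim: "(\<lambda>n. disp (F n)) \<longlonglongrightarrow> 0"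
  shows "(\<lambda>n. F n ** rot t ** adj2 (F n)) \<longlonglongrightarrow> rot t"
proof -
  define u where "u n = F n$1$1 * F n$2$1 + F n$1$2 * F n$2$2" for n
  define v where "v n = (F n$1$1)\<^sup>2 + (F n$1$2)\<^sup>2" for n
  define w where "w n = (F n$2$1)\<^sup>2 + (F n$2$2)\<^sup>2" for n
  note e = conj_rot_entries[OF det, folded u_def v_def w_def]
  have s: "4 * (u n)\<^sup>2 + (v n - w n)\<^sup>2 = disp (F n) * (disp (F n) + 4)" for n
  proof -
    have "4 * (u n)\<^sup>2 + (v n - w n)\<^sup>2 = (v n + w n)\<^sup>2 - 4 * (v n * w n - (u n)\<^sup>2)"
      by (simp add: power2_eq_square algebra_simps)
    also have "\<dots> = disp (F n) * (disp (F n) + 4)"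
      unfolding e(2,3) by (simp add: power2_eq_square algebra_simps)
    finally show ?thesis .
  qed
  have l: "(\<lambda>n. disp (F n) * (disp (F n) + 4)) \<longlonglongrightarrow> 0"
    using tendsto_mult[OF lim tendsto_add[OF lim tendsto_const[of 4]]] by simp
  have "(\<lambda>n. (u n)\<^sup>2) \<longlonglongrightarrow> 0"
  proof (rule Lim_null_comparison[OF _ l], intro always_eventually allI)
    fix n
    have "(u n)\<^sup>2 \<le> 4 * (u n)\<^sup>2 + (v n - w n)\<^sup>2" by simp
    then show "norm ((u n)\<^sup>2) \<le> disp (F n) * (disp (F n) + 4)" unfolding s by simp
  qed
  then have u: "u \<longlonglongrightarrow> 0" by (rule tendsto_zero_square)
  have "(\<lambda>n. (v n - w n)\<^sup>2) \<longlonglongrightarrow> 0"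
  proof (rule Lim_null_comparison[OF _ l], intro always_eventually allI)
    fix n
    have "(v n - w n)\<^sup>2 \<le> 4 * (u n)\<^sup>2 + (v n - w n)\<^sup>2" by simp
    then show "norm ((v n - w n)\<^sup>2) \<le> disp (F n) * (disp (F n) + 4)" unfolding s by simp
  qed
  then have vw: "(\<lambda>n. v n - w n) \<longlonglongrightarrow> 0" by (rule tendsto_zero_square)
  have vw': "(\<lambda>n. v n + w n) \<longlonglongrightarrow> 2"
    unfolding e(3) using tendsto_add[OF lim tendsto_const[of 2]] by simp
  have v: "v \<longlonglongrightarrow> 1" using tendsto_mult[OF tendsto_add[OF vw' vw] tendsto_const[of "1/2"]] by simp
  have w: "w \<longlonglongrightarrow> 1" using tendsto_mult[OF tendsto_diff[OF vw' vw] tendsto_const[of "1/2"]] by simp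
  show ?thesis unfolding e(1)
    by (rule tendsto_mat2I) (auto simp: rot_def intro!: tendsto_eq_intros u v w)
qed

lemma islimpt_conj:
  fixes P Q :: "real^2^2"
  assumes PQ: "P ** Q = mat 1" and "mat 1 islimpt X"
  shows "mat 1 islimpt (\<lambda>A. P ** A ** Q) ` X"
proof -
  obtain f where f: "\<And>n::nat. f n \<in> X - {mat 1}" "f \<longlonglongrightarrow> mat 1"
    using assms(2) unfolding islimpt_sequential by blast
  have "(\<lambda>n. P ** f n ** Q) \<longlonglongrightarrow> P ** mat 1 ** Q"
    by (intro tendsto_matrix_mult_2 f(2) tendsto_const)
  then have "(\<lambda>n. P ** f n ** Q) \<longlonglongrightarrow> mat 1" using PQ by simp
  moreover have "P ** f n ** Q \<noteq> mat 1" for n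
    using f(1)[of n] conj_cancel[OF matrix_inverse_swap[OF PQ], of "f n"] matrix_inverse_swap[OF PQ] by auto
  ultimately show ?thesis unfolding islimpt_sequential using f(1)
    by (intro exI[of _ "\<lambda>n. P ** f n ** Q"]) auto
qed

text \<open>The iterates of \<open>C \<mapsto> C A C\<^sup>-\<^sup>1\<close> from \<open>B\<close> converge to the rotation \<open>A\<close> without ever reaching it.\<close>

lemma jorgensen_rot:
  assumes X: "msemi X" and mem: "rot t \<in> X" "rot (- t) \<in> X" "B \<in> X" "adj2 B \<in> X"
    and det: "det B = 1" and t: "sin t \<noteq> 0" and B: "disp B > 0"
    and small: "(sin t)\<^sup>2 * (disp B + 4) < 1"
  shows "mat 1 islimpt X"
proof -
  define F where "F = rec_nat B (\<lambda>_ C. C ** rot t ** adj2 C)"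
  have F0: "F 0 = B" and FS: "F (Suc n) = F n ** rot t ** adj2 (F n)" for n
    by (simp_all add: F_def)
  have detF: "det (F n) = 1" for n
    by (induction n) (simp_all add: F0 FS det det_mul)
  have FX: "F n \<in> X \<and> adj2 (F n) \<in> X" for n
  proof (induction n)
    case (Suc n)
    have "adj2 (F (Suc n)) = F n ** rot (- t) ** adj2 (F n)"
      by (simp add: FS adj2_mult adj2_rot matrix_mul_assoc)
    then show ?case using Suc X mem by (simp add: FS msemi_def)
  qed (use mem F0 in simp)
  \<comment> \<open>The displacement never exceeds its initial value, so \<open>q\<close> bounds the
    contraction factor of every step.\<close>
  define q where "q = (sin t)\<^sup>2 * (disp B + 4)"
  have q: "0 \<le> q" "q < 1" using small disp_nonneg[of B] by (simp_all add: q_def)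
  have dS: "disp (F (Suc n)) = (sin t)\<^sup>2 * (disp (F n) * (disp (F n) + 4))" for n
    unfolding FS by (rule disp_conj_rot[OF detF])
  have pos: "disp (F n) > 0" for n
  proof (induction n)
    case (Suc n) then show ?case unfolding dS using t by (simp add: add_pos_pos)
  qed (use F0 B in simp)
  have bound: "disp (F n) \<le> q ^ n * disp B" for n
  proof (induction n)
    case (Suc n)
    have "q ^ n * disp B \<le> disp B" using q B by (simp add: mult_left_le_one_le power_le_one)
    then have "disp (F n) \<le> disp B" using Suc by simp
    have "disp (F (Suc n)) = (sin t)\<^sup>2 * (disp (F n) + 4) * disp (F n)" by (simp add: dS)
    also have "\<dots> \<le> q * disp (F n)"
      unfolding q_def using \<open>disp (F n) \<le> disp B\<close> pos[of n]
      by (intro mult_right_mono mult_left_mono) auto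
    also have "\<dots> \<le> q * (q ^ n * disp B)" using Suc q by (intro mult_left_mono) auto
    finally show ?case by (simp add: mult.assoc)
  qed (simp add: F0)
  have "(\<lambda>n. q ^ n * disp B) \<longlonglongrightarrow> 0"
    using tendsto_mult[OF LIMSEQ_realpow_zero[OF q] tendsto_const[of "disp B"]] by simp
  then have "(\<lambda>n. disp (F n)) \<longlonglongrightarrow> 0"
    by (rule Lim_null_comparison[rotated])
      (use bound pos less_imp_le in \<open>auto intro!: always_eventually simp: abs_of_pos\<close>)
  then have "(\<lambda>n. F n ** rot t ** adj2 (F n)) \<longlonglongrightarrow> rot t"
    by (rule conj_rot_tendsto[OF detF])
  then have "(\<lambda>n. F (Suc n) ** rot (- t)) \<longlonglongrightarrow> rot t ** rot (- t)"
    unfolding FS by (intro tendsto_matrix_mult_2 tendsto_const)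
  then have lim: "(\<lambda>n. F (Suc n) ** rot (- t)) \<longlonglongrightarrow> mat 1" by (simp add: rot_add[symmetric])
  have "F (Suc n) ** rot (- t) \<noteq> mat 1" for n
  proof
    assume "F (Suc n) ** rot (- t) = mat 1"
    then have "F (Suc n) ** (rot (- t) ** rot t) = rot t"
      by (metis matrix_mul_assoc matrix_mul_lid)
    then have "F (Suc n) = rot t" by (simp add: rot_add[symmetric])
    then show False using pos[of "Suc n"] by (simp add: disp_def rot_def)
  qed
  then show ?thesis unfolding islimpt_sequential
    using lim FX mem(2) X by (intro exI[of _ "\<lambda>n. F (Suc n) ** rot (- t)"]) (auto simp: msemi_def)
qed

lemma trace_elliptic_angle:
  assumes "\<bar>x\<bar> < (2::real)"
  obtains t where "x = 2 * cos t" "sin t \<noteq> 0"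
proof
  show "x = 2 * cos (arccos (x / 2))" using assms by (simp add: cos_arccos_abs)
  show "sin (arccos (x / 2)) \<noteq> 0" using assms by (intro sin_arccos_nonzero) auto
qed

text \<open>After conjugating \<open>A\<close> to \<open>rot s\<close> one has
  \<open>gam A B = (sin s)\<^sup>2 * disp\<close> of the conjugate of \<open>B\<close>, and
  \<open>4 - (trace A)\<^sup>2 = 4 * (sin s)\<^sup>2\<close>. Their sum, the quantity in Jorgensen's
  inequality, is thus the contraction factor of the iteration for rotations.\<close>

lemma jorgensen:
  assumes X: "msemi X" and mem: "A \<in> X" "adj2 A \<in> X" "B \<in> X" "adj2 B \<in> X"
    and det: "det A = 1" "det B = 1" and tr: "\<bar>trace A\<bar> < 2"
    and g: "gam A B > 0" "gam A B + 4 - (trace A)\<^sup>2 < 1"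
  shows "mat 1 islimpt X"
proof -
  obtain t where t: "trace A = 2 * cos t" "sin t \<noteq> 0" using trace_elliptic_angle[OF tr] .
  obtain P Q s where PQ: "P ** Q = mat 1" and A: "A = P ** rot s ** Q" and s: "s = t \<or> s = - t"
    using elliptic_conj_rot[OF det(1) t] by metis
  note QP = matrix_inverse_swap[OF PQ]
  define f where "f = (\<lambda>M. Q ** M ** P)"
  have fA: "f A = rot s" using conj_cancel[OF QP, of "rot s"] by (simp add: f_def A)
  have ss: "sin s \<noteq> 0" using s t by auto
  have "gam A B = gam (rot s) (f B)"
    using gam_conj[OF PQ det] fA by (simp add: f_def)
  also have "\<dots> = (sin s)\<^sup>2 * disp (f B)"
    by (rule gam_rot) (simp add: f_def det_conj[OF PQ] det)
  finally have gs: "gam A B = (sin s)\<^sup>2 * disp (f B)" .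
  have fadj: "f (adj2 M) = adj2 (f M)" if "det M = 1" for M
    using adj2_conj[OF PQ that] by (simp add: f_def)
  have "mat 1 islimpt f ` X"
  proof (rule jorgensen_rot)
    show "msemi (f ` X)" using X unfolding msemi_def f_def
      by (auto simp: conj_mult[OF PQ, symmetric])
    show "rot s \<in> f ` X" using mem(1) fA by (metis imageI)
    show "rot (- s) \<in> f ` X" using mem(2) fadj[OF det(1)] fA by (metis imageI adj2_rot)
    show "f B \<in> f ` X" using mem(3) by simp
    show "adj2 (f B) \<in> f ` X" using mem(4) fadj[OF det(2)] by (metis imageI)
    show "det (f B) = 1" by (simp add: f_def det_conj[OF PQ] det)
    show "sin s \<noteq> 0" by (rule ss)
    show "disp (f B) > 0" using g(1) ss gs disp_nonneg[of "f B"] by (cases "disp (f B) = 0") auto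
    have "(trace A)\<^sup>2 = 4 * (cos s)\<^sup>2" using t(1) s by (auto simp: power_mult_distrib)
    then have "4 - (trace A)\<^sup>2 = 4 * (sin s)\<^sup>2" by (simp add: sin_squared_eq)
    then show "(sin s)\<^sup>2 * (disp (f B) + 4) < 1" using g(2) gs by (simp add: algebra_simps)
  qed
  then have "mat 1 islimpt (\<lambda>A. P ** A ** Q) ` f ` X" by (rule islimpt_conj[OF PQ])
  also have "(\<lambda>A. P ** A ** Q) ` f ` X = X"
    by (simp add: image_image f_def conj_cancel[OF PQ])
  finally show ?thesis .
qed

text \<open>The closure of a semigroup containing all rotations about a point is closed under inverses.\<close>

lemma adj2_rot_conj:
  obtains u v where "adj2 F = rot u ** F ** rot v"
proof -
  \<comment> \<open>Split \<open>F\<close> into \<open>r rot p\<close> and a symmetric traceless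
    part \<open>S\<close>; passing to \<open>adj2 F\<close> changes \<open>p\<close> to
    \<open>- p\<close> and \<open>S\<close> to \<open>- S\<close>. Since
    \<open>S rot v = rot (- v) S\<close>, multiplying by \<open>rot u\<close> and
    \<open>rot v\<close> adds \<open>u + v\<close> to the angle \<open>p\<close> and turns
    \<open>S\<close> into \<open>rot (u - v) S\<close>. The choice below solves
    \<open>u + v = - 2 * p\<close> and \<open>u - v = pi\<close>.\<close>
  obtain r p where rp: "(F$1$1 + F$2$2) / 2 = r * cos p" "(F$2$1 - F$1$2) / 2 = r * sin p"
    using polar_Ex by metis
  have a: "F$1$1 = r * cos p + (F$1$1 - F$2$2) / 2" "F$2$2 = r * cos p - (F$1$1 - F$2$2) / 2"
    using rp(1) by (simp_all add: field_simps)
  have b: "F$2$1 = r * sin p + (F$1$2 + F$2$1) / 2" "F$1$2 = (F$1$2 + F$2$1) / 2 - r * sin p"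
    using rp(2) by (simp_all add: field_simps)
  define x where "x = (F$1$1 - F$2$2) / 2"
  define y where "y = (F$1$2 + F$2$1) / 2"
  note e = a[folded x_def] b[folded y_def]
  define c s where cs: "c = cos p" "s = sin p"
  have sc: "c * c + s * s = 1"
    unfolding cs by (metis power2_eq_square sin_cos_squared_add2)
  have F: "F = M2 (r * c + x) (y - r * s) (r * s + y) (r * c - x)"
    using e by (simp add: mat2_eq_iff cs)
  have R: "rot (pi / 2 - p) = M2 s (- c) c s" "rot (- p - pi / 2) = M2 (- s) c (- c) (- s)"
    by (simp_all add: rot_def cs sin_diff cos_diff)
  have cc: "c * c = 1 - s * s" using sc by simp
  have cc': "c * (c * z) = z - s * (s * z)" for z using cc by (metis left_diff_distrib mult.assoc mult_1)
  have "adj2 F = rot (pi / 2 - p) ** F ** rot (- p - pi / 2)"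
    unfolding R F by (simp add: mat2_eq_iff algebra_simps cc cc')
  then show thesis by (rule that)
qed

text \<open>The condition \<open>gam A B > 0\<close> in \<open>pair\<close> excludes pairs in one
  cyclic semigroup: their lifts commute up to sign, so \<open>gam\<close> would be 0 or -4. As
  \<open>P\<close> varies, the image of \<i> runs through the upper half-plane, so
  \<open>no_interior_fixpoint\<close> excludes a common fixed point there.\<close>

locale pairwise_semidiscrete =
  fixes \<Sigma> :: "(real^2^2) set"
  assumes det_one: "A \<in> \<Sigma> \<Longrightarrow> det A = 1"
    and msemi: "msemi \<Sigma>"
    and neg: "A \<in> \<Sigma> \<Longrightarrow> - A \<in> \<Sigma>"
    and pair: "A \<in> \<Sigma> \<Longrightarrow> B \<in> \<Sigma> \<Longrightarrow> gam A B > 0 \<Longrightarrow> \<not> mat 1 islimpt msg {A, B}"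
    and no_interior_fixpoint: "P ** Q = mat 1 \<Longrightarrow> det P > 0 \<Longrightarrow> \<exists>A\<in>\<Sigma>. disp (Q ** A ** P) \<noteq> 0"
begin

text \<open>Powers of an elliptic element of infinite order accumulate at the identity. As
  \<open>A\<close> alone generates a cyclic semigroup, it is paired with some \<open>B\<close> that
  moves its fixed point, which makes \<open>gam A B\<close> positive and brings \<open>pair\<close>
  to bear.\<close>

lemma elliptic_finite_order:
  assumes A: "A \<in> \<Sigma>" and tr: "\<bar>trace A\<bar> < 2"
  obtains (finish) n where "n > 0" "mpow A n = mat 1"
proof (rule ccontr)
  assume "\<not> thesis"
  then have *: "mpow A n \<noteq> mat 1" if "n > 0" for n
    using finish that by blast
  obtain t where t: "trace A = 2 * cos t" "sin t \<noteq> 0" using trace_elliptic_angle[OF tr] .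
  obtain P Q s where PQ: "P ** Q = mat 1" "det P > 0" and A': "A = P ** rot s ** Q" and s: "s = t \<or> s = - t"
    using elliptic_conj_rot[OF det_one[OF A] t] by metis
  note QP = matrix_inverse_swap[OF PQ(1)]
  obtain B where B: "B \<in> \<Sigma>" "disp (Q ** B ** P) \<noteq> 0" using no_interior_fixpoint[OF PQ] by blast
  have "gam A B = gam (Q ** A ** P) (Q ** B ** P)"
    using gam_conj[OF PQ(1)] det_one A B by simp
  also have "\<dots> = gam (rot s) (Q ** B ** P)"
    using conj_cancel[OF QP, of "rot s"] by (simp add: A')
  also have "\<dots> = (sin s)\<^sup>2 * disp (Q ** B ** P)"
    by (rule gam_rot) (simp add: det_conj[OF PQ(1)] det_one B)
  also have "\<dots> > 0" using s t B(2) disp_nonneg[of "Q ** B ** P"] by auto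
  finally have nl: "\<not> mat 1 islimpt msg {A, B}" by (rule pair[OF A B(1)])
  define R where "R = {rot (real n * s) | n. n > 0}"
  have Am: "mpow A n = P ** rot (real n * s) ** Q" for n
    unfolding A' mpow_conj[OF QP] mpow_rot ..
  have "rot (real n * s) \<noteq> mat 1" if "n > 0" for n
  proof
    assume "rot (real n * s) = mat 1"
    then have "mpow A n = mat 1" by (simp add: Am PQ)
    then show False using * that by blast
  qed
  then have "mat 1 islimpt R"
    unfolding islimpt_approachable R_def using rot_recurrent[of _ s] by (smt (verit) mem_Collect_eq)
  then have "mat 1 islimpt (\<lambda>A. P ** A ** Q) ` R" by (rule islimpt_conj[OF PQ(1)])
  moreover have "(\<lambda>A. P ** A ** Q) ` R \<subseteq> msg {A, B}"
    using mpow_mem[OF msemi_msg msg.base, of A "{A, B}"] by (auto simp: R_def Am[symmetric])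
  ultimately show False using nl islimpt_subset by blast
qed

lemma adj2_elliptic_mem:
  assumes A: "A \<in> \<Sigma>" and tr: "\<bar>trace A\<bar> < 2" and X: "msemi X" "A \<in> X"
  shows "adj2 A \<in> X"
proof -
  obtain n where n: "n > 0" "mpow A n = mat 1" using elliptic_finite_order[OF A tr] .
  \<comment> \<open>Doubling keeps the exponent \<open>n + n - 1\<close> of the inverse positive
    even for \<open>n = 1\<close>.\<close>
  have "mpow A (n + n) = mat 1" by (simp add: mpow_add n)
  moreover have "n + n = Suc (n + n - 1)" using n by simp
  ultimately have "A ** mpow A (n + n - 1) = mat 1" by (metis mpow.simps(2))
  then have "mpow A (n + n - 1) = adj2 A" by (rule adj2_unique[OF det_one[OF A]])
  moreover have "mpow A (n + n - 1) \<in> X" using n by (intro mpow_mem X) simp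
  ultimately show ?thesis by simp
qed

abbreviation "CL \<equiv> closure \<Sigma>"

text \<open>The contradiction has to come from elements of \<open>\<Sigma>\<close>, to which alone
  \<open>pair\<close> applies. The inequalities required by \<open>jorgensen\<close> are strict and
  involve only traces and \<open>gam\<close>, so they pass from two suitable limits to elements of
  \<open>\<Sigma>\<close> near them. Those are elliptic of finite order, hence their inverses are
  powers and lie in the semigroup generated by the two.\<close>

lemma no_irrational_rotation:
  assumes A: "A \<in> CL" and tr: "trace A = 2 * cos t" and t: "t / (2 * pi) \<notin> \<rat>"
  shows False
proof -
  have st: "sin t \<noteq> 0"
  proof
    assume "sin t = 0"
    then obtain i where "t = of_int i * pi" unfolding sin_zero_iff_int2 by blast
    then have "t / (2 * pi) = of_int i / 2" by simp
    moreover have "of_int i / 2 \<in> (\<rat> :: real set)" by simp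
    ultimately show False using t by metis
  qed
  have detA: "det A = 1" using det_closure[OF _ A] det_one by blast
  obtain P Q s where PQ: "P ** Q = mat 1" "det P > 0" and A': "A = P ** rot s ** Q" and s: "s = t \<or> s = - t"
    using elliptic_conj_rot[OF detA tr st] by metis
  note QP = matrix_inverse_swap[OF PQ(1)]
  note CLs = msemi_closure[OF msemi]
  have mult: "P ** (M ** N) ** Q \<in> CL" if "P ** M ** Q \<in> CL" "P ** N ** Q \<in> CL" for M N
    using CLs that by (simp add: conj_mult[OF QP] msemi_def)
  have s': "s / (2 * pi) \<notin> \<rat>" using s t by auto
  have rotC: "P ** rot u ** Q \<in> CL" for u
  proof -
    define R where "R = {rot (real n * s) | n. n > 0}"
    have "rot u \<in> closure R"
      unfolding closure_approachable R_def using rot_dense[OF s', of _ u] by (smt (verit) mem_Collect_eq)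
    moreover have "(\<lambda>M. P ** M ** Q) ` closure R \<subseteq> CL"
    proof (rule image_closure_subset)
      show "continuous_on (closure R) (\<lambda>M. P ** M ** Q)"
        unfolding continuous_on_def by (intro ballI tendsto_matrix_mult_2 tendsto_const tendsto_ident_at)
      have "mpow A n \<in> CL" if "n > 0" for n by (rule mpow_mem[OF CLs A that])
      moreover have Am: "mpow A n = P ** rot (real n * s) ** Q" for n
        unfolding A' mpow_conj[OF QP] mpow_rot ..
      ultimately show "(\<lambda>M. P ** M ** Q) ` R \<subseteq> CL" by (auto simp: R_def)
    qed simp
    ultimately show ?thesis by blast
  qed
  obtain f where f: "f \<in> \<Sigma>" "disp (Q ** f ** P) \<noteq> 0" using no_interior_fixpoint[OF PQ] by blast
  define F where "F = Q ** f ** P"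
  have F: "P ** F ** Q \<in> CL" using f closure_subset by (auto simp: F_def conj_cancel[OF PQ(1)])
  have detF: "det F = 1" by (simp add: F_def det_conj[OF PQ(1)] det_one f)
  have dF: "disp F > 0" using f(2) disp_nonneg[of F] by (simp add: F_def)
  obtain u v where "adj2 F = rot u ** F ** rot v" using adj2_rot_conj .
  then have F': "P ** adj2 F ** Q \<in> CL" using mult rotC F by simp
  define m where "m = disp F * (disp F + 4)"
  have m: "m > 0" using dF by (simp add: m_def add_pos_pos)
  \<comment> \<open>\<open>\<sigma>\<close> will be \<open>(sin \<theta>)\<^sup>2\<close> for both
    rotations. Then \<open>gam\<close> is \<open>\<sigma> * (\<sigma> * m)\<close>, at most
    \<open>\<sigma>\<close>, and Jorgensen's quantity is at most \<open>5 * \<sigma>\<close>, which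
    is less than \<open>5 / 8\<close>.\<close>
  define \<sigma> where "\<sigma> = 1 / (8 + m)"
  have \<sigma>: "0 < \<sigma>" "\<sigma> < 1 / 8" "\<sigma> * m < 1" using m by (auto simp: \<sigma>_def field_simps)
  define \<theta> where "\<theta> = arcsin (sqrt \<sigma>)"
  have "sqrt \<sigma> \<le> 1" using \<sigma> by simp
  moreover have "0 \<le> sqrt \<sigma>" using \<sigma> by simp
  ultimately have "sin \<theta> = sqrt \<sigma>" unfolding \<theta>_def by (intro sin_arcsin) linarith+
  then have sin\<theta>: "(sin \<theta>)\<^sup>2 = \<sigma>" using \<sigma> by simp
  define B where "B = F ** rot \<theta> ** adj2 F"
  have detB: "det B = 1" by (simp add: B_def det_mul detF)
  have gB: "gam (rot \<theta>) B = \<sigma> * (\<sigma> * m)"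
    using gam_rot[OF detB, of \<theta>] disp_conj_rot[OF detF, of \<theta>] by (simp add: B_def sin\<theta> m_def)
  have "P ** rot \<theta> ** Q \<in> CL" "P ** B ** Q \<in> CL"
    unfolding B_def using mult rotC F F' by simp_all
  then obtain a b where ab: "\<And>n. a n \<in> \<Sigma>" "a \<longlonglongrightarrow> P ** rot \<theta> ** Q" "\<And>n. b n \<in> \<Sigma>" "b \<longlonglongrightarrow> P ** B ** Q"
    unfolding closure_sequential by metis
  have g: "(\<lambda>n. gam (a n) (b n)) \<longlonglongrightarrow> \<sigma> * (\<sigma> * m)"
    using tendsto_gam[OF ab(2,4)] unfolding gam_conj[OF QP det_rot detB] gB .
  have ta: "(\<lambda>n. trace (a n)) \<longlonglongrightarrow> 2 * cos \<theta>"
    using tendsto_trace_2[OF ab(2)] unfolding trace_conj[OF QP] by (simp add: rot_def trace_2)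
  have "trace B = trace (rot \<theta>)"
    unfolding B_def by (rule trace_conj[OF adj2_inverse(2)[OF detF]])
  then have tb: "(\<lambda>n. trace (b n)) \<longlonglongrightarrow> 2 * cos \<theta>"
    using tendsto_trace_2[OF ab(4)] unfolding trace_conj[OF QP] by (simp add: rot_def trace_2)
  have cos1: "\<bar>2 * cos \<theta>\<bar> < 2"
  proof -
    have "(cos \<theta>)\<^sup>2 < 1" using sin\<theta> \<sigma> by (simp add: cos_squared_eq)
    then show ?thesis by (simp add: abs_square_less_1)
  qed
  have e1: "\<forall>\<^sub>F n in sequentially. gam (a n) (b n) > 0"
    using g \<sigma> m by (intro order_tendstoD(1)[OF g]) simp
  have "(\<lambda>n. gam (a n) (b n) + 4 - (trace (a n))\<^sup>2) \<longlonglongrightarrow> \<sigma> * (\<sigma> * m) + 4 - (2 * cos \<theta>)\<^sup>2"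
    by (intro tendsto_intros g ta)
  moreover have "\<sigma> * (\<sigma> * m) + 4 - (2 * cos \<theta>)\<^sup>2 < 1"
  proof -
    have "(2 * cos \<theta>)\<^sup>2 = 4 - 4 * \<sigma>" using sin\<theta> by (simp add: cos_squared_eq power_mult_distrib)
    moreover have "\<sigma> * (\<sigma> * m) \<le> \<sigma> * 1" using \<sigma> by (intro mult_left_mono) auto
    ultimately show ?thesis using \<sigma> by linarith
  qed
  ultimately have e2: "\<forall>\<^sub>F n in sequentially. gam (a n) (b n) + 4 - (trace (a n))\<^sup>2 < 1"
    by (rule order_tendstoD(2))
  have e3: "\<forall>\<^sub>F n in sequentially. \<bar>trace (a n)\<bar> < 2"
    using order_tendstoD(2)[OF tendsto_rabs[OF ta] cos1] .
  have e4: "\<forall>\<^sub>F n in sequentially. \<bar>trace (b n)\<bar> < 2"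
    using order_tendstoD(2)[OF tendsto_rabs[OF tb] cos1] .
  obtain n where n: "gam (a n) (b n) > 0" "gam (a n) (b n) + 4 - (trace (a n))\<^sup>2 < 1"
    "\<bar>trace (a n)\<bar> < 2" "\<bar>trace (b n)\<bar> < 2"
    using eventually_happens'[OF sequentially_bot eventually_conj[OF e1 eventually_conj[OF e2 eventually_conj[OF e3 e4]]]]
    by blast
  let ?X = "msg {a n, b n}"
  have mem: "a n \<in> ?X" "b n \<in> ?X" by (auto intro: msg.base)
  have "mat 1 islimpt ?X"
    by (rule jorgensen[OF msemi_msg mem(1) adj2_elliptic_mem[OF ab(1) n(3) msemi_msg mem(1)]
          mem(2) adj2_elliptic_mem[OF ab(3) n(4) msemi_msg mem(2)] det_one[OF ab(1)] det_one[OF ab(3)]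
          n(3,1,2)])
  then show False using pair[OF ab(1) ab(3) n(1)] by blast
qed

end

section \<open>One-parameter semigroups in the closure\<close>

text \<open>\<open>C k\<close> and \<open>T k\<close> are the coefficients of the
  \<open>k\<close>-th power of \<open>\<tau> + \<nu> Y\<close>, for a matrix \<open>Y\<close> whose
  square is the scalar \<open>\<delta>\<close>; the invariant
  \<open>C\<^sup>2 - \<delta> T\<^sup>2 = 1\<close> is the determinant. As long as \<open>T\<close>
  is below \<open>t\<close>, \<open>C\<close> stays above \<open>c\<close> and each step raises
  \<open>T\<close> by at least \<open>\<nu> * c / 2\<close>. So \<open>t\<close> is reached, and the
  first index that does so overshoots by no more than one step. Positivity of \<open>C\<close> there
  selects the positive square root.\<close>

lemma power_coefficients_reach:
  fixes C T :: "nat \<Rightarrow> real"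
  assumes init: "C 0 = 1" "T 0 = 0"
    and CS: "\<And>k. C (Suc k) = \<tau> * C k + \<nu> * \<delta> * T k"
    and TS: "\<And>k. T (Suc k) = \<tau> * T k + \<nu> * C k"
    and \<tau>: "\<tau> > 0" "\<tau>\<^sup>2 = 1 + \<nu>\<^sup>2 * \<delta>" and \<nu>: "\<nu> > 0" and t: "t > 0"
    and c: "c > 0" "c\<^sup>2 \<le> 1" "c\<^sup>2 \<le> 1 + \<delta> * t\<^sup>2"
    and small: "\<bar>\<tau> - 1\<bar> * t \<le> \<nu> * c / 2" "\<nu> * \<bar>\<delta>\<bar> * t < \<tau> * c"
    and D: "\<bar>\<delta>\<bar> \<le> D"
  obtains k where "k > 0" "t \<le> T k" "T k \<le> t + \<bar>\<tau> - 1\<bar> * t + \<nu> * (1 + D * t\<^sup>2)"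
    "C k = sqrt (1 + \<delta> * (T k)\<^sup>2)"
proof -
  have inv: "(C k)\<^sup>2 = 1 + \<delta> * (T k)\<^sup>2" for k
  proof (induction k)
    case (Suc k)
    have "(C (Suc k))\<^sup>2 - \<delta> * (T (Suc k))\<^sup>2 = (\<tau>\<^sup>2 - \<nu>\<^sup>2 * \<delta>) * ((C k)\<^sup>2 - \<delta> * (T k)\<^sup>2)"
      unfolding CS TS by (simp add: power2_eq_square algebra_simps)
    then show ?case using Suc \<tau>(2) by simp
  qed (simp add: init)
  have lower: "c\<^sup>2 \<le> 1 + \<delta> * x\<^sup>2" if "0 \<le> x" "x \<le> t" for x
  proof (cases "\<delta> \<ge> 0")
    case True
    then have "0 \<le> \<delta> * x\<^sup>2" by simp
    then show ?thesis using c(2) by linarith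
  next
    case False
    have "x\<^sup>2 \<le> t\<^sup>2" using that by simp
    then have "\<delta> * t\<^sup>2 \<le> \<delta> * x\<^sup>2" using False by (intro mult_left_mono_neg) auto
    then show ?thesis using c(3) by simp
  qed
  have Cpos: "C (Suc k) > 0" if "C k \<ge> c" "0 \<le> T k" "T k < t" for k
  proof -
    have "\<tau> * c \<le> \<tau> * C k" using \<tau> that by simp
    moreover have "\<nu> * \<bar>\<delta>\<bar> * T k \<le> \<nu> * \<bar>\<delta>\<bar> * t" using \<nu> that by (intro mult_left_mono) auto
    moreover have "\<bar>\<nu> * \<delta> * T k\<bar> = \<nu> * \<bar>\<delta>\<bar> * T k" using \<nu> that by (simp add: abs_mult)
    ultimately show ?thesis unfolding CS using small(2) by linarith
  qed
  have incr: "C k \<ge> c \<and> T k \<ge> real k * (\<nu> * c / 2)" if "\<forall>j\<le>k. T j < t" for k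
    using that
  proof (induction k)
    case 0 show ?case using init c by (simp add: power_le_one_iff abs_square_le_1)
  next
    case (Suc k)
    then have IH: "C k \<ge> c" "T k \<ge> real k * (\<nu> * c / 2)" and Tt: "T k < t" "T (Suc k) < t" by auto
    have "0 \<le> real k * (\<nu> * c / 2)" using \<nu> c by simp
    then have T0: "T k \<ge> 0" using IH by linarith
    have "C (Suc k) > 0" by (rule Cpos[OF IH(1) T0 Tt(1)])
    have "\<bar>(\<tau> - 1) * T k\<bar> \<le> \<bar>\<tau> - 1\<bar> * t"
      unfolding abs_mult using T0 Tt by (intro mult_left_mono) auto
    then have "(\<tau> - 1) * T k \<ge> - (\<nu> * c / 2)" using small(1) by linarith
    moreover have "\<nu> * C k \<ge> \<nu> * c" using \<nu> IH by simp
    ultimately have "T (Suc k) \<ge> T k + \<nu> * c / 2" unfolding TS by (simp add: algebra_simps)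
    then have TSk: "T (Suc k) \<ge> real (Suc k) * (\<nu> * c / 2)" using IH(2) by (simp add: algebra_simps)
    moreover have "0 \<le> real (Suc k) * (\<nu> * c / 2)" using \<nu> c by simp
    ultimately have "c\<^sup>2 \<le> (C (Suc k))\<^sup>2" unfolding inv using lower Tt(2) by fastforce
    then have "c \<le> C (Suc k)" using \<open>C (Suc k) > 0\<close> c(1) power2_le_imp_le by fastforce
    then show ?case using TSk by blast
  qed
  have ex: "\<exists>k. t \<le> T k"
  proof (rule ccontr)
    assume "\<not> ?thesis"
    then have all: "T j < t" for j using not_less by blast
    have "\<nu> * c / 2 > 0" using \<nu> c by simp
    then obtain k where "t < real k * (\<nu> * c / 2)" using ex_less_of_nat_mult by blast
    then show False using incr[of k] all all[of k] by fastforce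
  qed
  define K where "K = (LEAST k. t \<le> T k)"
  have K: "t \<le> T K" unfolding K_def by (rule LeastI_ex[OF ex])
  have less: "T j < t" if "j < K" for j using not_less_Least that unfolding K_def by fastforce
  have K0: "K > 0" using K init t by (cases K) auto
  then obtain k where k: "K = Suc k" by (cases K) auto
  have P: "C k \<ge> c" "T k \<ge> real k * (\<nu> * c / 2)" using incr[of k] less k by auto
  have "0 \<le> real k * (\<nu> * c / 2)" using \<nu> c by simp
  then have T0: "T k \<ge> 0" using P by linarith
  have Tk: "T k < t" using less k by simp
  have "(C k)\<^sup>2 \<le> 1 + D * t\<^sup>2"
  proof -
    have "\<delta> * (T k)\<^sup>2 \<le> D * (T k)\<^sup>2" using D by (intro mult_right_mono) auto
    also have "\<dots> \<le> D * t\<^sup>2" using D T0 Tk by (intro mult_left_mono power_mono) auto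
    finally show ?thesis by (simp add: inv)
  qed
  also have "\<dots> \<le> (1 + D * t\<^sup>2)\<^sup>2"
  proof -
    have "0 \<le> D * t\<^sup>2" using D by (intro mult_nonneg_nonneg) auto
    then have "1 * (1 + D * t\<^sup>2) \<le> (1 + D * t\<^sup>2) * (1 + D * t\<^sup>2)" by (intro mult_right_mono) auto
    then show ?thesis by (simp only: power2_eq_square mult_1)
  qed
  finally have "C k \<le> 1 + D * t\<^sup>2"
    by (rule power2_le_imp_le) (use D in \<open>auto intro!: add_nonneg_nonneg mult_nonneg_nonneg\<close>)
  then have Ck: "\<nu> * C k \<le> \<nu> * (1 + D * t\<^sup>2)" using \<nu> by simp
  have "\<bar>(\<tau> - 1) * T k\<bar> \<le> \<bar>\<tau> - 1\<bar> * t"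
    unfolding abs_mult using T0 Tk by (intro mult_left_mono) auto
  then have "T K \<le> t + \<bar>\<tau> - 1\<bar> * t + \<nu> * (1 + D * t\<^sup>2)"
    unfolding k TS using Ck Tk by (simp add: left_diff_distrib)
  moreover have "C K = sqrt (1 + \<delta> * (T K)\<^sup>2)"
    unfolding inv[symmetric] using Cpos[OF P(1) T0 Tk] k by simp
  ultimately show thesis using that K0 K by blast
qed

text \<open>\<open>Y\<close> is a limit of the normalised traceless parts of elements tending to the
  identity. The semigroup is parametrised by the coefficient \<open>t\<close> of \<open>Y\<close>
  instead of time: determinant 1 fixes the scalar coefficient up to sign. This covers hyperbolic,
  parabolic and elliptic \<open>Y\<close> alike; the condition on
  \<open>1 - det Y * t\<^sup>2\<close> restricts only the elliptic case, to angles below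
  \<open>pi / 2\<close>.\<close>

lemma one_parameter_limit:
  fixes X :: "(real^2^2) set"
  assumes det1: "\<And>A. A \<in> X \<Longrightarrow> det A = 1" and X: "msemi X" and lim: "mat 1 islimpt X"
  obtains Y :: "real^2^2" where "Y \<noteq> 0" "trace Y = 0"
    "\<And>t. t \<ge> 0 \<Longrightarrow> 1 - det Y * t\<^sup>2 > 0 \<Longrightarrow> sqrt (1 - det Y * t\<^sup>2) *\<^sub>R mat 1 + t *\<^sub>R Y \<in> closure X"
proof -
  obtain A0 where A0: "\<And>n::nat. A0 n \<in> X - {mat 1}" "A0 \<longlonglongrightarrow> mat 1"
    using lim unfolding islimpt_sequential by blast
  have tr0: "(\<lambda>n. trace (A0 n)) \<longlonglongrightarrow> 2" using tendsto_trace_2[OF A0(2)] by (simp add: trace_2)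
  have "\<forall>\<^sub>F n in sequentially. 1 < trace (A0 n)" by (rule order_tendstoD(1)[OF tr0]) simp
  then obtain N where N: "\<And>n. n \<ge> N \<Longrightarrow> 1 < trace (A0 n)" unfolding eventually_sequentially by blast
  define A where "A n = A0 (n + N)" for n
  have A: "A n \<in> X" "A n \<noteq> mat 1" "trace (A n) > 1" for n using A0 N by (auto simp: A_def)
  have Alim: "A \<longlonglongrightarrow> mat 1" unfolding A_def using A0(2) by (rule LIMSEQ_ignore_initial_segment)
  define \<tau> where "\<tau> n = trace (A n) / 2" for n
  define Z where "Z n = A n - \<tau> n *\<^sub>R mat 1" for n
  define \<nu> where "\<nu> n = norm (Z n)" for n
  define Y where "Y n = (1 / \<nu> n) *\<^sub>R Z n" for n
  have \<tau>lim: "\<tau> \<longlonglongrightarrow> 1" unfolding \<tau>_def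
    using tendsto_divide[OF tendsto_trace_2[OF Alim] tendsto_const[of 2]] by (simp add: trace_2)
  have trZ: "Z n $ 2 $ 2 = - Z n $ 1 $ 1" for n
    by (simp add: Z_def \<tau>_def trace_2 field_simps)
  have detA: "\<tau> n * \<tau> n + det (Z n) = 1" for n
    using det1[OF A(1), of n] by (simp add: Z_def det_2 \<tau>_def trace_2 field_simps)
  have Z0: "Z n \<noteq> 0" for n
  proof
    assume 0: "Z n = 0"
    then have "\<tau> n * \<tau> n = 1" using detA[of n] by (simp add: det_2)
    moreover have "\<tau> n > 0" using A(3)[of n] by (simp add: \<tau>_def)
    ultimately have "\<tau> n = 1" by (simp add: square_eq_1_iff)
    then show False using 0 A(2)[of n] by (simp add: Z_def)
  qed
  then have \<nu>: "\<nu> n > 0" for n by (simp add: \<nu>_def)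
  have "Z \<longlonglongrightarrow> mat 1 - 1 *\<^sub>R mat 1" unfolding Z_def by (intro tendsto_intros Alim \<tau>lim)
  then have \<nu>lim: "\<nu> \<longlonglongrightarrow> 0" unfolding \<nu>_def by (simp add: tendsto_norm_zero)
  have AY: "A n = \<tau> n *\<^sub>R mat 1 + \<nu> n *\<^sub>R Y n" for n using \<nu>[of n] by (simp add: Y_def Z_def)
  have trY: "Y n $ 2 $ 2 = - Y n $ 1 $ 1" for n using trZ[of n] by (simp add: Y_def)
  define \<delta> where "\<delta> n = - det (Y n)" for n
  have \<tau>\<delta>: "(\<tau> n)\<^sup>2 = 1 + (\<nu> n)\<^sup>2 * \<delta> n" for n
  proof -
    have "det (Z n) = (\<nu> n)\<^sup>2 * det (Y n)"
      using \<nu>[of n] by (simp add: Y_def det_2 power2_eq_square field_simps)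
    then show ?thesis using detA[of n] by (simp add: \<delta>_def power2_eq_square)
  qed
  have "Y n \<in> sphere 0 1" for n using \<nu>[of n] by (simp add: Y_def \<nu>_def)
  then obtain W r where W: "W \<in> sphere 0 1" and r: "strict_mono (r :: nat \<Rightarrow> nat)" and Yr: "(Y \<circ> r) \<longlonglongrightarrow> W"
    using compact_sphere[of "0 :: real^2^2" 1] unfolding compact_def by metis
  have W0: "W \<noteq> 0" using W by auto
  have "(\<lambda>n. trace (Y (r n))) \<longlonglongrightarrow> trace W" using tendsto_trace_2[OF Yr] by (simp add: o_def)
  then have trW: "trace W = 0" unfolding trace_2 trY by (simp add: LIMSEQ_const_iff)
  have \<delta>lim: "(\<lambda>n. \<delta> (r n)) \<longlonglongrightarrow> - det W"
    unfolding \<delta>_def using tendsto_minus[OF tendsto_det_2[OF Yr]] by (simp add: o_def)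
  have \<nu>r: "(\<lambda>n. \<nu> (r n)) \<longlonglongrightarrow> 0" using LIMSEQ_subseq_LIMSEQ[OF \<nu>lim r] by (simp add: o_def)
  have \<tau>r: "(\<lambda>n. \<tau> (r n)) \<longlonglongrightarrow> 1" using LIMSEQ_subseq_LIMSEQ[OF \<tau>lim r] by (simp add: o_def)
  have main: "sqrt (1 - det W * t\<^sup>2) *\<^sub>R mat 1 + t *\<^sub>R W \<in> closure X"
    if t0: "t > 0" and q: "1 - det W * t\<^sup>2 > 0" for t
  proof -
    \<comment> \<open>The factor 1/2 makes \<open>c\<^sup>2\<close> strictly smaller than
      \<open>1 - det W * t\<^sup>2\<close>, so the bound persists for \<open>\<delta> (r n)\<close>
      with \<open>n\<close> large.\<close>
    define c where "c = sqrt (min 1 (1 - det W * t\<^sup>2) / 2)"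
    have c: "c > 0" "c\<^sup>2 \<le> 1" "c\<^sup>2 < 1 - det W * t\<^sup>2" using q by (auto simp: c_def)
    define D where "D = \<bar>det W\<bar> + 1"
    have e1: "\<forall>\<^sub>F n in sequentially. c\<^sup>2 < 1 + \<delta> (r n) * t\<^sup>2"
    proof (rule order_tendstoD(1))
      show "(\<lambda>n. 1 + \<delta> (r n) * t\<^sup>2) \<longlonglongrightarrow> 1 + (- det W) * t\<^sup>2" by (intro tendsto_intros \<delta>lim)
    qed (use c in simp)
    have e2: "\<forall>\<^sub>F n in sequentially. \<bar>\<delta> (r n)\<bar> < D"
      by (rule order_tendstoD(2)[OF tendsto_rabs[OF \<delta>lim]]) (simp add: D_def)
    have e3: "\<forall>\<^sub>F n in sequentially. \<nu> (r n) * \<bar>\<delta> (r n)\<bar> * t < c / 2"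
    proof (rule order_tendstoD(2))
      show "(\<lambda>n. \<nu> (r n) * \<bar>\<delta> (r n)\<bar> * t) \<longlonglongrightarrow> 0 * \<bar>- det W\<bar> * t" by (intro tendsto_intros \<delta>lim \<nu>r)
    qed (use c in simp)
    define good where "good n k x \<longleftrightarrow> k > 0 \<and> t \<le> x \<and>
       x \<le> t + \<bar>\<tau> (r n) - 1\<bar> * t + \<nu> (r n) * (1 + D * t\<^sup>2) \<and>
       mpow (A (r n)) k = sqrt (1 + \<delta> (r n) * x\<^sup>2) *\<^sub>R mat 1 + x *\<^sub>R Y (r n)" for n k x
    have "\<forall>\<^sub>F n in sequentially. \<exists>k x. good n k x"
      using e1 e2 e3
    proof eventually_elim
      case (elim m)
      define n where "n = r m"
      note el = elim[folded n_def]
      define F where "F = rec_nat (1, 0) (\<lambda>_ p. (\<tau> n * fst p + \<nu> n * \<delta> n * snd p, \<tau> n * snd p + \<nu> n * fst p))"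
      define C where "C k = fst (F k)" for k
      define T where "T k = snd (F k)" for k
      have rec: "C 0 = 1" "T 0 = 0" "\<And>k. C (Suc k) = \<tau> n * C k + \<nu> n * \<delta> n * T k"
        "\<And>k. T (Suc k) = \<tau> n * T k + \<nu> n * C k" by (simp_all add: C_def T_def F_def)
      have pw: "mpow (A n) k = C k *\<^sub>R mat 1 + T k *\<^sub>R Y n" for k
      proof (induction k)
        case (Suc k)
        have dY: "\<delta> n = Y n $ 1 $ 1 * Y n $ 1 $ 1 + Y n $ 1 $ 2 * Y n $ 2 $ 1"
          by (simp add: \<delta>_def det_2 trY)
        show ?case unfolding mpow.simps Suc
          by (subst AY) (simp add: mat2_eq_iff rec trY dY algebra_simps)
      qed (simp add: rec)
      have \<tau>1: "\<tau> n > 1 / 2" using A(3)[of n] by (simp add: \<tau>_def)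
      \<comment> \<open>The determinant makes \<open>\<tau> n - 1\<close> of second order in
        \<open>\<nu> n\<close>, hence negligible against the step
        \<open>\<nu> n * c / 2\<close>.\<close>
      have "(\<tau> n - 1) * (\<tau> n + 1) = (\<nu> n)\<^sup>2 * \<delta> n"
        using \<tau>\<delta>[of n] by (simp add: power2_eq_square algebra_simps)
      then have "\<bar>\<tau> n - 1\<bar> * (\<tau> n + 1) = \<nu> n * (\<nu> n * \<bar>\<delta> n\<bar>)"
        using \<tau>1 \<nu>[of n] by (metis abs_mult abs_of_pos abs_power2 add_pos_pos half_gt_zero less_trans mult.assoc power2_eq_square zero_less_one)
      moreover have "\<bar>\<tau> n - 1\<bar> * 1 \<le> \<bar>\<tau> n - 1\<bar> * (\<tau> n + 1)" using \<tau>1 by (intro mult_left_mono) auto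
      ultimately have "\<bar>\<tau> n - 1\<bar> \<le> \<nu> n * (\<nu> n * \<bar>\<delta> n\<bar>)" by simp
      then have "\<bar>\<tau> n - 1\<bar> * t \<le> \<nu> n * (\<nu> n * \<bar>\<delta> n\<bar> * t)"
        using t0 by (metis mult.assoc mult_right_mono less_imp_le)
      also have "\<dots> \<le> \<nu> n * (c / 2)" using el(3) \<nu>[of n] by (intro mult_left_mono) auto
      finally have s1: "\<bar>\<tau> n - 1\<bar> * t \<le> \<nu> n * c / 2" by simp
      have "1 / 2 * c \<le> \<tau> n * c" using \<tau>1 c by (intro mult_right_mono) auto
      then have s2: "\<nu> n * \<bar>\<delta> n\<bar> * t < \<tau> n * c" using el(3) by simp
      have tp: "\<tau> n > 0" using \<tau>1 by simp
      obtain k where "k > 0" "t \<le> T k" "T k \<le> t + \<bar>\<tau> n - 1\<bar> * t + \<nu> n * (1 + D * t\<^sup>2)"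
        "C k = sqrt (1 + \<delta> n * (T k)\<^sup>2)"
        using power_coefficients_reach[OF rec tp \<tau>\<delta> \<nu> t0 c(1,2) less_imp_le[OF el(1)] s1 s2 less_imp_le[OF el(2)]]
        by metis
      then show ?case unfolding good_def n_def[symmetric] pw by (intro exI[of _ k] exI[of _ "T k"]) simp
    qed
    then obtain M where M: "\<And>n. n \<ge> M \<Longrightarrow> \<exists>k x. good n k x"
      unfolding eventually_sequentially by blast
    then have "\<forall>n. \<exists>k x. n \<ge> M \<longrightarrow> good n k x" by blast
    then obtain k x where "\<And>n. n \<ge> M \<Longrightarrow> good n (k n) (x n)" by metis
    note kx = this[unfolded good_def]
    have "(\<lambda>n. t + \<bar>\<tau> (r n) - 1\<bar> * t + \<nu> (r n) * (1 + D * t\<^sup>2)) \<longlonglongrightarrow> t + \<bar>1 - 1\<bar> * t + 0 * (1 + D * t\<^sup>2)"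
      by (intro tendsto_intros \<tau>r \<nu>r)
    then have up: "(\<lambda>n. t + \<bar>\<tau> (r n) - 1\<bar> * t + \<nu> (r n) * (1 + D * t\<^sup>2)) \<longlonglongrightarrow> t" by simp
    have xt: "x \<longlonglongrightarrow> t"
      by (rule tendsto_sandwich[OF _ _ tendsto_const up])
        (use kx in \<open>auto simp: eventually_sequentially\<close>)
    have "(\<lambda>n. sqrt (1 + \<delta> (r n) * (x n)\<^sup>2) *\<^sub>R mat 1 + x n *\<^sub>R (Y \<circ> r) n) \<longlonglongrightarrow>
      sqrt (1 + (- det W) * t\<^sup>2) *\<^sub>R mat 1 + t *\<^sub>R W"
      by (intro tendsto_intros \<delta>lim xt Yr)
    from LIMSEQ_ignore_initial_segment[OF this, of M]
    have l: "(\<lambda>n. mpow (A (r (n + M))) (k (n + M))) \<longlonglongrightarrow> sqrt (1 - det W * t\<^sup>2) *\<^sub>R mat 1 + t *\<^sub>R W"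
      using kx by simp
    have "mpow (A (r (n + M))) (k (n + M)) \<in> X" for n
      by (rule mpow_mem[OF X A(1)]) (use kx in auto)
    then show ?thesis unfolding closure_sequential
      using l by (intro exI[of _ "\<lambda>n. mpow (A (r (n + M))) (k (n + M))"]) simp
  qed
  show thesis
  proof (rule that[OF W0 trW])
    fix t :: real assume "t \<ge> 0" "1 - det W * t\<^sup>2 > 0"
    moreover have "mat 1 \<in> closure X" using lim by (simp add: closure_def)
    ultimately show "sqrt (1 - det W * t\<^sup>2) *\<^sub>R mat 1 + t *\<^sub>R W \<in> closure X"
      using main[of t] by (cases "t = 0") auto
  qed
qed

section \<open>Invariant sectors\<close>

definition nonneg2 :: "real^2^2 \<Rightarrow> bool" where
  "nonneg2 A \<longleftrightarrow> 0 \<le> A$1$1 \<and> 0 \<le> A$1$2 \<and> 0 \<le> A$2$1 \<and> 0 \<le> A$2$2"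

definition shear :: "real \<Rightarrow> real^2^2" where
  "shear t = M2 1 t 0 1"

definition stretch :: "real \<Rightarrow> real^2^2" where
  "stretch s = M2 (exp s) 0 0 (exp (- s))"

section \<open>Sign conditions from a missing trace value\<close>

lemma exp_dominates:
  fixes k m b :: real
  assumes "k > 0"
  obtains s0 where "s0 \<ge> 0" "\<And>s. s \<ge> s0 \<Longrightarrow> b \<le> exp s * k + exp (- s) * m"
proof
  define s0 where "s0 = (\<bar>m\<bar> + \<bar>b\<bar>) / k"
  show "s0 \<ge> 0" using assms by (simp add: s0_def)
  fix s assume s: "s \<ge> s0"
  have "s \<ge> 0" using s \<open>s0 \<ge> 0\<close> by simp
  have "s0 * k \<le> s * k" using s assms by simp
  then have "\<bar>m\<bar> + \<bar>b\<bar> \<le> s * k" using assms by (simp add: s0_def)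
  also have "\<dots> \<le> exp s * k" using exp_ge_add_one_self[of s] assms by (intro mult_right_mono) linarith+
  finally have "\<bar>m\<bar> + \<bar>b\<bar> \<le> exp s * k" .
  moreover have "\<bar>exp (- s) * m\<bar> \<le> 1 * \<bar>m\<bar>"
    unfolding abs_mult using \<open>s \<ge> 0\<close> by (intro mult_right_mono) auto
  ultimately show "b \<le> exp s * k + exp (- s) * m" by linarith
qed

lemma continuous_hits:
  fixes F :: "real \<Rightarrow> real"
  assumes "F a \<le> y" "y \<le> F b" "a \<le> b" "continuous_on UNIV F"
  obtains x where "a \<le> x" "F x = y"
proof -
  have "continuous_on {a..b} F" using assms(4) continuous_on_subset by blast
  then show thesis using IVT'[OF assms(1-3)] that by blast
qed

text \<open>In the trace of \<open>f ** stretch s ** g ** stretch t\<close> the term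
  \<open>exp (s + t)\<close> has coefficient \<open>f$1$1 * g$1$1 > 0\<close>, whereas at
  \<open>t = 0\<close> the growth in \<open>s\<close> is governed by the (1,1) entry of
  \<open>g ** f\<close>. Were that entry negative, then for a large fixed \<open>s\<close> the trace
  would run from at most -2 to at least 2 and hit \<open>y\<close>.\<close>

lemma stretch_positivity:
  fixes C :: "(real^2^2) set"
  assumes C: "msemi C" and E: "\<And>s. s \<ge> 0 \<Longrightarrow> stretch s \<in> C"
    and tr: "\<And>A. A \<in> C \<Longrightarrow> trace A \<noteq> y" and y: "\<bar>y\<bar> < 2"
    and fg: "f \<in> C" "g \<in> C" "f$1$1 > 0" "g$1$1 > 0"
  shows "0 \<le> g$1$1 * f$1$1 + g$1$2 * f$2$1"
proof (rule ccontr)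
  assume neg: "\<not> ?thesis"
  define k where "k = f$2$1 * g$1$2"
  define l where "l = f$1$2 * g$2$1"
  define m where "m = f$2$2 * g$2$2"
  define p where "p = f$1$1 * g$1$1"
  have p: "p > 0" using fg by (simp add: p_def)
  have pk: "- (p + k) > 0" using neg by (simp add: p_def k_def algebra_simps)
  obtain s1 where s1: "s1 \<ge> 0" "\<And>s. s \<ge> s1 \<Longrightarrow> 2 \<le> exp s * - (p + k) + exp (- s) * - (l + m)"
    using exp_dominates[OF pk] by metis
  obtain s2 where s2: "s2 \<ge> 0" "\<And>s. s \<ge> s2 \<Longrightarrow> 1 \<le> exp s * p + exp (- s) * l"
    using exp_dominates[OF p] by metis
  define s where "s = max s1 s2"
  have s: "s \<ge> 0" "2 \<le> exp s * - (p + k) + exp (- s) * - (l + m)" "1 \<le> exp s * p + exp (- s) * l"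
    using s1 s2 by (simp_all add: s_def)
  define F where "F t = exp t * (exp s * p + exp (- s) * l) + exp (- t) * (exp s * k + exp (- s) * m)" for t
  have trF: "trace (f ** stretch s ** g ** stretch t) = F t" for t
    by (simp add: trace_2 stretch_def F_def p_def k_def l_def m_def algebra_simps)
  have "exp s * p + exp (- s) * l > 0" using s by simp
  then obtain t0 where t0: "t0 \<ge> 0" "\<And>t. t \<ge> t0 \<Longrightarrow> 2 \<le> F t"
    unfolding F_def using exp_dominates by metis
  have "F 0 \<le> -2" using s by (simp add: F_def algebra_simps)
  moreover have "2 \<le> F t0" using t0 by simp
  moreover have "continuous_on UNIV F" unfolding F_def by (intro continuous_intros)
  ultimately obtain t where t: "t \<ge> 0" "F t = y"
  proof (rule_tac continuous_hits[of F 0 y t0])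
    show "F 0 \<le> y" "y \<le> F t0" using \<open>F 0 \<le> -2\<close> \<open>2 \<le> F t0\<close> y by linarith+
  qed (use t0(1) in auto)
  have "f ** stretch s ** g ** stretch t \<in> C"
    using C E fg s t by (simp add: msemi_def)
  then show False using tr t(2) trF by metis
qed

text \<open>The trace is now affine in \<open>s\<close> and in \<open>t\<close>: the coefficient of
  \<open>s * t\<close> is \<open>f$2$1 * g$2$1 > 0\<close>, and at \<open>t = 0\<close> the slope in
  \<open>s\<close> is the (2,1) entry of \<open>g ** f\<close>. A negative entry would again make
  the trace cross \<open>y\<close>.\<close>

lemma shear_positivity:
  fixes C :: "(real^2^2) set"
  assumes C: "msemi C" and E: "\<And>s. s \<ge> 0 \<Longrightarrow> shear s \<in> C"
    and tr: "\<And>A. A \<in> C \<Longrightarrow> trace A \<noteq> y" and y: "\<bar>y\<bar> < 2"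
    and fg: "f \<in> C" "g \<in> C" "f$2$1 > 0" "g$2$1 > 0"
  shows "0 \<le> g$2$1 * f$1$1 + g$2$2 * f$2$1"
proof (rule ccontr)
  assume neg: "\<not> ?thesis"
  define k where "k = - (g$2$1 * f$1$1 + g$2$2 * f$2$1)"
  define l where "l = f$2$1 * g$1$1 + f$2$2 * g$2$1"
  define m where "m = f$1$1 * g$1$1 + f$1$2 * g$2$1 + f$2$1 * g$1$2 + f$2$2 * g$2$2"
  define p where "p = f$2$1 * g$2$1"
  have p: "p > 0" using fg by (simp add: p_def)
  have k: "k > 0" using neg by (simp add: k_def)
  \<comment> \<open>Large enough for the trace to be at most -2 at \<open>t = 0\<close> and to have
    slope at least 1 in \<open>t\<close>.\<close>
  define s where "s = (\<bar>m\<bar> + 2) / k + (\<bar>l\<bar> + 1) / p"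
  have s0: "s \<ge> 0" using p k by (simp add: s_def)
  have "(\<bar>m\<bar> + 2) / k \<le> s" "(\<bar>l\<bar> + 1) / p \<le> s" using p k by (simp_all add: s_def)
  then have s: "\<bar>m\<bar> + 2 \<le> s * k" "\<bar>l\<bar> + 1 \<le> s * p" using p k by (simp_all add: field_simps)
  define q where "q = s * p + l"
  have q: "q > 0" using s by (simp add: q_def)
  define F where "F t = t * q + (m - s * k)" for t
  have trF: "trace (f ** shear s ** g ** shear t) = F t" for t
    by (simp add: trace_2 shear_def F_def p_def k_def l_def m_def q_def algebra_simps)
  define t0 where "t0 = (2 + \<bar>m - s * k\<bar>) / q"
  have t0: "t0 \<ge> 0" "F t0 \<ge> 2" using q by (simp_all add: t0_def F_def)
  have "F 0 \<le> -2" using s by (simp add: F_def)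
  moreover have "2 \<le> F t0" using t0 by simp
  moreover have "continuous_on UNIV F" unfolding F_def by (intro continuous_intros)
  ultimately obtain t where t: "t \<ge> 0" "F t = y"
  proof (rule_tac continuous_hits[of F 0 y t0])
    show "F 0 \<le> y" "y \<le> F t0" using \<open>F 0 \<le> -2\<close> \<open>2 \<le> F t0\<close> y by linarith+
  qed (use t0(1) in auto)
  have "f ** shear s ** g ** shear t \<in> C"
    using C E fg s0 t by (simp add: msemi_def)
  then show False using tr t(2) trF by metis
qed

lemma affine_limit_nonneg:
  fixes a b x0 :: real
  assumes "\<And>x. x > x0 \<Longrightarrow> 0 \<le> a + b * x"
  shows "0 \<le> a + b * x0"
proof (rule tendsto_lowerbound)
  show "((\<lambda>x. a + b * x) \<longlongrightarrow> a + b * x0) (at_right x0)" by (intro tendsto_intros)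
  show "\<forall>\<^sub>F x in at_right x0. 0 \<le> a + b * x" using assms by (auto simp: eventually_at_right_less eventually_at_filter)
qed auto

text \<open>By \<open>shear_positivity\<close> every image \<open>f$1$1 / f$2$1\<close> of
  \<infinity> is at least every preimage \<open>- (g$2$2 / g$2$1)\<close> of \<infinity>. The
  supremum of the preimages is \<open>- d\<close>, and the interval from \<open>- d\<close> to
  \<infinity> is preserved; the columns of \<open>P\<close> are coordinates of its end
  points.\<close>

lemma nonneg_conj_of_shear:
  fixes C :: "(real^2^2) set"
  assumes det1: "\<And>A. A \<in> C \<Longrightarrow> det A = 1" and C: "msemi C" and neg: "\<And>A. A \<in> C \<Longrightarrow> - A \<in> C"
    and E: "\<And>s. s \<ge> 0 \<Longrightarrow> shear s \<in> C"
    and tr: "\<And>A. A \<in> C \<Longrightarrow> trace A \<noteq> y" and y: "\<bar>y\<bar> < 2"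
    and f0: "f0 \<in> C" "f0$2$1 \<noteq> 0"
  obtains P Q where "P ** Q = mat 1" "\<And>A. A \<in> C \<Longrightarrow> nonneg2 (Q ** A ** P) \<or> nonneg2 (- (Q ** A ** P))"
proof -
  have pos: "0 \<le> g$2$1 * f$1$1 + g$2$2 * f$2$1"
    if "f \<in> C" "g \<in> C" "f$2$1 > 0" "g$2$1 > 0" for f g
    using shear_positivity[of C y f g] C E tr y that by blast
  obtain f1 where f1: "f1 \<in> C" "f1$2$1 > 0" using f0 neg[OF f0(1)] by (cases "f0$2$1 > 0") fastforce+
  define D where "D = {g$2$2 / g$2$1 | g. g \<in> C \<and> g$2$1 > 0}"
  have Dne: "D \<noteq> {}" using f1 by (auto simp: D_def)
  have Dlow: "- (f$1$1 / f$2$1) \<le> x" if "x \<in> D" "f \<in> C" "f$2$1 > 0" for x f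
  proof -
    obtain g where g: "g \<in> C" "g$2$1 > 0" "x = g$2$2 / g$2$1" using \<open>x \<in> D\<close> by (auto simp: D_def)
    have "0 \<le> g$2$1 * f$1$1 + g$2$2 * f$2$1" by (rule pos[OF that(2) g(1) that(3) g(2)])
    then have "0 \<le> (g$2$1 * f$1$1 + g$2$2 * f$2$1) / (g$2$1 * f$2$1)" using g(2) that(3) by simp
    also have "\<dots> = f$1$1 / f$2$1 + x" using g(2,3) that(3) by (simp add: field_simps)
    finally show ?thesis by simp
  qed
  have bdd: "bdd_below D" using Dlow f1 by (auto simp: bdd_below_def)
  define d where "d = Inf D"
  have d_le: "d \<le> x" if "x \<in> D" for x unfolding d_def using that bdd by (rule cInf_lower)
  have d_ge: "- (f$1$1 / f$2$1) \<le> d" if "f \<in> C" "f$2$1 > 0" for f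
    unfolding d_def using Dne Dlow that by (intro cInf_greatest) auto
  define P where "P = M2 1 (- d) 0 1"
  define Q where "Q = M2 1 d 0 1"
  have PQ: "P ** Q = mat 1" by (simp add: P_def Q_def mat2_eq_iff)
  have main: "nonneg2 (Q ** f ** P)" if f: "f \<in> C" "f$2$1 > 0 \<or> f$2$1 = 0 \<and> f$1$1 > 0" for f
  proof -
    have det: "f$1$1 * f$2$2 - f$1$2 * f$2$1 = 1" using det1[OF f(1)] by (simp add: det_2)
    have n11: "0 \<le> f$1$1 + d * f$2$1"
    proof (cases "f$2$1 > 0")
      case True then show ?thesis using d_ge[OF f(1) True] by (simp add: field_simps)
    qed (use f in auto)
    have n22: "0 \<le> f$2$2 - d * f$2$1"
    proof (cases "f$2$1 > 0")
      case True
      then have "f$2$2 / f$2$1 \<in> D" using f by (auto simp: D_def)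
      then have "d \<le> f$2$2 / f$2$1" by (rule d_le)
      then show ?thesis using True by (simp add: field_simps)
    next
      case False
      then have "f$2$1 = 0" "f$1$1 > 0" using f by auto
      moreover then have "f$2$2 > 0" using det by (metis mult_zero_right diff_zero zero_less_mult_pos zero_less_one)
      ultimately show ?thesis by simp
    qed
    \<comment> \<open>The (1,2) entry says that \<open>f\<close> does not push \<open>- d\<close> to
      the left. For \<open>x > d\<close>, composing with a shear gives \<open>h\<close> in
      \<open>C\<close> whose preimage of \<infinity> is exactly \<open>- x\<close>. Then
      \<open>h ** f\<close> contributes to \<open>D\<close>, so its ratio is at least
      \<open>d\<close>; afterwards \<open>x\<close> tends to \<open>d\<close>.\<close>
    have "0 \<le> (f$1$2 - d * f$1$1) + (f$2$2 - d * f$2$1) * x" if x: "x > d" for x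
    proof -
      obtain z where z: "z \<in> D" "z < x" using x cInf_less_iff[OF Dne bdd] by (auto simp: d_def)
      obtain g where g: "g \<in> C" "g$2$1 > 0" "z = g$2$2 / g$2$1" using z(1) by (auto simp: D_def)
      define h where "h = g ** shear (x - z)"
      have h: "h \<in> C" using C E g(1) z(2) by (simp add: h_def msemi_def)
      have h1: "h$2$1 = g$2$1" "h$2$2 = x * g$2$1" using g(2,3) by (simp_all add: h_def shear_def field_simps)
      have hf: "h ** f \<in> C" using C h f(1) by (simp add: msemi_def)
      have e: "(h ** f)$2$1 = g$2$1 * (f$1$1 + x * f$2$1)" "(h ** f)$2$2 = g$2$1 * (f$1$2 + x * f$2$2)"
        by (simp_all add: h1 algebra_simps)
      have p: "f$1$1 + x * f$2$1 > 0"
      proof (cases "f$2$1 > 0")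
        case True
        then have "d * f$2$1 < x * f$2$1" using x by simp
        then show ?thesis using n11 by linarith
      qed (use f in auto)
      have "(h ** f)$2$2 / (h ** f)$2$1 \<in> D" using hf p g(2) D_def e(1)
        by (smt (verit) mem_Collect_eq mult_pos_pos)
      then have "d \<le> (h ** f)$2$2 / (h ** f)$2$1" by (rule d_le)
      also have "\<dots> = (f$1$2 + x * f$2$2) / (f$1$1 + x * f$2$1)" unfolding e using g(2) by simp
      finally show ?thesis using p by (simp add: field_simps)
    qed
    then have n12: "0 \<le> (f$1$2 - d * f$1$1) + (f$2$2 - d * f$2$1) * d" by (rule affine_limit_nonneg)
    show ?thesis using n11 n12 n22 f(2) by (auto simp: nonneg2_def P_def Q_def algebra_simps)
  qed
  have "nonneg2 (Q ** f ** P) \<or> nonneg2 (- (Q ** f ** P))" if f: "f \<in> C" for f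
  proof (cases "f$2$1 > 0 \<or> f$2$1 = 0 \<and> f$1$1 > 0")
    case False
    have "f$1$1 * f$2$2 - f$1$2 * f$2$1 = 1" using det1[OF f] by (simp add: det_2)
    then have "f$2$1 \<noteq> 0 \<or> f$1$1 \<noteq> 0" by auto
    then have "(- f)$2$1 > 0 \<or> (- f)$2$1 = 0 \<and> (- f)$1$1 > 0" using False by auto
    then have "nonneg2 (Q ** (- f) ** P)" by (rule main[OF neg[OF f]])
    then show ?thesis by (simp add: conj_neg)
  qed (use main f in blast)
  then show thesis using that PQ by blast
qed

text \<open>The inequalities for all directions \<open>(1, v)\<close> reduce to the two extreme
  ones, \<open>(1, Inf V)\<close> and \<open>(1, Sup V)\<close>; a missing bound is replaced by the
  limit direction \<open>(0, 1)\<close> or \<open>(0, -1)\<close>. These are the rows of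
  \<open>Q\<close>. When both bounds exist, 0 and \<open>w\<close> keep them apart.\<close>

lemma dual_sector:
  fixes V :: "real set"
  assumes V0: "0 \<in> V" and V1: "w \<in> V" "w \<noteq> 0" and bdd: "bdd_below V \<or> bdd_above V"
  obtains Q :: "real^2^2" where "det Q \<noteq> 0"
    "\<And>x y. (\<forall>v\<in>V. 0 \<le> x + v * y) \<longleftrightarrow> 0 \<le> Q$1$1 * x + Q$1$2 * y \<and> 0 \<le> Q$2$1 * x + Q$2$2 * y"
proof -
  have Vne: "V \<noteq> {}" using V0 by blast
  have low: "(\<forall>v\<in>V. 0 \<le> x + v * y) \<longleftrightarrow> 0 \<le> x + Inf V * y" if "bdd_below V" "y \<ge> 0" for x y
  proof
    assume *: "\<forall>v\<in>V. 0 \<le> x + v * y"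
    show "0 \<le> x + Inf V * y"
    proof (cases "y = 0")
      case False
      then have y: "y > 0" using that by simp
      have "- x / y \<le> Inf V" using * y by (intro cInf_greatest Vne) (auto simp: field_simps)
      then show ?thesis using y by (simp add: field_simps)
    qed (use * Vne in auto)
  next
    assume *: "0 \<le> x + Inf V * y"
    show "\<forall>v\<in>V. 0 \<le> x + v * y"
    proof
      fix v assume "v \<in> V"
      then have "Inf V * y \<le> v * y" using that cInf_lower by (intro mult_right_mono) auto
      then show "0 \<le> x + v * y" using * by linarith
    qed
  qed
  have up: "(\<forall>v\<in>V. 0 \<le> x + v * y) \<longleftrightarrow> 0 \<le> x + Sup V * y" if "bdd_above V" "y \<le> 0" for x y
  proof
    assume *: "\<forall>v\<in>V. 0 \<le> x + v * y"
    show "0 \<le> x + Sup V * y"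
    proof (cases "y = 0")
      case False
      then have y: "y < 0" using that by simp
      have "Sup V \<le> x / (- y)" using * y by (intro cSup_least Vne) (auto simp: field_simps)
      then show ?thesis using y by (simp add: field_simps)
    qed (use * Vne in auto)
  next
    assume *: "0 \<le> x + Sup V * y"
    show "\<forall>v\<in>V. 0 \<le> x + v * y"
    proof
      fix v assume "v \<in> V"
      then have "Sup V * y \<le> v * y" using that cSup_upper by (intro mult_right_mono_neg) auto
      then show "0 \<le> x + v * y" using * by linarith
    qed
  qed
  have neg_y: "\<exists>v\<in>V. x + v * y < 0" if "\<not> bdd_above V" "y < 0" for x y
  proof -
    obtain v where "v \<in> V" "v > x / (- y)" using \<open>\<not> bdd_above V\<close> by (meson bdd_above.I not_le)
    then show ?thesis using \<open>y < 0\<close> by (intro bexI[of _ v]) (auto simp: field_simps)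
  qed
  have pos_y: "\<exists>v\<in>V. x + v * y < 0" if "\<not> bdd_below V" "y > 0" for x y
  proof -
    obtain v where "v \<in> V" "v < - x / y" using \<open>\<not> bdd_below V\<close> by (meson bdd_below.I not_le)
    then show ?thesis using \<open>y > 0\<close> by (intro bexI[of _ v]) (auto simp: field_simps)
  qed
  consider "bdd_below V" "bdd_above V" | "bdd_below V" "\<not> bdd_above V" | "\<not> bdd_below V" "bdd_above V"
    using bdd by metis
  then show thesis
  proof cases
    case 1
    have i: "Inf V \<le> 0" "Inf V \<le> w" "0 \<le> Sup V" "w \<le> Sup V"
      using 1 V0 V1 cInf_lower cSup_upper by blast+
    have "(\<forall>v\<in>V. 0 \<le> x + v * y) \<longleftrightarrow> 0 \<le> x + Inf V * y \<and> 0 \<le> x + Sup V * y" for x y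
    proof (cases "y \<ge> 0")
      case True
      then have "Inf V * y \<le> Sup V * y" using i by (intro mult_right_mono) auto
      then show ?thesis using low[OF 1(1) True, of x] by linarith
    next
      case False
      then have "Sup V * y \<le> Inf V * y" using i by (intro mult_right_mono_neg) auto
      then show ?thesis using up[OF 1(2), of y x] False by linarith
    qed
    then show thesis using i V1(2) by (intro that[of "M2 1 (Inf V) 1 (Sup V)"]) auto
  next
    case 2
    have "(\<forall>v\<in>V. 0 \<le> x + v * y) \<longleftrightarrow> 0 \<le> x + Inf V * y \<and> 0 \<le> y" for x y
      using low[OF 2(1), of y x] neg_y[OF 2(2), of y x] by (meson not_le)
    then show thesis by (intro that[of "M2 1 (Inf V) 0 1"]) simp_all
  next
    case 3
    have "(\<forall>v\<in>V. 0 \<le> x + v * y) \<longleftrightarrow> 0 \<le> x + Sup V * y \<and> 0 \<le> - y" for x y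
      using up[OF 3(2), of y x] pos_y[OF 3(1), of y x] by (meson neg_0_le_iff_le not_le)
    then show thesis by (intro that[of "M2 1 (Sup V) 0 (-1)"]) simp_all
  qed
qed

lemma exp_combination_nonneg:
  fixes a b :: real
  assumes "\<And>s. s > 0 \<Longrightarrow> 0 \<le> exp s * a + exp (- s) * b"
  shows "0 \<le> a + b" "0 \<le> a"
proof -
  have "0 \<le> exp 0 * a + exp (- 0) * b"
  proof (rule tendsto_lowerbound)
    show "((\<lambda>s. exp s * a + exp (- s) * b) \<longlongrightarrow> exp 0 * a + exp (- 0) * b) (at_right 0)"
      by (intro tendsto_intros)
    show "\<forall>\<^sub>F s in at_right 0. 0 \<le> exp s * a + exp (- s) * b"
      using assms by (auto simp: eventually_at_filter)
  qed auto
  then show "0 \<le> a + b" by simp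
  show "0 \<le> a"
  proof (rule ccontr)
    assume "\<not> 0 \<le> a"
    then obtain s0 where s0: "s0 \<ge> 0" "\<And>s. s \<ge> s0 \<Longrightarrow> 1 \<le> exp s * - a + exp (- s) * - b"
      using exp_dominates[of "- a"] by (metis neg_0_less_iff_less not_le)
    then show False using assms[of "s0 + 1"] s0(2)[of "s0 + 1"] by simp
  qed
qed

text \<open>The sector is the cone \<open>K\<close> on which all first rows with positive (1,1)
  entry are nonnegative. The first column of \<open>h0\<close>, up to sign, lies in \<open>K\<close>
  off the axes, which bounds the slopes in \<open>V\<close> on one side; \<open>g0\<close> supplies
  a nonzero slope. Invariance of \<open>K\<close> is easy when (1,1) entries of products are
  strictly positive, and the stretches serve to reach that case.\<close>

lemma nonneg_conj_of_stretch:
  fixes C :: "(real^2^2) set"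
  assumes det1: "\<And>A. A \<in> C \<Longrightarrow> det A = 1" and C: "msemi C" and neg: "\<And>A. A \<in> C \<Longrightarrow> - A \<in> C"
    and E: "\<And>s. s \<ge> 0 \<Longrightarrow> stretch s \<in> C"
    and tr: "\<And>A. A \<in> C \<Longrightarrow> trace A \<noteq> y" and y: "\<bar>y\<bar> < 2"
    and h0: "h0 \<in> C" "h0$1$1 \<noteq> 0" "h0$2$1 \<noteq> 0"
    and g0: "g0 \<in> C" "g0$1$1 \<noteq> 0" "g0$1$2 \<noteq> 0"
  obtains P Q where "P ** Q = mat 1" "\<And>A. A \<in> C \<Longrightarrow> nonneg2 (Q ** A ** P) \<or> nonneg2 (- (Q ** A ** P))"
proof -
  have pos: "0 \<le> g$1$1 * f$1$1 + g$1$2 * f$2$1"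
    if "f \<in> C" "g \<in> C" "f$1$1 > 0" "g$1$1 > 0" for f g
    using stretch_positivity[of C y f g] C E tr y that by blast
  have sgn: "\<exists>f'\<in>C. f'$1$1 > 0 \<and> (f' = f \<or> f' = - f)" if "f \<in> C" "f$1$1 \<noteq> 0" for f
  proof (cases "f$1$1 > 0")
    case False
    then have "(- f)$1$1 > 0" using that(2) by simp
    then show ?thesis using neg[OF that(1)] by blast
  qed (use that in blast)
  obtain h where h: "h \<in> C" "h$1$1 > 0" "h$2$1 \<noteq> 0" using sgn[OF h0(1,2)] h0(3) by auto
  obtain g1 where g1: "g1 \<in> C" "g1$1$1 > 0" "g1$1$2 \<noteq> 0" using sgn[OF g0(1,2)] g0(3) by auto
  have one: "mat 1 \<in> C" using E[of 0] by (simp add: stretch_def mat2_eq_iff M2_def[symmetric]) (metis M2_nth mat1_2 mat2_eq_iff)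
  define V where "V = {g$1$2 / g$1$1 | g. g \<in> C \<and> g$1$1 > 0}"
  have V0: "0 \<in> V" using one by (force simp: V_def)
  have V1: "g1$1$2 / g1$1$1 \<in> V" "g1$1$2 / g1$1$1 \<noteq> 0" using g1 by (auto simp: V_def)
  have uv: "0 \<le> 1 + v * (h$2$1 / h$1$1)" if "v \<in> V" for v
  proof -
    obtain g where g: "g \<in> C" "g$1$1 > 0" "v = g$1$2 / g$1$1" using \<open>v \<in> V\<close> by (auto simp: V_def)
    have "0 \<le> g$1$1 * h$1$1 + g$1$2 * h$2$1" by (rule pos[OF h(1) g(1) h(2) g(2)])
    then have "0 \<le> (g$1$1 * h$1$1 + g$1$2 * h$2$1) / (g$1$1 * h$1$1)" using g(2) h(2) by simp
    also have "\<dots> = 1 + v * (h$2$1 / h$1$1)" using g h by (simp add: field_simps)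
    finally show ?thesis .
  qed
  define u where "u = h$2$1 / h$1$1"
  have u: "u \<noteq> 0" using h by (simp add: u_def)
  have bdd: "bdd_below V \<or> bdd_above V"
  proof (cases "u > 0")
    case True
    then have "- (1 / u) \<le> v" if "v \<in> V" for v using uv[OF that, folded u_def] by (simp add: field_simps)
    then have "bdd_below V" unfolding bdd_below_def by blast
    then show ?thesis ..
  next
    case False
    then have "u < 0" using u by simp
    then have "v \<le> - (1 / u)" if "v \<in> V" for v using uv[OF that, folded u_def] by (simp add: field_simps)
    then have "bdd_above V" unfolding bdd_above_def by blast
    then show ?thesis ..
  qed
  define K where "K w \<longleftrightarrow> (\<forall>g\<in>C. g$1$1 > 0 \<longrightarrow> 0 \<le> g$1$1 * w$1 + g$1$2 * w$2)" for w :: "real^2"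
  have KV: "K w \<longleftrightarrow> (\<forall>v\<in>V. 0 \<le> w$1 + v * w$2)" for w
  proof -
    have "0 \<le> g$1$1 * w$1 + g$1$2 * w$2 \<longleftrightarrow> 0 \<le> w$1 + (g$1$2 / g$1$1) * w$2" if "g$1$1 > 0" for g :: "real^2^2"
    proof -
      have "w$1 + (g$1$2 / g$1$1) * w$2 = (g$1$1 * w$1 + g$1$2 * w$2) / g$1$1" using that by (simp add: field_simps)
      then show ?thesis using that by (simp add: zero_le_divide_iff)
    qed
    then show ?thesis by (auto simp: K_def V_def)
  qed
  have mv: "(f *v w)$1 = f$1$1 * w$1 + f$1$2 * w$2" "(f *v w)$2 = f$2$1 * w$1 + f$2$2 * w$2"
    for f :: "real^2^2" and w by (simp_all add: matrix_vector_mult_def sum_2)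
  have Kmult: "0 \<le> g$1$1 * (f *v w)$1 + g$1$2 * (f *v w)$2" if "g \<in> C" "f \<in> C" "K w" "(g ** f)$1$1 > 0" for f g w
  proof -
    have "g ** f \<in> C" using C that by (simp add: msemi_def)
    then have "0 \<le> (g ** f)$1$1 * w$1 + (g ** f)$1$2 * w$2" using that(3,4) unfolding K_def by blast
    then show ?thesis by (simp add: mv algebra_simps)
  qed
  have gs: "g ** stretch s \<in> C" "(g ** stretch s)$1$1 = exp s * g$1$1" "(g ** stretch s)$1$2 = exp (- s) * g$1$2"
    if "g \<in> C" "s > 0" for g s
    using C E that by (simp_all add: msemi_def stretch_def algebra_simps)
  have inv1: "K (f *v w)" if f: "f \<in> C" "f$1$1 > 0" and w: "K w" for f w
    unfolding K_def
  proof (intro ballI impI)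
    fix g assume g: "g \<in> C" "g$1$1 > 0"
    \<comment> \<open>The (1,1) entry of \<open>g ** f\<close> is only known to be nonnegative,
      while \<open>K\<close> tests rows with a positive one. A stretch between \<open>g\<close> and
      \<open>f\<close> makes it positive, and then \<open>s\<close> tends to 0.\<close>
    have "0 \<le> exp s * (g$1$1 * (f *v w)$1) + exp (- s) * (g$1$2 * (f *v w)$2)" if s: "s > 0" for s
    proof -
      have p: "0 \<le> g$1$1 * f$1$1 + g$1$2 * f$2$1" by (rule pos[OF f(1) g(1) f(2) g(2)])
      have "((g ** stretch s) ** f)$1$1 = exp s * (g$1$1 * f$1$1) + exp (- s) * (g$1$2 * f$2$1)"
        using gs[OF g(1) s] by (simp add: algebra_simps)
      also have "\<dots> = (exp s - exp (- s)) * (g$1$1 * f$1$1) + exp (- s) * (g$1$1 * f$1$1 + g$1$2 * f$2$1)"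
        by (simp add: algebra_simps)
      also have "\<dots> > 0" using p f(2) g(2) s by (intro add_pos_nonneg mult_pos_pos) auto
      finally have "0 \<le> (g ** stretch s)$1$1 * (f *v w)$1 + (g ** stretch s)$1$2 * (f *v w)$2"
        by (rule Kmult[OF gs(1)[OF g(1) s] f(1) w])
      then show ?thesis using gs[OF g(1) s] by (simp add: mult.assoc)
    qed
    then show "0 \<le> g$1$1 * (f *v w)$1 + g$1$2 * (f *v w)$2" by (rule exp_combination_nonneg(1))
  qed
  have inv: "(\<forall>w. K w \<longrightarrow> K (f *v w)) \<or> (\<forall>w. K w \<longrightarrow> K ((- f) *v w))" if f: "f \<in> C" for f
  proof (cases "f$1$1 = 0")
    case False
    then consider "f$1$1 > 0" | "(- f)$1$1 > 0" by fastforce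
    then show ?thesis using inv1[OF f] inv1[OF neg[OF f]] by cases blast+
  next
    case True
    have bc: "f$1$2 * f$2$1 = -1" using det1[OF f] True by (simp add: det_2)
    define \<sigma> where "\<sigma> = (if g1$1$2 > 0 then 1 else (-1 :: real))"
    have \<sigma>1: "\<sigma> * g1$1$2 > 0" using g1(3) by (simp add: \<sigma>_def)
    have \<sigma>\<sigma>: "\<sigma> * \<sigma> = 1" by (simp add: \<sigma>_def)
    text \<open>If first rows \<open>(a, b)\<close> with \<open>a > 0\<close> occurred with both signs of \<open>b\<close>, then multiplying
      them by \<open>f\<close> would give slopes unbounded in both directions.\<close>
    have one_sign: "0 \<le> \<sigma> * g$1$2" if g: "g \<in> C" "g$1$1 > 0" for g
    proof (rule ccontr)
      assume n: "\<not> ?thesis"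
      \<comment> \<open>\<open>\<epsilon>\<close> is the sign that gives the product of
        \<open>k\<close>, a stretch and \<open>f\<close> a positive (1,1) entry. Its positivity
        against \<open>h\<close> has the claimed expression as the coefficient of
        \<open>exp s\<close>.\<close>
      have key: "0 \<le> (\<epsilon> * f$1$2) * (k$1$1 * h$2$1)"
        if k: "k \<in> C" "k$1$1 > 0" and \<epsilon>: "\<epsilon> = 1 \<or> \<epsilon> = -1" "0 < \<epsilon> * (k$1$2 * f$2$1)" for k \<epsilon>
      proof -
        have "0 \<le> exp s * ((\<epsilon> * f$1$2) * (k$1$1 * h$2$1)) + exp (- s) * (\<epsilon> * (k$1$2 * f$2$1 * h$1$1 + k$1$2 * f$2$2 * h$2$1))"
          if s: "s > 0" for s
        proof -
          define r where "r = (if \<epsilon> = 1 then (k ** stretch s) ** f else - ((k ** stretch s) ** f))"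
          have kf: "(k ** stretch s) ** f \<in> C" using C gs(1)[OF k(1) s] f by (simp add: msemi_def)
          then have rC: "r \<in> C" using neg by (auto simp: r_def)
          have r1: "r$1$1 = exp (- s) * (\<epsilon> * (k$1$2 * f$2$1))"
            "r$1$2 = \<epsilon> * (exp s * (k$1$1 * f$1$2) + exp (- s) * (k$1$2 * f$2$2))"
            using \<epsilon>(1) gs(2,3)[OF k(1) s] True by (auto simp: r_def)
          have "0 \<le> r$1$1 * h$1$1 + r$1$2 * h$2$1"
            by (rule pos[OF h(1) rC h(2)]) (use r1 \<epsilon>(2) in simp)
          then show ?thesis unfolding r1 by (simp add: algebra_simps)
        qed
        then show ?thesis by (rule exp_combination_nonneg(2))
      qed
      define \<epsilon> where "\<epsilon> = (if f$2$1 > 0 then \<sigma> else - \<sigma>)"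
      have c0: "f$2$1 \<noteq> 0" using bc by auto
      have \<epsilon>: "\<epsilon> = 1 \<or> \<epsilon> = -1" by (auto simp: \<epsilon>_def \<sigma>_def)
      have \<epsilon>c: "\<epsilon> * f$2$1 = \<sigma> * \<bar>f$2$1\<bar>" by (simp add: \<epsilon>_def)
      have e1: "0 < \<epsilon> * (g1$1$2 * f$2$1)"
      proof -
        have "\<epsilon> * (g1$1$2 * f$2$1) = g1$1$2 * (\<epsilon> * f$2$1)" by (simp only: ac_simps)
        also have "\<dots> = (\<sigma> * g1$1$2) * \<bar>f$2$1\<bar>" unfolding \<epsilon>c by (simp only: ac_simps)
        also have "\<dots> > 0" by (rule mult_pos_pos[OF \<sigma>1]) (use c0 in simp)
        finally show ?thesis .
      qed
      have e2: "0 < (- \<epsilon>) * (g$1$2 * f$2$1)"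
      proof -
        have "(- \<epsilon>) * (g$1$2 * f$2$1) = - (g$1$2 * (\<epsilon> * f$2$1))" by (simp add: ac_simps)
        also have "\<dots> = (- (\<sigma> * g$1$2)) * \<bar>f$2$1\<bar>" unfolding \<epsilon>c by (simp add: ac_simps)
        also have "\<dots> > 0" by (rule mult_pos_pos) (use n c0 in auto)
        finally show ?thesis .
      qed
      have "0 \<le> (\<epsilon> * f$1$2) * (g1$1$1 * h$2$1)" by (rule key[OF g1(1,2) \<epsilon> e1])
      then have "0 \<le> g1$1$1 * ((\<epsilon> * f$1$2) * h$2$1)" by (simp only: ac_simps)
      then have "0 \<le> (\<epsilon> * f$1$2) * h$2$1" using g1(2) by (simp add: zero_le_mult_iff)
      moreover have "0 \<le> ((- \<epsilon>) * f$1$2) * (g$1$1 * h$2$1)" by (rule key[OF g _ e2]) (use \<epsilon> in auto)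
      then have "0 \<le> g$1$1 * (((- \<epsilon>) * f$1$2) * h$2$1)" by (simp only: ac_simps)
      then have "0 \<le> ((- \<epsilon>) * f$1$2) * h$2$1" using g(2) mult_pos_neg not_le by blast
      ultimately have "(\<epsilon> * f$1$2) * h$2$1 = 0" by simp
      then show False using \<epsilon> h(3) bc by auto
    qed
    \<comment> \<open>For \<open>g$1$2\<close> nonzero, \<open>one_sign\<close> makes the (1,1)
      entry of \<open>g ** f'\<close> positive. For \<open>g$1$2 = 0\<close> only the first
      coordinate counts, and its sign results from the rows of \<open>g1 ** stretch s\<close> as
      \<open>s\<close> grows.\<close>
    have main: "K (f' *v w)" if f': "f' \<in> C" "f'$1$1 = 0" "\<sigma> * f'$2$1 > 0" and w: "K w" for f' w
      unfolding K_def
    proof (intro ballI impI)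
      have nz: "0 \<le> g$1$1 * (f' *v w)$1 + g$1$2 * (f' *v w)$2"
        if g: "g \<in> C" "g$1$1 > 0" "g$1$2 \<noteq> 0" for g
      proof (rule Kmult[OF g(1) f'(1) w])
        have "\<sigma> \<noteq> 0" using \<sigma>\<sigma> by auto
        then have "\<sigma> * g$1$2 > 0" using one_sign[OF g(1,2)] g(3) by (metis less_eq_real_def mult_eq_0_iff)
        then have "0 < (\<sigma> * g$1$2) * (\<sigma> * f'$2$1)" using f'(3) by simp
        also have "\<dots> = (\<sigma> * \<sigma>) * (g$1$2 * f'$2$1)" by (simp only: ac_simps)
        finally show "(g ** f')$1$1 > 0" by (simp add: \<sigma>\<sigma> f'(2))
      qed
      have "0 \<le> exp s * (g1$1$1 * (f' *v w)$1) + exp (- s) * (g1$1$2 * (f' *v w)$2)" if s: "s > 0" for s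
        using nz[OF gs(1)[OF g1(1) s]] gs(2,3)[OF g1(1) s] g1(2,3) by (simp add: mult.assoc)
      then have "0 \<le> g1$1$1 * (f' *v w)$1" by (rule exp_combination_nonneg(2))
      then have first: "0 \<le> (f' *v w)$1" using g1(2) by (simp add: zero_le_mult_iff)
      fix g assume g: "g \<in> C" "g$1$1 > 0"
      show "0 \<le> g$1$1 * (f' *v w)$1 + g$1$2 * (f' *v w)$2"
        using nz[OF g] first g(2) by (cases "g$1$2 = 0") auto
    qed
    have "\<sigma> * f$2$1 \<noteq> 0" using bc \<sigma>\<sigma> by auto
    then consider "\<sigma> * f$2$1 > 0" | "\<sigma> * (- f)$2$1 > 0" by fastforce
    then show ?thesis using main[OF f True] main[OF neg[OF f]] True by cases auto
  qed
  obtain Q :: "real^2^2" where Q: "det Q \<noteq> 0"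
    "\<And>x y. (\<forall>v\<in>V. 0 \<le> x + v * y) \<longleftrightarrow> 0 \<le> Q$1$1 * x + Q$1$2 * y \<and> 0 \<le> Q$2$1 * x + Q$2$2 * y"
    by (rule dual_sector[OF V0 V1 bdd]) (rule that)
  have KQ: "K w \<longleftrightarrow> 0 \<le> (Q *v w)$1 \<and> 0 \<le> (Q *v w)$2" for w
    unfolding KV Q(2) mv ..
  obtain P where QP: "Q ** P = mat 1" using Q(1) by (metis invertible_det_nz invertible_def)
  then have PQ: "P ** Q = mat 1" by (rule matrix_inverse_swap)
  have nn: "nonneg2 (Q ** f ** P)" if f: "\<forall>w. K w \<longrightarrow> K (f *v w)" for f
  proof -
    have K1: "K (P *v axis i 1)" for i
    proof -
      have "Q *v (P *v axis i 1) = axis i 1" by (simp add: matrix_vector_mul_assoc QP)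
      then show ?thesis unfolding KQ using exhaust_2[of i] by (auto simp: axis_def)
    qed
    then have "K (f *v (P *v axis i 1))" for i using f by blast
    then have "0 \<le> ((Q ** f ** P) *v axis i 1)$1 \<and> 0 \<le> ((Q ** f ** P) *v axis i 1)$2" for i
      unfolding KQ by (simp add: matrix_vector_mul_assoc matrix_mul_assoc)
    from this[of 1] this[of 2] show ?thesis
      by (simp add: nonneg2_def matrix_vector_mult_basis column_def)
  qed
  show thesis
  proof (rule that[OF PQ])
    fix A assume "A \<in> C"
    then show "nonneg2 (Q ** A ** P) \<or> nonneg2 (- (Q ** A ** P))"
      using inv nn conj_neg by metis
  qed
qed

section \<open>Normal forms of traceless matrices\<close>

lemma conj_from_intertwining:
  fixes Y P D :: "real^2^2"
  assumes "Y ** P = P ** D" "det P \<noteq> 0"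
  obtains Q where "P ** Q = mat 1" "Q ** Y ** P = D"
proof -
  obtain Q where PQ: "P ** Q = mat 1"
    using assms(2) by (metis invertible_det_nz invertible_def)
  have "Q ** Y ** P = Q ** P ** D" using assms(1) by (metis matrix_mul_assoc)
  then have "Q ** Y ** P = D" by (simp add: matrix_inverse_swap[OF PQ])
  then show thesis using that PQ by blast
qed

lemma diagonalize_traceless:
  fixes Y :: "real^2^2"
  assumes "trace Y = 0" "det Y = - (l\<^sup>2)" "l > 0"
  obtains P Q where "P ** Q = mat 1" "Q ** Y ** P = M2 l 0 0 (- l)"
proof -
  define p where "p = Y$1$1"
  define q where "q = Y$1$2"
  define r where "r = Y$2$1"
  have Y: "Y = M2 p q r (- p)" using assms(1) by (simp add: mat2_eq_iff p_def q_def r_def trace_2)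
  have e: "p * p + q * r = l * l" using assms(2) by (simp add: Y power2_eq_square)
  have "\<exists>P. det P \<noteq> 0 \<and> Y ** P = P ** M2 l 0 0 (- l)"
  proof (cases "q = 0")
    case False
    have "Y ** M2 q q (l - p) (- l - p) = M2 q q (l - p) (- l - p) ** M2 l 0 0 (- l)"
      using e by (simp add: Y mat2_eq_iff algebra_simps)
    moreover have "det (M2 q q (l - p) (- l - p)) = - 2 * l * q" by (simp add: algebra_simps)
    ultimately show ?thesis using False assms(3) by (intro exI[of _ "M2 q q (l - p) (- l - p)"]) simp
  next
    case q: True
    then have "p * p = l * l" using e by simp
    then have p: "p = l \<or> p = - l" using square_eq_iff by blast
    show ?thesis
    proof (cases "p = l")
      case True
      then show ?thesis using q assms(3)
        by (intro exI[of _ "M2 (2 * l) 0 r 1"]) (simp add: Y mat2_eq_iff algebra_simps)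
    next
      case False
      then have "p = - l" using p by simp
      then show ?thesis using q assms(3)
        by (intro exI[of _ "M2 0 (2 * l) 1 (- r)"]) (simp add: Y mat2_eq_iff algebra_simps)
    qed
  qed
  then show thesis using conj_from_intertwining that by metis
qed

lemma jordan_nilpotent:
  fixes Y :: "real^2^2"
  assumes "trace Y = 0" "det Y = 0" "Y \<noteq> 0"
  obtains P Q where "P ** Q = mat 1" "Q ** Y ** P = M2 0 1 0 0"
proof -
  define p where "p = Y$1$1"
  define q where "q = Y$1$2"
  define r where "r = Y$2$1"
  have Y: "Y = M2 p q r (- p)" using assms(1) by (simp add: mat2_eq_iff p_def q_def r_def trace_2)
  have e: "p * p + q * r = 0" using assms(2) by (simp add: Y)
  have "\<exists>P. det P \<noteq> 0 \<and> Y ** P = P ** M2 0 1 0 0"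
  proof (cases "q = 0")
    case False
    then show ?thesis using e
      by (intro exI[of _ "M2 q 0 (- p) 1"]) (simp add: Y mat2_eq_iff algebra_simps)
  next
    case True
    then have "p = 0" using e by simp
    moreover then have "r \<noteq> 0" using assms(3) True by (auto simp: Y mat2_eq_iff)
    ultimately show ?thesis using True
      by (intro exI[of _ "M2 0 1 r 0"]) (simp add: Y mat2_eq_iff)
  qed
  then show thesis using conj_from_intertwining that by metis
qed

lemma conj_combination:
  fixes P Q Y :: "real^2^2"
  assumes "P ** Q = mat 1"
  shows "Q ** (a *\<^sub>R mat 1 + b *\<^sub>R Y) ** P = a *\<^sub>R mat 1 + b *\<^sub>R (Q ** Y ** P)"
proof -
  have "Q ** (a *\<^sub>R mat 1 + b *\<^sub>R Y) ** P = a *\<^sub>R (Q ** P) + b *\<^sub>R (Q ** Y ** P)"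
    by (simp add: mat2_eq_iff algebra_simps)
  then show ?thesis by (simp add: matrix_inverse_swap[OF assms])
qed

lemma irrational_acute_angle:
  obtains \<phi> where "0 < \<phi>" "\<phi> < pi / 2" "\<phi> / (2 * pi) \<notin> \<rat>"
proof -
  have "uncountable ({0<..<1/4} :: real set)" by (simp add: uncountable_open_interval)
  then have "\<not> {0<..<1/4} \<subseteq> (\<rat> :: real set)" using countable_rat countable_subset by blast
  then obtain x :: real where "x \<in> {0<..<1/4}" and x3: "x \<notin> \<rat>" by blast
  then have x: "0 < x" "x < 1 / 4" by auto
  show thesis
  proof (rule that[of "2 * pi * x"])
    show "2 * pi * x < pi / 2" using x by simp
  qed (use x x3 in auto)
qed

text \<open>The columns of \<open>P\<close> represent two arbitrary distinct real points. Entry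
  (1,1) or (2,1) of \<open>Q ** A ** P\<close> vanishes when \<open>A\<close> maps the first point
  to the second or to itself; if this held for every \<open>A\<close>, the first point would have an
  orbit of at most two points.\<close>

locale nonelementary_pairwise_semidiscrete = pairwise_semidiscrete +
  assumes no_small_real_orbit:
    "\<And>P Q :: real^2^2. P ** Q = mat 1 \<Longrightarrow> \<exists>A\<in>\<Sigma>. (Q ** A ** P)$1$1 \<noteq> 0 \<and> (Q ** A ** P)$2$1 \<noteq> 0"
begin

lemma no_small_real_orbit':
  fixes P Q :: "real^2^2"
  assumes "P ** Q = mat 1"
  shows "\<exists>A\<in>\<Sigma>. (Q ** A ** P)$2$2 \<noteq> 0 \<and> (Q ** A ** P)$1$2 \<noteq> 0"
proof -
  define J where "J = M2 0 1 1 0"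
  have J: "J ** J = mat 1" by (simp add: J_def mat2_eq_iff)
  have "P ** J ** (J ** Q) = mat 1" using assms J by (metis matrix_mul_assoc matrix_mul_rid)
  then obtain A where A: "A \<in> \<Sigma>" "(J ** Q ** A ** (P ** J))$1$1 \<noteq> 0" "(J ** Q ** A ** (P ** J))$2$1 \<noteq> 0"
    using no_small_real_orbit by blast
  have "J ** Q ** A ** (P ** J) = J ** (Q ** A ** P) ** J" by (simp add: matrix_mul_assoc)
  then show ?thesis using A by (intro bexI[OF _ A(1)]) (simp add: J_def)
qed

lemma invariant_sector:
  assumes lim: "mat 1 islimpt \<Sigma>"
  obtains P Q where "P ** Q = mat 1"
    "\<And>A. A \<in> \<Sigma> \<Longrightarrow> nonneg2 (Q ** A ** P) \<or> nonneg2 (- (Q ** A ** P))"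
proof -
  note sector = that
  obtain Y :: "real^2^2" where Y: "Y \<noteq> 0" "trace Y = 0"
    and exp_Y: "\<And>t. t \<ge> 0 \<Longrightarrow> 1 - det Y * t\<^sup>2 > 0 \<Longrightarrow> sqrt (1 - det Y * t\<^sup>2) *\<^sub>R mat 1 + t *\<^sub>R Y \<in> CL"
    by (rule one_parameter_limit[OF _ msemi lim]) (erule det_one, rule that)
  \<comment> \<open>Irrationality makes \<open>2 * cos \<phi>\<close> a trace value that the closure
    omits. The angle is acute because the one-parameter semigroup is available in the closure only
    for angles below \<open>pi / 2\<close>.\<close>
  obtain \<phi> where \<phi>: "0 < \<phi>" "\<phi> < pi / 2" "\<phi> / (2 * pi) \<notin> \<rat>" by (rule irrational_acute_angle)
  have cos\<phi>: "cos \<phi> > 0" and sin\<phi>: "sin \<phi> > 0" using \<phi> by (auto intro: cos_gt_zero sin_gt_zero)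
  define y where "y = 2 * cos \<phi>"
  have y: "\<bar>y\<bar> < 2"
  proof -
    have "cos \<phi> < cos 0" using \<phi> by (intro cos_monotone_0_pi) auto
    then show ?thesis using cos\<phi> by (simp add: y_def)
  qed
  have trCL: "trace A \<noteq> y" if "A \<in> CL" for A
    using no_irrational_rotation[OF that _ \<phi>(3)] by (auto simp: y_def)
  have finish: thesis
    if PQ: "P ** Q = mat 1" and P'Q': "P' ** Q' = mat 1"
      and nn: "\<And>A. P ** A ** Q \<in> CL \<Longrightarrow> nonneg2 (Q' ** A ** P') \<or> nonneg2 (- (Q' ** A ** P'))"
    for P Q P' Q' :: "real^2^2"
  proof (rule sector[of "P ** P'" "Q' ** Q"])
    show "P ** P' ** (Q' ** Q) = mat 1" using PQ P'Q' by (metis matrix_mul_assoc matrix_mul_rid)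
    fix A assume "A \<in> \<Sigma>"
    then have "P ** (Q ** A ** P) ** Q \<in> CL" using closure_subset by (auto simp: conj_cancel[OF PQ])
    from nn[OF this] show "nonneg2 (Q' ** Q ** A ** (P ** P')) \<or> nonneg2 (- (Q' ** Q ** A ** (P ** P')))"
      by (simp add: matrix_mul_assoc)
  qed
  have conj_CL: "\<And>A. A \<in> {A. P ** A ** Q \<in> CL} \<Longrightarrow> det A = 1" "msemi {A. P ** A ** Q \<in> CL}"
    "\<And>A. A \<in> {A. P ** A ** Q \<in> CL} \<Longrightarrow> - A \<in> {A. P ** A ** Q \<in> CL}"
    "\<And>A. A \<in> {A. P ** A ** Q \<in> CL} \<Longrightarrow> trace A \<noteq> y" if "P ** Q = mat 1" for P Q :: "real^2^2"
  proof -
    note QP = matrix_inverse_swap[OF that]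
    show "det A = 1" if "A \<in> {A. P ** A ** Q \<in> CL}" for A
      using det_closure[of \<Sigma>, OF det_one] that det_conj[OF QP, of A] by simp
    show "msemi {A. P ** A ** Q \<in> CL}"
      using msemi_closure[OF msemi] unfolding msemi_def by (simp add: conj_mult[OF QP])
    show "- A \<in> {A. P ** A ** Q \<in> CL}" if "A \<in> {A. P ** A ** Q \<in> CL}" for A
      using neg_closure[OF neg] that by (simp add: conj_neg)
    show "trace A \<noteq> y" if "A \<in> {A. P ** A ** Q \<in> CL}" for A
      using trCL that trace_conj[OF QP, of A] by force
  qed
  have subC: "P ** (Q ** A ** P) ** Q \<in> CL" if "P ** Q = mat 1" "A \<in> \<Sigma>" for P Q A :: "real^2^2"
    using that closure_subset by (auto simp: conj_cancel)
  consider "det Y > 0" | "det Y = 0" | "det Y < 0" by linarith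
  then show thesis
  proof cases
    case 1
    define t where "t = sin \<phi> / sqrt (det Y)"
    have t: "t \<ge> 0" using sin\<phi> 1 by (simp add: t_def)
    have "det Y * t\<^sup>2 = (sin \<phi>)\<^sup>2" using 1 by (simp add: t_def power_divide)
    then have e: "1 - det Y * t\<^sup>2 = (cos \<phi>)\<^sup>2" by (simp add: sin_squared_eq)
    have "sqrt (1 - det Y * t\<^sup>2) *\<^sub>R mat 1 + t *\<^sub>R Y \<in> CL"
      by (rule exp_Y[OF t]) (use e cos\<phi> in simp)
    moreover have "trace (sqrt (1 - det Y * t\<^sup>2) *\<^sub>R mat 1 + t *\<^sub>R Y) = y"
    proof -
      have "Y$2$2 = - Y$1$1" using Y(2) by (simp add: trace_2)
      then show ?thesis using cos\<phi> unfolding e by (simp add: trace_2 y_def)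
    qed
    ultimately show thesis using trCL by blast
  next
    case 2
    obtain P Q where PQ: "P ** Q = mat 1" and D: "Q ** Y ** P = M2 0 1 0 0"
      by (rule jordan_nilpotent[OF Y(2) 2 Y(1)])
    define C where "C = {A. P ** A ** Q \<in> CL}"
    have E: "shear s \<in> C" if "s \<ge> 0" for s
    proof -
      have "1 *\<^sub>R mat 1 + s *\<^sub>R Y \<in> CL" using exp_Y[OF that] 2 by simp
      then have "P ** (Q ** (1 *\<^sub>R mat 1 + s *\<^sub>R Y) ** P) ** Q \<in> CL" by (simp add: conj_cancel[OF PQ])
      then have "1 *\<^sub>R mat 1 + s *\<^sub>R M2 0 1 0 0 \<in> C" unfolding conj_combination[OF PQ] D by (simp add: C_def)
      moreover have "1 *\<^sub>R mat 1 + s *\<^sub>R M2 0 1 0 0 = shear s" by (simp add: mat2_eq_iff shear_def)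
      ultimately show ?thesis by simp
    qed
    obtain A where A: "A \<in> \<Sigma>" "(Q ** A ** P)$2$1 \<noteq> 0" using no_small_real_orbit[OF PQ] by blast
    have AC: "Q ** A ** P \<in> C" using subC[OF PQ A(1)] by (simp add: C_def)
    note CC = conj_CL[OF PQ, folded C_def]
    obtain P' Q' where "P' ** Q' = mat 1" "\<And>A. A \<in> C \<Longrightarrow> nonneg2 (Q' ** A ** P') \<or> nonneg2 (- (Q' ** A ** P'))"
      using nonneg_conj_of_shear[of C y "Q ** A ** P"] CC E y AC A(2) by metis
    then show thesis using finish[OF PQ] by (simp add: C_def)
  next
    case 3
    define l where "l = sqrt (- det Y)"
    have l: "l > 0" "det Y = - (l\<^sup>2)" using 3 by (simp_all add: l_def)
    obtain P Q where PQ: "P ** Q = mat 1" and D: "Q ** Y ** P = M2 l 0 0 (- l)"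
      by (rule diagonalize_traceless[OF Y(2) l(2,1)])
    define C where "C = {A. P ** A ** Q \<in> CL}"
    have E: "stretch s \<in> C" if "s \<ge> 0" for s
    proof -
      \<comment> \<open>With this coefficient the element is \<open>cosh s + sinh s (Y / l)\<close>,
        which is conjugate to \<open>stretch s\<close>.\<close>
      define t where "t = sinh s / l"
      have t: "t \<ge> 0" using that l by (simp add: t_def)
      have "1 - det Y * t\<^sup>2 = (cosh s)\<^sup>2"
        using l by (simp add: t_def power_divide cosh_square_eq)
      then have "cosh s *\<^sub>R mat 1 + t *\<^sub>R Y \<in> CL" using exp_Y[OF t] by simp
      then have "P ** (Q ** (cosh s *\<^sub>R mat 1 + t *\<^sub>R Y) ** P) ** Q \<in> CL" by (simp add: conj_cancel[OF PQ])
      then have "cosh s *\<^sub>R mat 1 + t *\<^sub>R M2 l 0 0 (- l) \<in> C"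
        unfolding conj_combination[OF PQ] D by (simp add: C_def)
      moreover have "cosh s *\<^sub>R mat 1 + t *\<^sub>R M2 l 0 0 (- l) = stretch s"
        using l by (simp add: mat2_eq_iff stretch_def t_def cosh_plus_sinh cosh_minus_sinh)
      ultimately show ?thesis by simp
    qed
    note CC = conj_CL[OF PQ, folded C_def]
    obtain A where A: "A \<in> \<Sigma>" "(Q ** A ** P)$1$1 \<noteq> 0" "(Q ** A ** P)$2$1 \<noteq> 0"
      using no_small_real_orbit[OF PQ] by blast
    have AC: "Q ** A ** P \<in> C" using subC[OF PQ A(1)] by (simp add: C_def)
    obtain B where B: "B \<in> \<Sigma>" "(Q ** B ** P)$2$2 \<noteq> 0" "(Q ** B ** P)$1$2 \<noteq> 0"
      using no_small_real_orbit'[OF PQ] by blast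
    define b where "b = Q ** B ** P"
    have b: "b \<in> C" "b$2$2 \<noteq> 0" "b$1$2 \<noteq> 0" using subC[OF PQ B(1)] B by (simp_all add: C_def b_def)
    \<comment> \<open>If \<open>b$1$1 = 0\<close>, then \<open>b$1$2 * b$2$1 = -1\<close> by the
      determinant, and the square of \<open>b\<close> has no zero in its first row.\<close>
    have "\<exists>g\<in>C. g$1$1 \<noteq> 0 \<and> g$1$2 \<noteq> 0"
    proof (cases "b$1$1 = 0")
      case True
      have "b ** b \<in> C" using CC(2) b(1) by (simp add: msemi_def)
      moreover have "b$1$2 * b$2$1 = -1" using CC(1)[OF b(1)] True by (simp add: det_2)
      ultimately show ?thesis using True b by (intro bexI[of _ "b ** b"]) auto
    qed (use b in blast)
    then obtain g where g: "g \<in> C" "g$1$1 \<noteq> 0" "g$1$2 \<noteq> 0" by blast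
    obtain P' Q' where "P' ** Q' = mat 1" "\<And>A. A \<in> C \<Longrightarrow> nonneg2 (Q' ** A ** P') \<or> nonneg2 (- (Q' ** A ** P'))"
      using nonneg_conj_of_stretch[of C y "Q ** A ** P" g] CC E y AC A(2,3) g by metis
    then show thesis using finish[OF PQ] by (simp add: C_def)
  qed
qed

end

section \<open>Lifting Moebius semigroups to matrices\<close>

definition lift :: "(complex option \<Rightarrow> complex option) set \<Rightarrow> (real^2^2) set" where
  "lift T = {A. det A = 1 \<and> mobius A \<in> T}"

lemma mobius_neg: "mobius (- A) = mobius A"
  using mobius_scale[of "-1" A] by simp

lemma mobius_eq_id:
  assumes "det A = 1" "mobius A = id"
  shows "A = mat 1 \<or> A = - mat 1"
proof -
  have "mobius A None = None" "mobius A (Some 0) = Some 0" "mobius A (Some 1) = Some 1"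
    using assms(2) by simp_all
  then have c: "A$2$1 = 0" and b: "A$1$2 = 0" and ad: "A$1$1 = A$2$2"
    by (auto simp: mobius_def Let_def split: if_splits)
  then have "A$1$1 * A$1$1 = 1" using assms(1) by (simp add: det_2)
  then have "A$1$1 = 1 \<or> A$1$1 = -1" by (simp add: square_eq_1_iff)
  then show ?thesis using b c ad by (auto simp: mat2_eq_iff)
qed

lemma mobius_eq_iff:
  assumes "det A = 1" "det B = 1"
  shows "mobius A = mobius B \<longleftrightarrow> A = B \<or> A = - B"
proof
  assume eq: "mobius A = mobius B"
  have "mobius (adj2 B ** A) = mobius (adj2 B) \<circ> mobius B"
    using assms eq mobius_compose[of "adj2 B" A] by simp
  also have "\<dots> = id"
    using assms mobius_compose[of "adj2 B" B] by (simp add: adj2_inverse mobius_one)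
  finally have "adj2 B ** A = mat 1 \<or> adj2 B ** A = - mat 1"
    using assms by (intro mobius_eq_id) (simp_all add: det_mul)
  then have "B ** (adj2 B ** A) = B \<or> B ** (adj2 B ** A) = - B"
    by (auto simp: matrix_neg_mult_2)
  moreover have "B ** (adj2 B ** A) = A"
    using adj2_inverse(1)[OF assms(2)] by (simp add: matrix_mul_assoc)
  ultimately show "A = B \<or> A = - B" by simp
qed (auto simp: mobius_neg)

lemma mobius_mult:
  assumes "det A = 1" "det B = 1"
  shows "mobius (A ** B) = mobius A \<circ> mobius B"
  using mobius_compose[of A B] assms by simp

lemma mobius_maps_lift:
  assumes "f \<in> mobius_maps"
  obtains A where "det A = 1" "f = mobius A"
  using assms unfolding mobius_image_SL2[symmetric] SL2_def by auto

text \<open>\<open>A\<close> and \<open>- A\<close> are the only lifts of determinant 1 of a map,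
  and \<open>- mat 1\<close> is far from \<open>mat 1\<close>, so the projection is injective near
  the identity. Open sets of maps correspond to open sets of matrices closed under negation, whence
  the union of a ball with its negative.\<close>

lemma not_semidiscrete_iff:
  "\<not> semidiscrete T \<longleftrightarrow> mat 1 islimpt lift T"
proof
  assume "\<not> semidiscrete T"
  then have der: "id \<in> mobius_topology derived_set_of T" by (simp add: semidiscrete_def)
  show "mat 1 islimpt lift T"
    unfolding islimpt_approachable
  proof (intro allI impI)
    fix e :: real assume e: "e > 0"
    define U where "U = mobius ` (SL2 \<inter> ball (mat 1) e)"
    have "{A \<in> SL2. mobius A \<in> U} = SL2 \<inter> (ball (mat 1) e \<union> uminus ` ball (mat 1) e)"
    proof -
      have "mobius A \<in> U \<longleftrightarrow> A \<in> ball (mat 1) e \<union> uminus ` ball (mat 1) e" if A: "A \<in> SL2" for A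
      proof
        assume "mobius A \<in> U"
        then obtain B where "B \<in> SL2" "B \<in> ball (mat 1) e" "mobius A = mobius B" by (auto simp: U_def)
        then show "A \<in> ball (mat 1) e \<union> uminus ` ball (mat 1) e"
          using A mobius_eq_iff[of A B] by (auto simp: SL2_def)
      next
        assume "A \<in> ball (mat 1) e \<union> uminus ` ball (mat 1) e"
        then consider "A \<in> ball (mat 1) e" | "- A \<in> ball (mat 1) e" by auto
        then show "mobius A \<in> U"
        proof cases
          case 2
          have "- A \<in> SL2" using A by (simp add: SL2_def)
          then have "mobius (- A) \<in> U" using 2 unfolding U_def by blast
          then show ?thesis by (simp add: mobius_neg)
        qed (use A U_def in blast)
      qed
      then show ?thesis by blast
    qed
    moreover have "open (ball (mat 1 :: real^2^2) e \<union> uminus ` ball (mat 1) e)"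
      by (intro open_Un open_ball open_negations)
    ultimately have "openin mobius_topology U"
      unfolding openin_mobius_topology by (auto simp: U_def openin_open_Int)
    moreover have "id \<in> U"
      unfolding U_def using e by (intro image_eqI[of _ _ "mat 1"]) (auto simp: mobius_one SL2_def)
    ultimately obtain f where f: "f \<noteq> id" "f \<in> T" "f \<in> U"
      using der unfolding in_derived_set_of by blast
    then obtain A where A: "det A = 1" "A \<in> ball (mat 1) e" "f = mobius A"
      by (auto simp: U_def SL2_def)
    moreover have "A \<noteq> mat 1" using f(1) A(3) mobius_one by auto
    ultimately show "\<exists>A\<in>lift T. A \<noteq> mat 1 \<and> dist A (mat 1) < e"
      using f(2) by (auto simp: lift_def dist_commute)
  qed
next
  assume lim: "mat 1 islimpt lift T"
  have "\<exists>f. f \<noteq> id \<and> f \<in> T \<and> f \<in> U" if U: "openin mobius_topology U" "id \<in> U" for U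
  proof -
    obtain V where V: "open V" "{A \<in> SL2. mobius A \<in> U} = SL2 \<inter> V"
      using U(1) unfolding openin_mobius_topology openin_open by blast
    have "mat 1 \<in> {A \<in> SL2. mobius A \<in> U}" using U(2) by (simp add: mobius_one SL2_def)
    \<comment> \<open>Radius 1 keeps out \<open>- mat 1\<close>, the other lift of the
      identity.\<close>
    then have 1: "mat 1 \<in> V \<inter> ball (mat 1) 1" unfolding V(2) by simp
    obtain A where A: "A \<in> lift T" "A \<in> V \<inter> ball (mat 1) 1" "A \<noteq> mat 1"
      by (rule islimptE[OF lim 1 open_Int[OF V(1) open_ball]])
    have "A \<noteq> - mat 1"
    proof
      assume "A = - mat 1"
      then have "dist (mat 1 :: real^2^2) (- mat 1) < 1" using A(2) by simp
      moreover have "\<bar>(mat 1 - (- mat 1) :: real^2^2)$1$1\<bar> \<le> norm (mat 1 - (- mat 1) :: real^2^2)"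
        using order_trans[OF Finite_Cartesian_Product.norm_nth_le Finite_Cartesian_Product.norm_nth_le,
            of "(mat 1 - (- mat 1) :: real^2^2)" 1 1] by simp
      ultimately show False by (simp add: dist_norm)
    qed
    then have "mobius A \<noteq> id" using A(1,3) mobius_eq_id by (auto simp: lift_def)
    moreover have "A \<in> {A \<in> SL2. mobius A \<in> U}" unfolding V(2) using A(1,2) by (simp add: lift_def SL2_def)
    ultimately show ?thesis using A(1) by (auto simp: lift_def)
  qed
  moreover have "id \<in> mobius_maps" 
    unfolding mobius_maps_def by (intro image_eqI[of _ _ "mat 1"]) (simp_all add: mobius_one)
  ultimately have "id \<in> mobius_topology derived_set_of T"
    unfolding in_derived_set_of topspace_mobius_topology by blast
  then show "\<not> semidiscrete T" by (simp add: semidiscrete_def)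
qed

lemma compositions_closed:
  assumes "f \<in> compositions T" "g \<in> compositions T"
  shows "f \<circ> g \<in> compositions T"
  using assms
proof induction
  case (comp f h)
  then show ?case by (metis comp_assoc compositions.comp)
qed (rule compositions.comp)

lemma compositions_subset:
  assumes "mobius_semigroup S" "T \<subseteq> S"
  shows "compositions T \<subseteq> S"
proof
  fix f assume "f \<in> compositions T"
  then show "f \<in> S" using assms by induction (auto simp: mobius_semigroup_def)
qed

lemma compositions_singleton:
  assumes "f \<in> compositions {h}"
  obtains n where "n > 0" "f = h ^^ n"
proof -
  have "\<exists>n>0. f = h ^^ n" using assms
  proof induction
    case (base f) then show ?case by (intro exI[of _ 1]) simp
  next
    case (comp f g)
    then obtain n where "f = h" "g = h ^^ n" by auto
    then show ?case by (intro exI[of _ "Suc n"]) simp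
  qed
  then show thesis using that by blast
qed

text \<open>Two elements may generate a semigroup that needs only one generator, and then the
  hypothesis does not apply. A single generator \<open>h\<close> would make both of them positive
  powers of \<open>h\<close>, which \<open>ncyc\<close> rules out.\<close>

lemma two_generator_semidiscrete:
  assumes S: "mobius_semigroup S"
    and pairs: "\<forall>T. mobius_semigroup T \<and> n_generator 2 T \<and> T \<subseteq> S \<longrightarrow> semidiscrete T"
    and fg: "f \<in> S" "g \<in> S"
    and ncyc: "\<And>h m n. h \<in> compositions {f, g} \<Longrightarrow> m > 0 \<Longrightarrow> n > 0 \<Longrightarrow> f = h ^^ m \<Longrightarrow> g = h ^^ n \<Longrightarrow> False"
  shows "semidiscrete (compositions {f, g})"
proof (rule pairs[rule_format], intro conjI)
  let ?T = "compositions {f, g}"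
  show sub: "?T \<subseteq> S" using compositions_subset[OF S] fg by simp
  have f: "f \<in> ?T" and g: "g \<in> ?T" by (auto intro: compositions.base)
  show "mobius_semigroup ?T"
    using f sub S compositions_closed by (auto simp: mobius_semigroup_def)
  have "f \<noteq> g" using ncyc[OF f, of 1 1] by auto
  moreover have "generated_by ?T {f, g}" using f g by (simp add: generated_by_def)
  moreover have "2 \<le> card T'" if T': "finite T'" "generated_by ?T T'" for T'
  proof (rule ccontr)
    assume "\<not> 2 \<le> card T'"
    then consider "card T' = 0" | "card T' = 1" by linarith
    then show False
    proof cases
      case 1
      then have "f \<in> compositions {}" using T' f by (simp add: generated_by_def)
      then show False by induction auto
    next
      case 2
      then obtain h where h: "T' = {h}" by (rule card_1_singletonE)
      then have "h \<in> ?T" "f \<in> compositions {h}" "g \<in> compositions {h}"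
        using T' f g by (auto simp: generated_by_def)
      then show False using ncyc compositions_singleton by metis
    qed
  qed
  ultimately show "n_generator 2 ?T"
    unfolding n_generator_def by (intro conjI exI[of _ "{f, g}"] allI impI) auto
qed

lemma msg_lift_compositions:
  assumes "det A = 1" "det B = 1"
  shows "msg {A, B} \<subseteq> lift (compositions {mobius A, mobius B})"
proof
  fix M assume "M \<in> msg {A, B}"
  then show "M \<in> lift (compositions {mobius A, mobius B})"
  proof induction
    case (base M)
    then show ?case using assms by (auto simp: lift_def intro: compositions.base)
  next
    case (mult M N)
    then have "det M = 1" "det N = 1" "mobius M \<in> {mobius A, mobius B}" "mobius N \<in> compositions {mobius A, mobius B}"
      using assms by (auto simp: lift_def)
    then show ?case by (simp add: lift_def det_mul mobius_mult compositions.comp)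
  qed
qed

lemma msemi_lift:
  assumes "mobius_semigroup S"
  shows "msemi (lift S)"
  using assms by (auto simp: msemi_def lift_def det_mul mobius_mult mobius_semigroup_def)

lemma funpow_comm: "h ^^ m \<circ> h ^^ n = h ^^ n \<circ> h ^^ m"
  by (metis add.commute funpow_add)

lemma mobius_fixes_i:
  assumes "det B = 1" "disp B = 0"
  shows "mobius B (Some \<i>) = Some \<i>"
proof -
  have "B$1$1 = B$2$2 \<and> B$1$2 = - B$2$1"
    using assms(2) unfolding disp_def by (metis add.commute add_eq_0_iff eq_iff_diff_eq_0 sum_power2_eq_zero_iff)
  then have ab: "B$2$2 = B$1$1" "B$1$2 = - B$2$1" by auto
  let ?a = "complex_of_real (B$1$1)" and ?c = "complex_of_real (B$2$1)"
  have "B$1$1 \<noteq> 0 \<or> B$2$1 \<noteq> 0" using assms(1) by (auto simp: det_2 ab)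
  then have nz: "?c * \<i> + ?a \<noteq> 0" by (auto simp: complex_eq_iff)
  have "?a * \<i> + - ?c = \<i> * (?c * \<i> + ?a)" by (simp add: algebra_simps)
  then show ?thesis using nz by (simp add: mobius_def Let_def ab)
qed

lemma mobius_i_upper:
  assumes "det P > 0"
  shows "mobius P (Some \<i>) \<in> closed_half_plane"
proof -
  define a b c d where "a = P$1$1" and "b = P$1$2" and "c = P$2$1" and "d = P$2$2"
  have D: "a * d - b * c > 0" using assms by (simp add: det_2 a_def b_def c_def d_def)
  then have "c \<noteq> 0 \<or> d \<noteq> 0" by auto
  then have nz: "of_real c * \<i> + of_real d \<noteq> 0" by (auto simp: complex_eq_iff)
  have "Im ((of_real a * \<i> + of_real b) / (of_real c * \<i> + of_real d)) = (a * d - b * c) / (d\<^sup>2 + c\<^sup>2)"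
    by (simp add: Im_divide algebra_simps)
  moreover have "d\<^sup>2 + c\<^sup>2 > 0" using \<open>c \<noteq> 0 \<or> d \<noteq> 0\<close> by (auto simp: sum_power2_gt_zero_iff)
  ultimately have "Im ((of_real a * \<i> + of_real b) / (of_real c * \<i> + of_real d)) > 0" using D by simp
  then show ?thesis using nz
    by (auto simp: mobius_def Let_def closed_half_plane_def a_def b_def c_def d_def)
qed

definition pt :: "real^2 \<Rightarrow> complex option" where
  "pt w = (if w$2 = 0 then None else Some (of_real (w$1 / w$2)))"

lemma matrix_vector_2:
  fixes A :: "real^2^2"
  shows "(A *v w)$1 = A$1$1 * w$1 + A$1$2 * w$2" "(A *v w)$2 = A$2$1 * w$1 + A$2$2 * w$2"
  by (simp_all add: matrix_vector_mult_def sum_2)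

lemma vec2_eq_iff: "v = w \<longleftrightarrow> v$1 = w$1 \<and> v$2 = w$2" for v w :: "'a^2"
  by (auto simp: vec_eq_iff forall_2)

lemma mobius_pt:
  assumes "w \<noteq> 0"
  shows "mobius A (pt w) = pt (A *v w)"
proof (cases "w$2 = 0")
  case True
  then have "w$1 \<noteq> 0" using assms by (simp add: vec2_eq_iff)
  then show ?thesis using True by (simp add: mobius_def Let_def pt_def matrix_vector_2)
next
  case False
  define z where "z = w$1 / w$2"
  have w1: "w$1 = z * w$2" using False by (simp add: z_def)
  have e: "(A *v w)$1 = (A$1$1 * z + A$1$2) * w$2" "(A *v w)$2 = (A$2$1 * z + A$2$2) * w$2"
    by (simp_all add: matrix_vector_2 w1 algebra_simps)
  have n: "complex_of_real (A$2$1) * of_real z + of_real (A$2$2) = of_real (A$2$1 * z + A$2$2)"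
    "complex_of_real (A$1$1) * of_real z + of_real (A$1$2) = of_real (A$1$1 * z + A$1$2)" by simp_all
  have "pt w = Some (of_real z)" using False by (simp add: pt_def z_def)
  then have "mobius A (pt w) = (if A$2$1 * z + A$2$2 = 0 then None
      else Some (of_real (A$1$1 * z + A$1$2) / of_real (A$2$1 * z + A$2$2)))"
    unfolding mobius_def Let_def n by (simp only: option.case of_real_eq_0_iff n)
  then show ?thesis using False by (simp add: pt_def e)
qed

lemma pt_scale: "k \<noteq> 0 \<Longrightarrow> pt (k *\<^sub>R w) = pt w"
  by (simp add: pt_def)

lemma pt_in_closed_half_plane: "pt w \<in> closed_half_plane"
proof -
  have "pt w = ext_of_real (if w$2 = 0 then None else Some (w$1 / w$2))"
    by (simp add: pt_def ext_of_real_def)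
  then show ?thesis unfolding closed_half_plane_def ext_reals_def by blast
qed

lemma matrix_vector_axis_nonzero:
  fixes P Q :: "real^2^2"
  assumes "Q ** P = mat 1"
  shows "P *v axis i 1 \<noteq> 0"
proof
  assume "P *v axis i 1 = 0"
  then have "Q *v (P *v axis i 1) = 0" by simp
  then show False by (simp add: matrix_vector_mul_assoc assms axis_eq_0_iff)
qed

lemma lift_nonelementary:
  assumes S: "mobius_semigroup S" and ne: "\<not> elementary S"
    and pairs: "\<forall>T. mobius_semigroup T \<and> n_generator 2 T \<and> T \<subseteq> S \<longrightarrow> semidiscrete T"
  shows "nonelementary_pairwise_semidiscrete (lift S)"
proof
  have lift_ex: "\<exists>A\<in>lift S. f = mobius A" if "f \<in> S" for f
  proof -
    have "f \<in> mobius_maps" using that S by (auto simp: mobius_semigroup_def)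
    then obtain A where "det A = 1" "f = mobius A" by (rule mobius_maps_lift)
    then show ?thesis using that by (auto simp: lift_def)
  qed
  show "det A = 1" if "A \<in> lift S" for A using that by (simp add: lift_def)
  show "msemi (lift S)" by (rule msemi_lift[OF S])
  show "- A \<in> lift S" if "A \<in> lift S" for A using that by (simp add: lift_def mobius_neg)
  show "\<not> mat 1 islimpt msg {A, B}" if A: "A \<in> lift S" and B: "B \<in> lift S" and g: "gam A B > 0" for A B
  proof
    assume lim: "mat 1 islimpt msg {A, B}"
    have dA: "det A = 1" "det B = 1" using A B by (simp_all add: lift_def)
    have "semidiscrete (compositions {mobius A, mobius B})"
    proof (rule two_generator_semidiscrete[OF S])
      fix h :: "complex option \<Rightarrow> complex option" and m n :: nat
      assume "mobius A = h ^^ m" "mobius B = h ^^ n"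
      then have "mobius (A ** B) = mobius (B ** A)" using dA by (simp add: mobius_mult funpow_comm)
      then have "A ** B = B ** A \<or> A ** B = - (B ** A)"
        using mobius_eq_iff[of "A ** B" "B ** A"] dA by (simp add: det_mul)
      moreover have "B ** A ** adj2 A ** adj2 B = mat 1"
        using adj2_inverse(1)[OF dA(1)] adj2_inverse(1)[OF dA(2)]
        by (metis matrix_mul_assoc matrix_mul_rid)
      ultimately have "A ** B ** adj2 A ** adj2 B = mat 1 \<or> A ** B ** adj2 A ** adj2 B = - mat 1"
        by (auto simp: matrix_neg_mult_2)
      moreover have "trace (mat 1 :: real^2^2) = 2" "trace (- mat 1 :: real^2^2) = -2"
        by (simp_all add: trace_2)
      ultimately show False using g unfolding gam_def by auto
    qed (use A B pairs in \<open>auto simp: lift_def\<close>)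
    moreover have "mat 1 islimpt lift (compositions {mobius A, mobius B})"
      by (rule islimpt_subset[OF lim msg_lift_compositions[OF dA]])
    ultimately show False using not_semidiscrete_iff by blast
  qed
  show "\<exists>A\<in>lift S. disp (Q ** A ** P) \<noteq> 0" if PQ: "P ** Q = mat 1" and P: "det P > 0" for P Q
  proof (rule ccontr)
    assume n: "\<not> ?thesis"
    have "f (mobius P (Some \<i>)) = mobius P (Some \<i>)" if "f \<in> S" for f
    proof -
      obtain A where A: "A \<in> lift S" "f = mobius A" using lift_ex[OF \<open>f \<in> S\<close>] by blast
      define R where "R = Q ** A ** P"
      have R: "det R = 1" "disp R = 0" using A n by (auto simp: R_def det_conj[OF PQ] lift_def)
      have "A ** P = P ** R" unfolding R_def by (metis PQ matrix_mul_assoc matrix_mul_lid)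
      then have "mobius A \<circ> mobius P = mobius P \<circ> mobius R"
        using mobius_compose[of A P] mobius_compose[of P R] A P R by (simp add: lift_def)
      then have "mobius A (mobius P (Some \<i>)) = mobius P (mobius R (Some \<i>))" by (metis comp_apply)
      then show ?thesis using mobius_fixes_i[OF R] A(2) by simp
    qed
    then have "(\<lambda>f. f (mobius P (Some \<i>))) ` S \<subseteq> {mobius P (Some \<i>)}" by blast
    then have "elementary S"
      unfolding elementary_def using mobius_i_upper[OF P] finite_subset by blast
    then show False using ne by blast
  qed
  show "\<exists>A\<in>lift S. (Q ** A ** P)$1$1 \<noteq> 0 \<and> (Q ** A ** P)$2$1 \<noteq> 0"
    if PQ: "P ** Q = mat 1" for P Q :: "real^2^2"
  proof (rule ccontr)
    assume n: "\<not> ?thesis"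
    define e where "e i = P *v axis i 1" for i :: 2
    have e0: "e i \<noteq> 0" for i
      unfolding e_def by (rule matrix_vector_axis_nonzero[OF matrix_inverse_swap[OF PQ]])
    have "f (pt (e 1)) \<in> {pt (e 1), pt (e 2)}" if "f \<in> S" for f
    proof -
      obtain A where A: "A \<in> lift S" "f = mobius A" using lift_ex[OF \<open>f \<in> S\<close>] by blast
      define R where "R = Q ** A ** P"
      have detR: "det R = 1" using A by (auto simp: R_def det_conj[OF PQ] lift_def)
      have AP: "A ** P = P ** R" unfolding R_def by (metis PQ matrix_mul_assoc matrix_mul_lid)
      have Ae: "A *v e 1 = P *v (R *v axis 1 1)" by (simp add: e_def matrix_vector_mul_assoc AP)
      have col: "(R *v axis 1 1)$1 = R$1$1" "(R *v axis 1 1)$2 = R$2$1"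
        by (simp_all add: matrix_vector_2 axis_def)
      have "R$1$1 = 0 \<or> R$2$1 = 0" using A n by (auto simp: R_def)
      then have "\<exists>k i. k \<noteq> 0 \<and> R *v axis 1 1 = k *\<^sub>R axis i 1"
      proof
        assume z: "R$1$1 = 0"
        then have "R$2$1 \<noteq> 0" using detR by (auto simp: det_2)
        then show ?thesis using z col
          by (intro exI[of _ "R$2$1"] exI[of _ 2]) (simp add: vec2_eq_iff axis_def)
      next
        assume z: "R$2$1 = 0"
        then have "R$1$1 \<noteq> 0" using detR by (auto simp: det_2)
        then show ?thesis using z col
          by (intro exI[of _ "R$1$1"] exI[of _ 1]) (simp add: vec2_eq_iff axis_def)
      qed
      then obtain k and i :: 2 where k: "k \<noteq> 0" "R *v axis 1 1 = k *\<^sub>R axis i 1" by blast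
      have "A *v e 1 = k *\<^sub>R e i" unfolding Ae k(2) by (simp add: e_def matrix_vector_mult_scaleR)
      then have "f (pt (e 1)) = pt (e i)" using mobius_pt[OF e0, of A 1] A(2) pt_scale[OF k(1)] by simp
      then show ?thesis using exhaust_2[of i] by auto
    qed
    then have "(\<lambda>f. f (pt (e 1))) ` S \<subseteq> {pt (e 1), pt (e 2)}" by blast
    then have "finite ((\<lambda>f. f (pt (e 1))) ` S)" by (rule finite_subset) simp
    then show False using ne pt_in_closed_half_plane unfolding elementary_def by blast
  qed
qed

section \<open>Sectors and closed intervals\<close>

text \<open>The arc cut out by the sector spanned by the columns of \<open>P\<close>: the matrix \<open>adj2 P\<close> computes
  coordinates with respect to these columns, up to the factor \<open>det P\<close>.\<close>

definition sector_arc :: "real^2^2 \<Rightarrow> complex option set" where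
  "sector_arc P = {pt w | w. w \<noteq> 0 \<and> 0 \<le> (adj2 P *v w)$1 \<and> 0 \<le> (adj2 P *v w)$2}"

text \<open>Up to positive scaling a finite real point has the two representatives
  \<open>(x, 1)\<close> and \<open>(- x, -1)\<close>, which accounts for the two sign
  patterns.\<close>

lemma Some_in_sector_arc:
  "Some z \<in> sector_arc P \<longleftrightarrow> (\<exists>x. z = of_real x \<and>
    (0 \<le> P$2$2 * x - P$1$2 \<and> 0 \<le> P$1$1 - P$2$1 * x \<or> P$2$2 * x - P$1$2 \<le> 0 \<and> P$1$1 - P$2$1 * x \<le> 0))"
    (is "_ \<longleftrightarrow> ?R")
proof
  assume "Some z \<in> sector_arc P"
  then obtain w where w: "Some z = pt w" "0 \<le> (adj2 P *v w)$1" "0 \<le> (adj2 P *v w)$2"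
    by (auto simp: sector_arc_def)
  have w2: "w$2 \<noteq> 0" and z: "z = of_real (w$1 / w$2)"
    using w(1) by (auto simp: pt_def split: if_splits)
  define x where "x = w$1 / w$2"
  have w1: "w$1 = x * w$2" using w2 by (simp add: x_def)
  have e: "0 \<le> (P$2$2 * x - P$1$2) * w$2" "0 \<le> (P$1$1 - P$2$1 * x) * w$2"
    using w(2,3) by (simp_all add: matrix_vector_2 w1 algebra_simps)
  show ?R
  proof (intro exI[of _ x] conjI)
    show "0 \<le> P$2$2 * x - P$1$2 \<and> 0 \<le> P$1$1 - P$2$1 * x \<or> P$2$2 * x - P$1$2 \<le> 0 \<and> P$1$1 - P$2$1 * x \<le> 0"
      using e w2 unfolding zero_le_mult_iff by linarith
  qed (simp add: z x_def)
next
  assume ?R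
  then obtain x where z: "z = of_real x" and x: "0 \<le> P$2$2 * x - P$1$2 \<and> 0 \<le> P$1$1 - P$2$1 * x \<or>
    P$2$2 * x - P$1$2 \<le> 0 \<and> P$1$1 - P$2$1 * x \<le> 0" by blast
  define s :: real where "s = (if 0 \<le> P$2$2 * x - P$1$2 \<and> 0 \<le> P$1$1 - P$2$1 * x then 1 else -1)"
  define w :: "real^2" where "w = vector [s * x, s]"
  have s: "s \<noteq> 0" by (simp add: s_def)
  have "Some z = pt w" using s by (simp add: w_def pt_def z)
  moreover have "w \<noteq> 0" using s by (simp add: w_def vec2_eq_iff)
  moreover have "0 \<le> s * (P$2$2 * x - P$1$2)" "0 \<le> s * (P$1$1 - P$2$1 * x)"
    using x by (auto simp: s_def)
  then have "0 \<le> (adj2 P *v w)$1" "0 \<le> (adj2 P *v w)$2"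
    by (simp_all add: w_def matrix_vector_2 algebra_simps)
  ultimately show "Some z \<in> sector_arc P" unfolding sector_arc_def by blast
qed

lemma None_in_sector_arc:
  "None \<in> sector_arc P \<longleftrightarrow> P$2$2 * P$2$1 \<le> 0"
proof
  assume "None \<in> sector_arc P"
  then obtain w where w: "None = pt w" "w \<noteq> 0" "0 \<le> (adj2 P *v w)$1" "0 \<le> (adj2 P *v w)$2"
    by (auto simp: sector_arc_def)
  have w2: "w$2 = 0" using w(1) by (auto simp: pt_def split: if_splits)
  then have w1: "w$1 \<noteq> 0" using w(2) by (simp add: vec2_eq_iff)
  have "0 \<le> (adj2 P *v w)$1 * (adj2 P *v w)$2" using w by simp
  also have "\<dots> = - (P$2$2 * P$2$1) * (w$1 * w$1)" by (simp add: matrix_vector_2 w2)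
  finally have *: "0 \<le> - (P$2$2 * P$2$1) * (w$1 * w$1)" .
  have "0 < w$1 * w$1" using w1 by (metis mult_neg_neg mult_pos_pos linorder_neqE_linordered_idom)
  then show "P$2$2 * P$2$1 \<le> 0" using * mult_neg_pos[of "- (P$2$2 * P$2$1)" "w$1 * w$1"] by linarith
next
  assume a: "P$2$2 * P$2$1 \<le> 0"
  define s :: real where "s = (if P$2$2 \<ge> 0 \<and> P$2$1 \<le> 0 then 1 else -1)"
  define w :: "real^2" where "w = vector [s, 0]"
  have s: "s \<noteq> 0" by (simp add: s_def)
  have "0 \<le> s * P$2$2" "0 \<le> - s * P$2$1" using a by (auto simp: s_def mult_le_0_iff)
  then have "0 \<le> (adj2 P *v w)$1" "0 \<le> (adj2 P *v w)$2"
    by (simp_all add: w_def matrix_vector_2 mult.commute)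
  moreover have "None = pt w" "w \<noteq> 0" using s by (auto simp: w_def pt_def vec2_eq_iff)
  ultimately show "None \<in> sector_arc P" unfolding sector_arc_def by blast
qed

lemma ext_of_real_image_eqI:
  assumes "None \<in> J \<longleftrightarrow> None \<in> I" and "\<And>x. Some (of_real x) \<in> J \<longleftrightarrow> Some x \<in> I"
    and "\<And>z. Some z \<in> J \<Longrightarrow> z \<in> \<real>"
  shows "J = ext_of_real ` I"
proof (rule Set.set_eqI)
  fix p
  show "p \<in> J \<longleftrightarrow> p \<in> ext_of_real ` I"
  proof (cases p)
    case None
    have "None \<in> ext_of_real ` I \<longleftrightarrow> None \<in> I" by (auto simp: ext_of_real_def image_iff)
    then show ?thesis using None assms(1) by simp
  next
    case (Some z)
    have "Some (of_real x) = ext_of_real y \<longleftrightarrow> y = Some x" for x y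
      by (cases y) (auto simp: ext_of_real_def)
    then have "Some (of_real x) \<in> ext_of_real ` I \<longleftrightarrow> Some x \<in> I" for x
      by (simp add: image_iff)
    moreover have "Some z = ext_of_real y \<Longrightarrow> z \<in> \<real>" for y
      by (cases y) (auto simp: ext_of_real_def)
    then have "z \<in> \<real>" if "Some z \<in> ext_of_real ` I" using that by blast
    ultimately show ?thesis using Some assms(2,3) by (metis Reals_cases)
  qed
qed

text \<open>The coordinate \<open>w$1 / w$2\<close> decreases as \<open>w\<close> turns
  counterclockwise. With \<open>det P > 0\<close> the arc therefore runs in the positive direction
  from the second column to the first. The sign of the product of the lower entries of
  \<open>P\<close> decides whether \<infinity> lies outside the arc, at an end point or
  inside.\<close>

lemma closed_interval_sector_arc:
  assumes "det P > 0"
  shows "closed_interval (pt (P *v axis 2 1)) (pt (P *v axis 1 1)) (sector_arc P)"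
proof -
  define a b c d where "a = P$1$1" and "b = P$1$2" and "c = P$2$1" and "d = P$2$2"
  note abcd = a_def b_def c_def d_def
  have D: "a * d - b * c > 0" using assms by (simp add: det_2 abcd)
  define p where "p = (if d = 0 then None else Some (b / d))"
  define q where "q = (if c = 0 then None else Some (a / c))"
  have u: "pt (P *v axis 2 1) = ext_of_real p" and v: "pt (P *v axis 1 1) = ext_of_real q"
    by (simp_all add: p_def q_def pt_def matrix_vector_2 axis_def ext_of_real_def abcd)
  have S: "Some (of_real x) \<in> sector_arc P \<longleftrightarrow> (0 \<le> d * x - b \<and> 0 \<le> a - c * x \<or> d * x - b \<le> 0 \<and> a - c * x \<le> 0)" for x
    unfolding Some_in_sector_arc abcd[symmetric] by auto
  have N: "None \<in> sector_arc P \<longleftrightarrow> d * c \<le> 0"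
    unfolding None_in_sector_arc abcd[symmetric] ..
  have R: "z \<in> \<real>" if "Some z \<in> sector_arc P" for z
    using that unfolding Some_in_sector_arc by auto
  have dx: "d > 0 \<Longrightarrow> (0 \<le> d * x - b \<longleftrightarrow> b / d \<le> x)" "d < 0 \<Longrightarrow> (0 \<le> d * x - b \<longleftrightarrow> x \<le> b / d)"
    "d > 0 \<Longrightarrow> (d * x - b \<le> 0 \<longleftrightarrow> x \<le> b / d)" "d < 0 \<Longrightarrow> (d * x - b \<le> 0 \<longleftrightarrow> b / d \<le> x)" for x
    by (auto simp: field_simps)
  have cx: "c > 0 \<Longrightarrow> (0 \<le> a - c * x \<longleftrightarrow> x \<le> a / c)" "c < 0 \<Longrightarrow> (0 \<le> a - c * x \<longleftrightarrow> a / c \<le> x)"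
    "c > 0 \<Longrightarrow> (a - c * x \<le> 0 \<longleftrightarrow> a / c \<le> x)" "c < 0 \<Longrightarrow> (a - c * x \<le> 0 \<longleftrightarrow> x \<le> a / c)" for x
    by (auto simp: field_simps)
  have "p \<noteq> q \<and> sector_arc P = ext_of_real ` ext_arc p q"
  proof (cases "c = 0 \<or> d = 0")
    case True
    then consider "c = 0" "a * d > 0" | "d = 0" "b * c < 0" using D by auto
    then show ?thesis
    proof cases
      case 1
      then have nz: "d \<noteq> 0" by auto
      have "sector_arc P = ext_of_real ` insert None (Some ` {b / d..})"
      proof (rule ext_of_real_image_eqI[OF _ _ R])
        fix x
        have "d > 0 \<and> a > 0 \<or> d < 0 \<and> a < 0" using 1(2) by (auto simp: zero_less_mult_iff)
        then show "Some (of_real x) \<in> sector_arc P \<longleftrightarrow> Some x \<in> insert None (Some ` {b / d..})"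
          unfolding S 1(1) using dx[of x] by auto
      qed (use N 1 in auto)
      then show ?thesis using 1 nz by (simp add: p_def q_def)
    next
      case 2
      then have nz: "c \<noteq> 0" by auto
      have "sector_arc P = ext_of_real ` insert None (Some ` {..a / c})"
      proof (rule ext_of_real_image_eqI[OF _ _ R])
        fix x
        have "c > 0 \<and> b < 0 \<or> c < 0 \<and> b > 0" using 2(2) by (auto simp: mult_less_0_iff)
        then show "Some (of_real x) \<in> sector_arc P \<longleftrightarrow> Some x \<in> insert None (Some ` {..a / c})"
          unfolding S 2(1) using cx[of x] by auto
      qed (use N 2 in auto)
      then show ?thesis using 2 nz by (simp add: p_def q_def)
    qed
  next
    case False
    then have nz: "c \<noteq> 0" "d \<noteq> 0" by auto
    have pq: "p = Some (b / d)" "q = Some (a / c)" using nz by (simp_all add: p_def q_def)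
    have diff: "a / c - b / d = (a * d - b * c) / (c * d)" using nz by (simp add: field_simps)
    show ?thesis
    proof (cases "c * d > 0")
      case True
      then have lt: "b / d < a / c" using diff D by (simp add: field_simps)
      have "sector_arc P = ext_of_real ` (Some ` {b / d..a / c})"
      proof (rule ext_of_real_image_eqI[OF _ _ R])
        fix x
        have "c > 0 \<and> d > 0 \<or> c < 0 \<and> d < 0" using True by (auto simp: zero_less_mult_iff)
        then show "Some (of_real x) \<in> sector_arc P \<longleftrightarrow> Some x \<in> Some ` {b / d..a / c}"
          unfolding S using dx[of x] cx[of x] lt by auto
      qed (use N True in \<open>auto simp: mult.commute\<close>)
      then show ?thesis using lt by (simp add: pq)
    next
      case False
      then have neg: "c * d < 0" using nz by (simp add: not_less less_le)
      then have gt: "a / c < b / d" using diff D by (metis diff_less_0_iff_less divide_pos_neg)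
      have "sector_arc P = ext_of_real ` insert None (Some ` ({b / d..} \<union> {..a / c}))"
      proof (rule ext_of_real_image_eqI[OF _ _ R])
        fix x
        have "c > 0 \<and> d < 0 \<or> c < 0 \<and> d > 0" using neg by (auto simp: mult_less_0_iff)
        then show "Some (of_real x) \<in> sector_arc P \<longleftrightarrow> Some x \<in> insert None (Some ` ({b / d..} \<union> {..a / c}))"
          unfolding S using dx[of x] cx[of x] gt by auto
      qed (use N neg in \<open>auto simp: mult.commute\<close>)
      then show ?thesis using gt by (simp add: pq)
    qed
  qed
  then show ?thesis unfolding closed_interval_def using u v by blast
qed

lemma adj2_scaled_inverse:
  assumes "P ** Q = mat 1"
  shows "adj2 P = det P *\<^sub>R Q"
proof -
  have "adj2 P ** P = det P *\<^sub>R mat 1" by (simp add: mat2_eq_iff det_2 algebra_simps)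
  then have "adj2 P ** (P ** Q) = det P *\<^sub>R Q"
    unfolding matrix_mul_assoc by (simp add: mat2_eq_iff)
  then show ?thesis using assms by simp
qed

lemma sector_arc_coords:
  assumes "P ** Q = mat 1" "det P > 0"
  shows "sector_arc P = {pt w | w. w \<noteq> 0 \<and> 0 \<le> (Q *v w)$1 \<and> 0 \<le> (Q *v w)$2}"
proof -
  have "0 \<le> (adj2 P *v w)$1 \<and> 0 \<le> (adj2 P *v w)$2 \<longleftrightarrow> 0 \<le> (Q *v w)$1 \<and> 0 \<le> (Q *v w)$2" for w
  proof -
    have "adj2 P *v w = det P *\<^sub>R (Q *v w)"
      unfolding adj2_scaled_inverse[OF assms(1)] by (simp add: vec2_eq_iff matrix_vector_2 algebra_simps)
    then show ?thesis using assms(2) by (simp add: zero_le_mult_iff)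
  qed
  then show ?thesis unfolding sector_arc_def by auto
qed

lemma nonneg_maps_into_sector_arc:
  assumes PQ: "P ** Q = mat 1" "det P > 0" and B: "det B = 1" "nonneg2 B"
  shows "mobius (P ** B ** Q) ` sector_arc P \<subseteq> sector_arc P"
proof
  fix p assume "p \<in> mobius (P ** B ** Q) ` sector_arc P"
  then obtain w where w: "p = mobius (P ** B ** Q) (pt w)" "w \<noteq> 0" "0 \<le> (Q *v w)$1" "0 \<le> (Q *v w)$2"
    unfolding sector_arc_coords[OF PQ] by blast
  define x where "x = Q *v w"
  have w': "w = P *v x" by (simp add: x_def matrix_vector_mul_assoc PQ)
  define w'' where "w'' = P ** B ** Q *v w"
  have Qw: "Q *v w'' = B *v x"
  proof -
    have "Q ** (P ** B ** Q) = B ** Q"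
      by (metis PQ(1) matrix_inverse_swap matrix_mul_assoc matrix_mul_lid)
    then show ?thesis by (simp add: w''_def x_def matrix_vector_mul_assoc)
  qed
  have "w'' \<noteq> 0"
  proof
    assume "w'' = 0"
    then have "B *v x = 0" using Qw by simp
    then have "adj2 B *v (B *v x) = 0" by simp
    then have "x = 0" by (simp add: matrix_vector_mul_assoc adj2_inverse(2)[OF B(1)])
    then show False using w(2) w' by simp
  qed
  moreover have "p = pt w''" unfolding w''_def w(1) by (rule mobius_pt[OF w(2)])
  moreover have "0 \<le> (Q *v w'')$1" "0 \<le> (Q *v w'')$2"
    using B(2) w(3,4) unfolding Qw x_def[symmetric] by (simp_all add: matrix_vector_2 nonneg2_def)
  ultimately show "p \<in> sector_arc P" unfolding sector_arc_coords[OF PQ] by blast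
qed

definition diag :: "real \<Rightarrow> real^2^2" where
  "diag x = M2 x 0 0 (1 / x)"

lemma nonneg_det_one_diag:
  assumes "det B = 1" "nonneg2 B" "B$1$2 = 0" "B$2$1 = 0"
  shows "B$1$1 > 0" "B = diag (B$1$1)"
proof -
  have e: "B$1$1 * B$2$2 = 1" using assms by (simp add: det_2)
  then have "B$1$1 \<noteq> 0" by auto
  then show "B$1$1 > 0" using assms(2) by (simp add: nonneg2_def less_le)
  then show "B = diag (B$1$1)" using e assms by (simp add: diag_def mat2_eq_iff field_simps)
qed

text \<open>If the image is the whole arc, each end point is attained: \<open>B\<close> maps some
  nonzero nonnegative vector to a multiple of a basis vector. As the diagonal entries are positive
  and nonnegative terms cannot cancel, the off-diagonal entries vanish. Conversely, a diagonal
  \<open>B\<close> has a nonnegative inverse.\<close>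

lemma nonneg_onto_sector_arc_iff:
  assumes PQ: "P ** Q = mat 1" "det P > 0" and B: "det B = 1" "nonneg2 B"
  shows "mobius (P ** B ** Q) ` sector_arc P = sector_arc P \<longleftrightarrow> B$1$2 = 0 \<and> B$2$1 = 0"
proof
  assume eq: "mobius (P ** B ** Q) ` sector_arc P = sector_arc P"
  have QP: "Q ** P = mat 1" by (rule matrix_inverse_swap[OF PQ(1)])
  have nn: "B$1$1 \<ge> 0" "B$1$2 \<ge> 0" "B$2$1 \<ge> 0" "B$2$2 \<ge> 0" using B(2) by (simp_all add: nonneg2_def)
  have "B$1$1 * B$2$2 = 1 + B$1$2 * B$2$1" using B(1) by (simp add: det_2)
  moreover have "B$1$2 * B$2$1 \<ge> 0" using nn by simp
  ultimately have "B$1$1 * B$2$2 > 0" by simp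
  then have nz: "B$1$1 \<noteq> 0" "B$2$2 \<noteq> 0" by auto
  have key: "\<exists>x. x \<noteq> 0 \<and> 0 \<le> x$1 \<and> 0 \<le> x$2 \<and> (\<forall>j. j \<noteq> i \<longrightarrow> (B *v x)$j = 0)" for i :: 2
  proof -
    have "P *v axis i 1 \<noteq> 0" by (rule matrix_vector_axis_nonzero[OF QP])
    moreover have "Q *v (P *v axis i 1) = axis i 1" by (simp add: matrix_vector_mul_assoc QP)
    ultimately have "pt (P *v axis i 1) \<in> sector_arc P"
      unfolding sector_arc_coords[OF PQ] by (auto simp: axis_def intro!: exI[of _ "P *v axis i 1"])
    then have "pt (P *v axis i 1) \<in> mobius (P ** B ** Q) ` sector_arc P" by (simp only: eq)
    then obtain w where w: "w \<noteq> 0" "0 \<le> (Q *v w)$1" "0 \<le> (Q *v w)$2"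
      and pt: "pt (P *v axis i 1) = mobius (P ** B ** Q) (pt w)"
      unfolding sector_arc_coords[OF PQ] by blast
    define x where "x = Q *v w"
    have w': "w = P *v x" by (simp add: x_def matrix_vector_mul_assoc PQ)
    have x0: "x \<noteq> 0" using w(1) w' by auto
    have "P ** B ** Q *v w = P *v (B *v x)" by (simp add: x_def matrix_vector_mul_assoc matrix_mul_assoc)
    then have pt': "pt (P *v axis i 1) = pt (P *v (B *v x))" using pt mobius_pt[OF w(1)] by simp
    have cross: "v$1 * w$2 = v$2 * w$1" if "pt v = pt w" for v w
      using that
      by (auto simp: pt_def frac_eq_eq mult.commute simp del: of_real_divide split: if_splits)
    have "det P * (axis i 1$1 * (B *v x)$2 - axis i 1$2 * (B *v x)$1) = 0"
      using cross[OF pt'] by (simp add: matrix_vector_2 det_2 algebra_simps)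
    then have "axis i 1$1 * (B *v x)$2 - axis i 1$2 * (B *v x)$1 = 0" using PQ(2) by simp
    then have "\<forall>j. j \<noteq> i \<longrightarrow> (B *v x)$j = 0" using exhaust_2[of i] by (auto simp: axis_def forall_2)
    then show ?thesis using x0 w(2,3) x_def by blast
  qed
  obtain x :: "real^2" where x: "x \<noteq> 0" "0 \<le> x$1" "0 \<le> x$2" "B$2$1 * x$1 + B$2$2 * x$2 = 0"
    using key[of 1] by (auto simp: forall_2 matrix_vector_2)
  have "0 \<le> B$2$1 * x$1" "0 \<le> B$2$2 * x$2" using nn x by simp_all
  then have z: "B$2$1 * x$1 = 0" "B$2$2 * x$2 = 0" using x(4) by linarith+
  then have c: "B$2$1 = 0" using nz x(1) by (auto simp: vec2_eq_iff)
  obtain y :: "real^2" where y: "y \<noteq> 0" "0 \<le> y$1" "0 \<le> y$2" "B$1$1 * y$1 + B$1$2 * y$2 = 0"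
    using key[of 2] by (auto simp: forall_2 matrix_vector_2)
  have "0 \<le> B$1$1 * y$1" "0 \<le> B$1$2 * y$2" using nn y by simp_all
  then have z: "B$1$1 * y$1 = 0" "B$1$2 * y$2 = 0" using y(4) by linarith+
  then have "B$1$2 = 0" using nz y(1) by (auto simp: vec2_eq_iff)
  with c show "B$1$2 = 0 \<and> B$2$1 = 0" by blast
next
  assume z: "B$1$2 = 0 \<and> B$2$1 = 0"
  show "mobius (P ** B ** Q) ` sector_arc P = sector_arc P"
  proof
    show "mobius (P ** B ** Q) ` sector_arc P \<subseteq> sector_arc P"
      by (rule nonneg_maps_into_sector_arc[OF PQ B])
    have QP: "Q ** P = mat 1" by (rule matrix_inverse_swap[OF PQ(1)])
    have B': "det (adj2 B) = 1" "nonneg2 (adj2 B)" using B z by (simp_all add: nonneg2_def)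
    have "P ** B ** Q ** (P ** adj2 B ** Q) = mat 1"
      unfolding conj_mult[OF QP, symmetric] adj2_inverse(1)[OF B(1)] by (simp add: PQ)
    then have "mobius (P ** B ** Q) \<circ> mobius (P ** adj2 B ** Q) = id"
      using mobius_mult[of "P ** B ** Q" "P ** adj2 B ** Q"] B(1) by (simp add: det_conj[OF QP] mobius_one)
    then have inv: "mobius (P ** B ** Q) (mobius (P ** adj2 B ** Q) p) = p" for p
      by (rule pointfree_idE)
    show "sector_arc P \<subseteq> mobius (P ** B ** Q) ` sector_arc P"
    proof
      fix p assume "p \<in> sector_arc P"
      then have "mobius (P ** adj2 B ** Q) p \<in> sector_arc P"
        using nonneg_maps_into_sector_arc[OF PQ B'] by blast
      then show "p \<in> mobius (P ** B ** Q) ` sector_arc P"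
        by (rule image_eqI[rotated]) (simp only: inv)
    qed
  qed
qed

lemma triangular_fixes_endpoint:
  fixes P Q B :: "real^2^2"
  assumes PQ: "P ** Q = mat 1" and B: "det B = 1"
  shows "B$1$2 = 0 \<Longrightarrow> mobius (P ** B ** Q) (pt (P *v axis 2 1)) = pt (P *v axis 2 1)"
    and "B$2$1 = 0 \<Longrightarrow> mobius (P ** B ** Q) (pt (P *v axis 1 1)) = pt (P *v axis 1 1)"
proof -
  have QP: "Q ** P = mat 1" by (rule matrix_inverse_swap[OF PQ])
  have *: "mobius (P ** B ** Q) (pt (P *v axis i 1)) = pt (P *v axis i 1)"
    if "B *v axis i 1 = k *\<^sub>R axis i 1" "k \<noteq> 0" for i k
  proof -
    have "mobius (P ** B ** Q) (pt (P *v axis i 1)) = pt (P ** B ** Q *v (P *v axis i 1))"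
      by (rule mobius_pt[OF matrix_vector_axis_nonzero[OF QP]])
    also have "P ** B ** Q *v (P *v axis i 1) = P *v (B *v axis i 1)"
    proof -
      have "P ** B ** Q ** P = P ** B" by (metis QP matrix_mul_assoc matrix_mul_rid)
      then show ?thesis by (simp add: matrix_vector_mul_assoc)
    qed
    also have "\<dots> = k *\<^sub>R (P *v axis i 1)" using that(1) by (simp add: matrix_vector_mult_scaleR)
    finally show ?thesis using pt_scale[OF that(2)] by simp
  qed
  show "mobius (P ** B ** Q) (pt (P *v axis 2 1)) = pt (P *v axis 2 1)" if b: "B$1$2 = 0"
  proof (rule *)
    show "B *v axis 2 1 = B$2$2 *\<^sub>R axis 2 1"
      using b by (simp add: vec2_eq_iff matrix_vector_2 axis_def)
    show "B$2$2 \<noteq> 0" using B b by (auto simp: det_2)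
  qed
  show "mobius (P ** B ** Q) (pt (P *v axis 1 1)) = pt (P *v axis 1 1)" if c: "B$2$1 = 0"
  proof (rule *)
    show "B *v axis 1 1 = B$1$1 *\<^sub>R axis 1 1"
      using c by (simp add: vec2_eq_iff matrix_vector_2 axis_def)
    show "B$1$1 \<noteq> 0" using B c by (auto simp: det_2)
  qed
qed

section \<open>Words in nonnegative matrices\<close>

lemma islimpt_open_Int:
  assumes "x islimpt X" "open U" "x \<in> U"
  shows "x islimpt (X \<inter> U)"
  unfolding islimpt_def
proof (intro allI impI)
  fix T assume "x \<in> T" "open T"
  then have "x \<in> T \<inter> U" "open (T \<inter> U)" using assms by auto
  then show "\<exists>y\<in>X \<inter> U. y \<in> T \<and> y \<noteq> x" using assms(1) unfolding islimpt_def by blast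
qed

lemma finite_positive_lower_bound:
  fixes f :: "'a \<Rightarrow> real"
  assumes "finite A"
  obtains k where "k > 0" "\<And>x. x \<in> A \<Longrightarrow> f x > 0 \<Longrightarrow> k \<le> f x"
proof
  let ?B = "insert 1 (f ` {x \<in> A. f x > 0})"
  have fin: "finite ?B" using assms by simp
  show "Min ?B > 0" using fin by (subst Min_gr_iff) auto
  show "Min ?B \<le> f x" if "x \<in> A" "f x > 0" for x using fin that by (intro Min_le) auto
qed

definition nonneg_SL2 :: "(real^2^2) set" where
  "nonneg_SL2 = {A. det A = 1 \<and> nonneg2 A}"

lemma nonneg_SL2_mult:
  assumes "A \<in> nonneg_SL2" "B \<in> nonneg_SL2"
  shows "A ** B \<in> nonneg_SL2"
  using assms by (simp add: nonneg_SL2_def det_mul nonneg2_def)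

lemma nonneg_SL2_diagonal:
  assumes "A \<in> nonneg_SL2"
  shows "A$1$1 > 0" "A$2$2 > 0" "1 \<le> A$1$1 * A$2$2" "A$1$1 * A$2$2 = 1 + A$1$2 * A$2$1"
    "0 \<le> A$1$2" "0 \<le> A$2$1"
proof -
  have n: "0 \<le> A$1$1" "0 \<le> A$1$2" "0 \<le> A$2$1" "0 \<le> A$2$2"
    and d: "A$1$1 * A$2$2 - A$1$2 * A$2$1 = 1"
    using assms by (auto simp: nonneg_SL2_def nonneg2_def det_2)
  show e: "A$1$1 * A$2$2 = 1 + A$1$2 * A$2$1" using d by simp
  have "0 \<le> A$1$2 * A$2$1" using n by simp
  then show "1 \<le> A$1$1 * A$2$2" using e by simp
  then have "A$1$1 \<noteq> 0" "A$2$2 \<noteq> 0" by auto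
  then show "A$1$1 > 0" "A$2$2 > 0" using n by simp_all
  show "0 \<le> A$1$2" "0 \<le> A$2$1" using n by simp_all
qed

lemma msg_nonneg_SL2:
  assumes "T \<subseteq> nonneg_SL2" "W \<in> msg T"
  shows "W \<in> nonneg_SL2"
  using assms(2) by induction (use assms(1) nonneg_SL2_mult in auto)

text \<open>On nonnegative matrices of determinant 1 the product \<open>W$1$1 * W$2$2\<close> is at
  least 1 and supermultiplicative, and on letters that are not triangular it is at least
  \<open>1 + k\<close>. One such letter keeps the whole word away from the identity.\<close>

lemma triangular_letters_suffice:
  assumes fin: "finite T" and T: "T \<subseteq> nonneg_SL2" and lim: "mat 1 islimpt msg T"
  shows "mat 1 islimpt msg {B \<in> T. B$1$2 * B$2$1 = 0}"
proof -
  let ?T = "{B \<in> T. B$1$2 * B$2$1 = 0}"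
  obtain k where k: "k > 0" "\<And>B. B \<in> T \<Longrightarrow> B$1$2 * B$2$1 > 0 \<Longrightarrow> k \<le> B$1$2 * B$2$1"
    using finite_positive_lower_bound[OF fin, of "\<lambda>B. B$1$2 * B$2$1"] by blast
  have letter: "B \<in> ?T \<or> 1 + k \<le> B$1$1 * B$2$2" if "B \<in> T" for B
  proof -
    note B = nonneg_SL2_diagonal[OF subsetD[OF T that]]
    have "0 \<le> B$1$2 * B$2$1" using B(5,6) by simp
    then show ?thesis using k(2)[OF that] B(4) that by (cases "B$1$2 * B$2$1 = 0") auto
  qed
  have word: "W \<in> msg ?T \<or> 1 + k \<le> W$1$1 * W$2$2" if "W \<in> msg T" for W
    using that
  proof induction
    case (base A) then show ?case using letter by (auto intro: msg.base)
  next
    case (mult A W)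
    note A = nonneg_SL2_diagonal[OF subsetD[OF T mult(1)]]
    note W = nonneg_SL2_diagonal[OF msg_nonneg_SL2[OF T mult(2)]]
    have "A$1$1 * W$1$1 \<le> (A ** W)$1$1" "A$2$2 * W$2$2 \<le> (A ** W)$2$2"
      using A W by simp_all
    then have "(A$1$1 * W$1$1) * (A$2$2 * W$2$2) \<le> (A ** W)$1$1 * (A ** W)$2$2"
      using A(1,2) W(1,2) by (intro mult_mono) (auto intro!: mult_nonneg_nonneg add_nonneg_nonneg simp: A W less_imp_le)
    then have le: "(A$1$1 * A$2$2) * (W$1$1 * W$2$2) \<le> (A ** W)$1$1 * (A ** W)$2$2" by (simp only: ac_simps)
    have "A$1$1 * A$2$2 \<le> (A$1$1 * A$2$2) * (W$1$1 * W$2$2)"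
      using mult_left_mono[OF W(3), of "A$1$1 * A$2$2"] A(3) by simp
    moreover have "W$1$1 * W$2$2 \<le> (A$1$1 * A$2$2) * (W$1$1 * W$2$2)"
      using mult_right_mono[OF A(3), of "W$1$1 * W$2$2"] W(3) by simp
    ultimately show ?case using mult.IH letter[OF mult(1)] le by (meson msg.mult order_trans)
  qed
  let ?U = "{W :: real^2^2. W$1$1 * W$2$2 < 1 + k}"
  have "open ?U" by (intro open_Collect_less continuous_intros)
  moreover have "mat 1 \<in> ?U" using k by simp
  ultimately have "mat 1 islimpt (msg T \<inter> ?U)" by (rule islimpt_open_Int[OF lim])
  moreover have "msg T \<inter> ?U \<subseteq> msg ?T" using word by force
  ultimately show ?thesis by (rule islimpt_subset)
qed

text \<open>Here \<open>\<alpha>\<close> is the product of the upper left entries of the letters. As long as no diagonal letter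
  contracts, a word whose first off-diagonal letter is upper triangular has \<open>\<alpha> b \<ge> k\<close>, one whose last
  off-diagonal letter is lower triangular has \<open>\<alpha> c \<ge> k\<close>, and in the remaining case a lower
  triangular letter is followed by an upper triangular one with only diagonal letters in between,
  which forces \<open>b c \<ge> k\<^sup>2\<close>.\<close>

definition word_bound :: "real \<Rightarrow> real^2^2 \<Rightarrow> bool" where
  "word_bound k W \<longleftrightarrow> W \<in> nonneg_SL2 \<and> (\<exists>\<alpha>>0. \<alpha> \<le> W$1$1 \<and> 1 \<le> \<alpha> * W$2$2 \<and>
    (W$1$2 = 0 \<and> W$2$1 = 0 \<and> W$1$1 = \<alpha> \<and> (\<alpha> = 1 \<or> 1 + k \<le> \<alpha>) \<or>
     k \<le> \<alpha> * W$1$2 \<or> k \<le> \<alpha> * W$2$1 \<or> k * k \<le> W$1$2 * W$2$1))"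

text \<open>Prepending \<open>x\<close> changes \<open>\<alpha>\<close> to
  \<open>a * \<alpha>\<close>. Because \<open>a * d = 1\<close>, the products
  \<open>\<alpha> * r\<close> and \<open>q * r\<close> do not decrease. An upper triangular
  \<open>x\<close> gives the bound on the (1,2) entry at once, by
  \<open>1 \<le> \<alpha> * s\<close>. A lower triangular \<open>x\<close> turns the diagonal
  alternative into the bound on the (2,1) entry, and \<open>k \<le> \<alpha> * q\<close> into the
  bound on the product. A diagonal \<open>x\<close> has \<open>a \<ge> 1\<close> and preserves each
  alternative.\<close>

lemma word_bound_step:
  assumes k: "k > 0" and x: "x \<in> nonneg_SL2" "x$1$2 * x$2$1 = 0"
    and diag: "x$1$2 = 0 \<Longrightarrow> x$2$1 = 0 \<Longrightarrow> x$1$1 = 1 \<or> 1 + k \<le> x$1$1"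
    and upper: "x$1$2 > 0 \<Longrightarrow> k \<le> x$1$1 * x$1$2" and lower: "x$2$1 > 0 \<Longrightarrow> k \<le> x$1$1 * x$2$1"
    and W: "word_bound k W"
  shows "word_bound k (x ** W)"
proof -
  define a b c d where "a = x$1$1" and "b = x$1$2" and "c = x$2$1" and "d = x$2$2"
  note xs = a_def[symmetric] b_def[symmetric] c_def[symmetric] d_def[symmetric]
  define p q r s where "p = W$1$1" and "q = W$1$2" and "r = W$2$1" and "s = W$2$2"
  note Ws = p_def[symmetric] q_def[symmetric] r_def[symmetric] s_def[symmetric]
  have x': "a > 0" "d > 0" "a * d = 1" "b \<ge> 0" "c \<ge> 0" "b * c = 0"
    using nonneg_SL2_diagonal[OF x(1)] x(2) by (simp_all add: xs)
  obtain \<alpha> where WN: "W \<in> nonneg_SL2" and \<alpha>: "\<alpha> > 0" "\<alpha> \<le> p" "1 \<le> \<alpha> * s"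
    and alt: "q = 0 \<and> r = 0 \<and> p = \<alpha> \<and> (\<alpha> = 1 \<or> 1 + k \<le> \<alpha>) \<or> k \<le> \<alpha> * q \<or> k \<le> \<alpha> * r \<or> k * k \<le> q * r"
    using W unfolding word_bound_def Ws by blast
  have W': "p > 0" "q \<ge> 0" "r \<ge> 0" "s > 0" using nonneg_SL2_diagonal[OF WN] by (simp_all add: Ws)
  have adz: "a * (d * z) = z" "a * (z * d) = z" for z using x'(3) by (simp_all add: mult.assoc[symmetric] mult.commute mult.left_commute)
  have E: "(x ** W)$1$1 = a * p + b * r" "(x ** W)$1$2 = a * q + b * s"
    "(x ** W)$2$1 = c * p + d * r" "(x ** W)$2$2 = c * q + d * s" by (simp_all add: xs Ws)
  have 1: "a * \<alpha> > 0" using x' \<alpha> by simp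
  have 2: "a * \<alpha> \<le> a * p + b * r" using x' \<alpha> W' by (simp add: add_increasing2)
  have 3: "1 \<le> a * \<alpha> * (c * q + d * s)"
  proof -
    have "a * \<alpha> * (c * q + d * s) = a * \<alpha> * c * q + \<alpha> * (a * (d * s))" by (simp add: algebra_simps)
    moreover have "0 \<le> a * \<alpha> * c * q" using x' \<alpha> W' by simp
    ultimately show ?thesis using \<alpha>(3) by (simp add: adz)
  qed
  have 4: "(a * q + b * s = 0 \<and> c * p + d * r = 0 \<and> a * p + b * r = a * \<alpha> \<and> (a * \<alpha> = 1 \<or> 1 + k \<le> a * \<alpha>)) \<or>
    k \<le> a * \<alpha> * (a * q + b * s) \<or> k \<le> a * \<alpha> * (c * p + d * r) \<or> k * k \<le> (a * q + b * s) * (c * p + d * r)"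
    (is "?D \<or> ?U \<or> ?L \<or> ?B")
  proof -
    have L: ?L if "k \<le> \<alpha> * r"
    proof -
      have "a * \<alpha> * (c * p + d * r) = a * \<alpha> * c * p + \<alpha> * (a * (d * r))" by (simp add: algebra_simps)
      moreover have "0 \<le> a * \<alpha> * c * p" using x' \<alpha> W' by simp
      ultimately show ?thesis using that by (simp add: adz)
    qed
    have B: ?B if "k * k \<le> q * r"
    proof -
      have "(a * q + b * s) * (c * p + d * r) = a * q * c * p + q * (a * (d * r)) + b * s * (c * p) + b * s * (d * r)"
        by (simp add: algebra_simps)
      moreover have "0 \<le> a * q * c * p" "0 \<le> b * s * (c * p)" "0 \<le> b * s * (d * r)" using x' W' by simp_all
      ultimately show ?thesis using that by (simp add: adz)
    qed
    consider "b = 0" "c = 0" | "b > 0" | "b = 0" "c > 0" using x' by fastforce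
    then show ?thesis
    proof cases
      case 1
      then have a: "a = 1 \<or> 1 + k \<le> a" using diag by (simp add: xs)
      then have a1: "1 \<le> a" using k by auto
      from alt consider "q = 0" "r = 0" "p = \<alpha>" "\<alpha> = 1 \<or> 1 + k \<le> \<alpha>" | "k \<le> \<alpha> * q" | "k \<le> \<alpha> * r" | "k * k \<le> q * r"
        by blast
      then show ?thesis
      proof cases
        case (1)
        have "1 \<le> \<alpha>" using 1(4) k by auto
        have "a * \<alpha> = 1 \<or> 1 + k \<le> a * \<alpha>"
        proof (cases "a = 1")
          case False
          then have "1 + k \<le> a" using a by simp
          also have "a \<le> a * \<alpha>" using \<open>1 \<le> \<alpha>\<close> a1 by simp
          finally show ?thesis by simp
        qed (use 1(4) in simp)
        then have ?D using 1 \<open>b = 0\<close> \<open>c = 0\<close> by simp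
        then show ?thesis by simp
      next
        case 2
        have "1 * 1 \<le> a * a" using a1 by (intro mult_mono) auto
        then have "1 * (\<alpha> * q) \<le> (a * a) * (\<alpha> * q)" using \<alpha> W' by (intro mult_right_mono) auto
        also have "\<dots> = a * \<alpha> * (a * q + b * s)" using \<open>b = 0\<close> by simp
        finally show ?thesis using 2 by simp
      qed (use L B in simp_all)
    next
      case 2
      then have "k \<le> a * b" using upper by (simp add: xs)
      also have "\<dots> \<le> (a * b) * (\<alpha> * s)" using \<alpha>(3) x' by (intro mult_left_mono[of 1 "\<alpha> * s" "a * b", simplified]) auto
      also have "\<dots> \<le> a * \<alpha> * (a * q + b * s)"
        using x' \<alpha> W' by (simp add: algebra_simps)
      finally show ?thesis by simp
    next
      case 3
      then have ac: "k \<le> a * c" using lower by (simp add: xs)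
      from alt consider "p = \<alpha>" "\<alpha> = 1 \<or> 1 + k \<le> \<alpha>" | "k \<le> \<alpha> * q" | "k \<le> \<alpha> * r" | "k * k \<le> q * r"
        by blast
      then show ?thesis
      proof cases
        case (1)
        have "1 \<le> \<alpha>" using 1(2) k by auto
        then have "1 * 1 \<le> \<alpha> * \<alpha>" by (intro mult_mono) auto
        then have "(a * c) * 1 \<le> (a * c) * (\<alpha> * \<alpha>)" using x' by (intro mult_left_mono) auto
        also have "\<dots> \<le> a * \<alpha> * (c * p + d * r)" using x' \<alpha> W' 1(1) by (simp add: algebra_simps)
        finally show ?thesis using ac by simp
      next
        case 2
        have "k * k \<le> (a * c) * (\<alpha> * q)" using ac 2 k by (intro mult_mono) auto
        also have "\<dots> \<le> (a * c) * (p * q)" using \<alpha> x' W' by (intro mult_left_mono mult_right_mono) auto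
        also have "\<dots> \<le> (a * q + b * s) * (c * p + d * r)" using x' W' \<open>b = 0\<close> by (simp add: algebra_simps)
        finally show ?thesis by simp
      qed (use L B in simp_all)
    qed
  qed
  show ?thesis unfolding word_bound_def E
    using nonneg_SL2_mult[OF x(1) WN] 1 2 3 4 by blast
qed

lemma no_contracting_letter:
  assumes fin: "finite T" and T: "T \<subseteq> nonneg_SL2" and tri: "\<And>B. B \<in> T \<Longrightarrow> B$1$2 * B$2$1 = 0"
    and diag: "\<And>B. B \<in> T \<Longrightarrow> B$1$2 = 0 \<Longrightarrow> B$2$1 = 0 \<Longrightarrow> 1 \<le> B$1$1"
  shows "\<not> mat 1 islimpt msg T"
proof
  assume lim: "mat 1 islimpt msg T"
  obtain k1 where k1: "k1 > 0" "\<And>B. B \<in> T \<Longrightarrow> B$1$1 - 1 > 0 \<Longrightarrow> k1 \<le> B$1$1 - 1"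
    by (rule finite_positive_lower_bound[OF fin, of "\<lambda>B. B$1$1 - 1"]) (rule that)
  obtain k2 where k2: "k2 > 0" "\<And>B. B \<in> T \<Longrightarrow> B$1$1 * B$1$2 > 0 \<Longrightarrow> k2 \<le> B$1$1 * B$1$2"
    by (rule finite_positive_lower_bound[OF fin, of "\<lambda>B. B$1$1 * B$1$2"]) (rule that)
  obtain k3 where k3: "k3 > 0" "\<And>B. B \<in> T \<Longrightarrow> B$1$1 * B$2$1 > 0 \<Longrightarrow> k3 \<le> B$1$1 * B$2$1"
    by (rule finite_positive_lower_bound[OF fin, of "\<lambda>B. B$1$1 * B$2$1"]) (rule that)
  define k where "k = min k1 (min k2 k3)"
  have k: "k > 0" "k \<le> k1" "k \<le> k2" "k \<le> k3" using k1 k2 k3 by (auto simp: k_def)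
  have step: "word_bound k (B ** W)" if B: "B \<in> T" and W: "word_bound k W" for B W
  proof (rule word_bound_step[OF k(1) _ tri[OF B] _ _ _ W])
    show N: "B \<in> nonneg_SL2" using B T by blast
    note N' = nonneg_SL2_diagonal[OF N]
    show "B$1$1 = 1 \<or> 1 + k \<le> B$1$1" if "B$1$2 = 0" "B$2$1 = 0"
      using diag[OF B that] k1(2)[OF B] k(2) by linarith
    show "k \<le> B$1$1 * B$1$2" if "B$1$2 > 0" using k2(2)[OF B] N'(1) that k(3) by fastforce
    show "k \<le> B$1$1 * B$2$1" if "B$2$1 > 0" using k3(2)[OF B] N'(1) that k(4) by fastforce
  qed
  have one: "word_bound k (mat 1)"
    unfolding word_bound_def by (auto simp: nonneg_SL2_def nonneg2_def intro!: exI[of _ 1])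
  have wb: "word_bound k W" if "W \<in> msg T" for W
    using that
  proof induction
    case (base A) then show ?case using step[OF base one] by simp
  qed (rule step)
  \<comment> \<open>A neighbourhood of the identity on which, since
    \<open>\<alpha> \<le> W$1$1\<close>, every alternative of \<open>word_bound\<close> fails except
    that \<open>W\<close> is the identity.\<close>
  let ?U = "{W :: real^2^2. W$1$1 < 1 + k \<and> W$1$1 * W$1$2 < k \<and> W$1$1 * W$2$1 < k \<and> W$1$2 * W$2$1 < k * k}"
  have "open ?U" by (intro open_Collect_conj open_Collect_less continuous_intros)
  moreover have "mat 1 \<in> ?U" using k by simp
  ultimately have "mat 1 islimpt (msg T \<inter> ?U)" by (rule islimpt_open_Int[OF lim])
  then obtain W where W: "W \<in> msg T" "W \<in> ?U" "W \<noteq> mat 1" unfolding islimpt_def by blast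
  have WN: "W \<in> nonneg_SL2" using wb[OF W(1)] by (simp add: word_bound_def)
  obtain \<alpha> where \<alpha>: "\<alpha> > 0" "\<alpha> \<le> W$1$1"
    and alt: "W$1$2 = 0 \<and> W$2$1 = 0 \<and> W$1$1 = \<alpha> \<and> (\<alpha> = 1 \<or> 1 + k \<le> \<alpha>) \<or>
     k \<le> \<alpha> * W$1$2 \<or> k \<le> \<alpha> * W$2$1 \<or> k * k \<le> W$1$2 * W$2$1"
    using wb[OF W(1)] unfolding word_bound_def by blast
  note N = nonneg_SL2_diagonal[OF WN]
  have "\<alpha> * W$1$2 \<le> W$1$1 * W$1$2" "\<alpha> * W$2$1 \<le> W$1$1 * W$2$1"
    using \<alpha> N by (intro mult_right_mono; simp)+
  then have "W$1$2 = 0" "W$2$1 = 0" "W$1$1 = 1" using alt W(2) by auto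
  then show False using W(3) N(4) by (simp add: mat2_eq_iff)
qed

text \<open>The second claim is the first one after exchanging the two basis vectors, which swaps
  the diagonal entries and so turns expansion into contraction.\<close>

lemma expanding_and_contracting_letters:
  assumes fin: "finite T" and T: "T \<subseteq> nonneg_SL2" and lim: "mat 1 islimpt msg T"
  shows "\<exists>B\<in>T. B$1$2 = 0 \<and> B$2$1 = 0 \<and> B$1$1 < 1"
    and "\<exists>B\<in>T. B$1$2 = 0 \<and> B$2$1 = 0 \<and> 1 < B$1$1"
proof -
  define T' where "T' = {B \<in> T. B$1$2 * B$2$1 = 0}"
  have T': "finite T'" "T' \<subseteq> nonneg_SL2" "\<And>B. B \<in> T' \<Longrightarrow> B$1$2 * B$2$1 = 0" "T' \<subseteq> T"
    using fin T by (auto simp: T'_def)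
  have lim': "mat 1 islimpt msg T'" unfolding T'_def by (rule triangular_letters_suffice[OF fin T lim])
  show "\<exists>B\<in>T. B$1$2 = 0 \<and> B$2$1 = 0 \<and> B$1$1 < 1"
    using no_contracting_letter[OF T'(1-3)] lim' T'(4) by (meson not_le subsetD)
  define J where "J = M2 0 1 1 0"
  have J: "J ** J = mat 1" by (simp add: J_def mat2_eq_iff)
  define f where "f = (\<lambda>A. J ** A ** J)"
  have f: "f A$1$1 = A$2$2" "f A$1$2 = A$2$1" "f A$2$1 = A$1$2" "f A$2$2 = A$1$1" for A
    by (simp_all add: f_def J_def)
  have "W \<in> msg T' \<Longrightarrow> f W \<in> msg (f ` T')" for W
  proof (induction rule: msg.induct)
    case (mult A W)
    have "f (A ** W) = f A ** f W" unfolding f_def by (rule conj_mult[OF J])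
    then show ?case using mult by (auto intro: msg.mult)
  qed (auto intro: msg.base)
  then have "f ` msg T' \<subseteq> msg (f ` T')" by blast
  moreover have "mat 1 islimpt f ` msg T'" unfolding f_def by (rule islimpt_conj[OF J lim'])
  ultimately have lim'': "mat 1 islimpt msg (f ` T')" by (rule islimpt_subset[rotated])
  have "\<exists>B\<in>f ` T'. B$1$2 = 0 \<and> B$2$1 = 0 \<and> B$1$1 < 1"
  proof (rule ccontr)
    assume "\<not> ?thesis"
    moreover have "f ` T' \<subseteq> nonneg_SL2"
      using T'(2) by (auto simp: nonneg_SL2_def nonneg2_def det_2 f mult.commute)
    ultimately show False
      using no_contracting_letter[of "f ` T'"] T'(1,3) lim'' by (force simp: f not_less mult.commute)
  qed
  then obtain B where B: "B \<in> T'" "B$1$2 = 0" "B$2$1 = 0" "B$2$2 < 1" by (auto simp: f)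
  have N: "B$1$1 > 0" "B$1$1 * B$2$2 = 1"
    using nonneg_SL2_diagonal[OF subsetD[OF T'(2) B(1)]] B by auto
  then have "1 < B$1$1" using mult_strict_left_mono[OF B(4) N(1)] by simp
  then show "\<exists>B\<in>T. B$1$2 = 0 \<and> B$2$1 = 0 \<and> 1 < B$1$1" using B T'(4) by blast
qed

text \<open>Diagonal entries of the letters are positive and nonnegative terms cannot cancel, so an
  off-diagonal entry of any letter would survive in the product.\<close>

lemma diagonal_word:
  assumes T: "T \<subseteq> nonneg_SL2" and "W \<in> msg T" "W$1$2 = 0" "W$2$1 = 0"
  shows "W \<in> msg {B \<in> T. B$1$2 = 0 \<and> B$2$1 = 0}"
  using assms(2-)
proof induction
  case (mult A W)
  note A = nonneg_SL2_diagonal[OF subsetD[OF T mult(1)]]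
  note W = nonneg_SL2_diagonal[OF msg_nonneg_SL2[OF T mult(2)]]
  have "A$1$1 * W$1$2 + A$1$2 * W$2$2 = 0" "A$2$1 * W$1$1 + A$2$2 * W$2$1 = 0"
    using mult.prems by simp_all
  moreover have "0 \<le> A$1$1 * W$1$2" "0 \<le> A$1$2 * W$2$2" "0 \<le> A$2$1 * W$1$1" "0 \<le> A$2$2 * W$2$1"
    using A W by simp_all
  ultimately have "A$1$1 * W$1$2 = 0" "A$1$2 * W$2$2 = 0" "A$2$1 * W$1$1 = 0" "A$2$2 * W$2$1 = 0"
    by linarith+
  then have "W$1$2 = 0" "A$1$2 = 0" "A$2$1 = 0" "W$2$1 = 0" using A(1,2) W(1,2) by auto
  then show ?case using mult by (auto intro: msg.mult)
qed (auto intro: msg.base)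

lemma diag_mult: "diag x ** diag y = diag (x * y)"
  by (simp add: diag_def mat2_eq_iff)

lemma diag_nth [simp]:
  "diag x$1$1 = x" "diag x$1$2 = 0" "diag x$2$1 = 0" "diag x$2$2 = 1 / x"
  by (simp_all add: diag_def)

text \<open>Dirichlet approximation of \<open>ln x / (- ln y)\<close> by \<open>h / k\<close> makes
  the logarithm of \<open>x ^ k * y ^ h\<close> arbitrarily small. If no such product were 1, these
  dilations would accumulate at the identity.\<close>

lemma commensurable_dilations:
  fixes x y :: real
  assumes x: "x > 1" and y: "0 < y" "y < 1"
    and nl: "\<not> mat 1 islimpt {diag (x ^ i * y ^ j) | i j. i > 0}"
  obtains (finish) i j where "i > 0" "j > 0" "x ^ i * y ^ j = 1"
proof (rule ccontr)
  assume "\<not> thesis"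
  then have no: "x ^ i * y ^ j \<noteq> 1" if "i > 0" "j > 0" for i j using finish that by blast
  define \<theta> where "\<theta> = ln x / (- ln y)"
  have ly: "ln y < 0" and lx: "ln x > 0" using x y by auto
  have \<theta>: "\<theta> > 0" unfolding \<theta>_def by (intro divide_pos_pos) (use lx ly in auto)
  have "mat 1 islimpt {diag (x ^ i * y ^ j) | i j. i > 0}"
    unfolding islimpt_approachable
  proof (intro allI impI)
    fix e :: real assume e: "e > 0"
    have "isCont (\<lambda>t. diag (exp t)) 0"
      unfolding isCont_def diag_def by (rule tendsto_mat2I) (auto intro!: tendsto_eq_intros)
    then obtain d where d: "d > 0" "\<And>t. dist t 0 < d \<Longrightarrow> dist (diag (exp t)) (diag (exp 0)) < e"
      using e unfolding continuous_at_eps_delta by blast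
    obtain N :: nat where N: "N > 0" "(- ln y) / d < N"
      by (metis d(1) divide_pos_pos gr_zeroI ly neg_0_less_iff_less of_nat_0 order_less_asym reals_Archimedean2)
    obtain h k where hk: "0 < k" "\<bar>of_int k * \<theta> - of_int h\<bar> < 1 / N"
      using Dirichlet_approx[OF N(1)] by blast
    have "(1::real) / N \<le> 1" using N(1) by simp
    \<comment> \<open>\<open>h\<close> becomes the exponent of \<open>y\<close> and must be natural.
      It can be 0, and for that reason the set in \<open>nl\<close> demands only
      \<open>i > 0\<close>.\<close>
    have "h \<ge> 0"
    proof (rule ccontr)
      assume "\<not> h \<ge> 0"
      then have "real_of_int h \<le> -1" by linarith
      moreover have "of_int k * \<theta> > 0" using hk(1) \<theta> by simp
      ultimately have "\<bar>of_int k * \<theta> - of_int h\<bar> > 1" by linarith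
      then show False using hk(2) \<open>1 / N \<le> 1\<close> by linarith
    qed
    define i j where "i = nat k" and "j = nat h"
    have i: "i > 0" using hk(1) by (simp add: i_def)
    have p: "x ^ i * y ^ j > 0" using x y by simp
    have ln_eq: "ln (x ^ i * y ^ j) = (- ln y) * (of_int k * \<theta> - of_int h)"
    proof -
      have "ln (x ^ i * y ^ j) = real i * ln x + real j * ln y"
        using x y by (simp add: ln_mult ln_realpow)
      also have "\<dots> = of_int k * ln x + of_int h * ln y"
        using hk(1) \<open>h \<ge> 0\<close> by (simp add: i_def j_def)
      also have "\<dots> = (- ln y) * (of_int k * \<theta> - of_int h)" using ly by (simp add: \<theta>_def field_simps)
      finally show ?thesis .
    qed
    have "x ^ i * y ^ j \<noteq> 1"
    proof (cases "j = 0")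
      case True
      then show ?thesis using one_less_power[OF x i] by simp
    qed (use no i in simp)
    then have ne: "diag (x ^ i * y ^ j) \<noteq> mat 1" by (simp add: mat2_eq_iff)
    have "\<bar>ln (x ^ i * y ^ j)\<bar> = (- ln y) * \<bar>of_int k * \<theta> - of_int h\<bar>"
      unfolding ln_eq abs_mult using ly by simp
    also have "\<dots> < (- ln y) * (1 / N)" using hk(2) ly by (intro mult_strict_left_mono) auto
    also have "\<dots> < d" using N d(1) by (simp add: field_simps)
    finally have "dist (ln (x ^ i * y ^ j)) 0 < d" by simp
    then have "dist (diag (exp (ln (x ^ i * y ^ j)))) (diag (exp 0)) < e" by (rule d(2))
    moreover have "diag 1 = mat 1" by (simp add: mat2_eq_iff)
    ultimately have "dist (diag (x ^ i * y ^ j)) (mat 1) < e" using p by simp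
    then show "\<exists>A\<in>{diag (x ^ i * y ^ j) | i j. i > 0}. A \<noteq> mat 1 \<and> dist A (mat 1) < e"
      using ne i by blast
  qed
  then show False using nl by blast
qed

section \<open>Semigroups preserving a closed interval\<close>

lemma diag_nonneg_SL2_iff: "diag x \<in> nonneg_SL2 \<longleftrightarrow> x > 0"
  by (auto simp: nonneg_SL2_def nonneg2_def det_2 diag_def less_le)

lemma abs_ln_less:
  fixes x :: real
  assumes "0 < x" "exp (- r) < x" "x < exp r"
  shows "\<bar>ln x\<bar> < r"
proof -
  have "ln (exp (- r)) < ln x" "ln x < ln (exp r)"
    using assms by (simp_all only: ln_less_cancel_iff exp_gt_zero)
  then show ?thesis by (simp add: abs_less_iff)
qed

locale sector_semigroup =
  fixes S :: "(complex option \<Rightarrow> complex option) set" and P Q :: "real^2^2"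
  assumes semigroup: "mobius_semigroup S"
    and PQ: "P ** Q = mat 1" and det_P: "det P > 0"
    and sector: "A \<in> lift S \<Longrightarrow> nonneg2 (Q ** A ** P) \<or> nonneg2 (- (Q ** A ** P))"
begin

lemma QP: "Q ** P = mat 1"
  by (rule matrix_inverse_swap[OF PQ])

definition act :: "real^2^2 \<Rightarrow> complex option \<Rightarrow> complex option" where
  "act B = mobius (P ** B ** Q)"

text \<open>Taking nonnegative lifts in the coordinates of the sector removes the sign ambiguity:
  \<open>act\<close> is injective on them, so words of maps and words of matrices
  correspond.\<close>

definition reps :: "(real^2^2) set" where
  "reps = {B \<in> nonneg_SL2. act B \<in> S}"

text \<open>In the coordinates of the sector, \<open>diag x\<close> is multiplication by
  \<open>x\<^sup>2\<close>, a hyperbolic element fixing both end points unless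
  \<open>x = 1\<close>.\<close>

definition dils :: "real set" where
  "dils = {x. x > 0 \<and> diag x \<in> reps}"

lemma act_mult:
  assumes "det A = 1" "det B = 1"
  shows "act (A ** B) = act A \<circ> act B"
  using mobius_mult[of "P ** A ** Q" "P ** B ** Q"] assms
  by (simp add: act_def det_conj[OF QP] conj_mult[OF QP])

lemma act_one: "act (mat 1) = id"
  by (simp add: act_def PQ mobius_one)

lemma act_mobius_maps: "det B = 1 \<Longrightarrow> act B \<in> mobius_maps"
  by (auto simp: act_def mobius_maps_def det_conj[OF QP])

lemma act_inj:
  assumes "A \<in> nonneg_SL2" "B \<in> nonneg_SL2" "act A = act B"
  shows "A = B"
proof -
  have d: "det A = 1" "det B = 1" using assms by (simp_all add: nonneg_SL2_def)
  have "P ** A ** Q = P ** B ** Q \<or> P ** A ** Q = - (P ** B ** Q)"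
    using assms(3) d mobius_eq_iff[of "P ** A ** Q" "P ** B ** Q"] by (simp add: act_def det_conj[OF QP])
  then have "Q ** (P ** A ** Q) ** P = Q ** (P ** B ** Q) ** P \<or> Q ** (P ** A ** Q) ** P = - (Q ** (P ** B ** Q) ** P)"
    by (auto simp: conj_neg)
  then have "A = B \<or> A = - B" by (simp add: conj_cancel[OF QP])
  then show ?thesis using nonneg_SL2_diagonal(1)[OF assms(1)] nonneg_SL2_diagonal(1)[OF assms(2)] by auto
qed

lemma reps_subset: "reps \<subseteq> nonneg_SL2" and reps_det: "B \<in> reps \<Longrightarrow> det B = 1" and act_mem: "B \<in> reps \<Longrightarrow> act B \<in> S"
  by (auto simp: reps_def nonneg_SL2_def)

lemma reps_mult: "A \<in> reps \<Longrightarrow> B \<in> reps \<Longrightarrow> A ** B \<in> reps"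
  using semigroup nonneg_SL2_mult by (auto simp: reps_def nonneg_SL2_def act_mult mobius_semigroup_def)

lemma sector_representative:
  assumes "f \<in> S"
  obtains B where "B \<in> reps" "f = act B"
proof -
  have "f \<in> mobius_maps" using assms semigroup by (auto simp: mobius_semigroup_def)
  then obtain A where A: "det A = 1" "f = mobius A" by (rule mobius_maps_lift)
  then have AL: "A \<in> lift S" using assms by (simp add: lift_def)
  define B where "B = Q ** A ** P"
  have B: "det B = 1" "act B = f" using A by (simp_all add: B_def act_def det_conj[OF PQ] conj_cancel[OF PQ])
  have B': "det (- B) = 1" "act (- B) = f" using B by (simp_all add: act_def conj_neg mobius_neg)
  have "nonneg2 B \<or> nonneg2 (- B)" using sector[OF AL] by (simp only: B_def)
  then show thesis
  proof
    assume "nonneg2 B"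
    then have "B \<in> reps" using B assms by (simp add: reps_def nonneg_SL2_def)
    then show thesis using that B(2) by simp
  next
    assume "nonneg2 (- B)"
    then have "- B \<in> reps" using B' assms unfolding reps_def nonneg_SL2_def by blast
    then show thesis using that B'(2) by simp
  qed
qed

lemma dils_mult: "x \<in> dils \<Longrightarrow> y \<in> dils \<Longrightarrow> x * y \<in> dils"
  using reps_mult by (auto simp: dils_def diag_mult[symmetric])

lemma dils_power_mult:
  assumes "x \<in> dils" "y \<in> dils"
  shows "x ^ k * y ^ Suc j \<in> dils"
proof -
  have y: "y ^ Suc j \<in> dils" using assms(2) by (induction j) (auto intro: dils_mult)
  show ?thesis using y assms(1) by (induction k) (auto simp: mult.assoc intro: dils_mult)
qed

lemma islimpt_reps:
  assumes "mat 1 islimpt lift S"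
  shows "mat 1 islimpt reps"
proof -
  have "mat 1 islimpt (\<lambda>A. Q ** A ** P) ` lift S" by (rule islimpt_conj[OF QP assms])
  moreover have "open {W :: real^2^2. 0 < W$1$1}" by (intro open_Collect_less continuous_intros)
  ultimately have "mat 1 islimpt (\<lambda>A. Q ** A ** P) ` lift S \<inter> {W. 0 < W$1$1}"
    by (rule islimpt_open_Int) simp
  moreover have "(\<lambda>A. Q ** A ** P) ` lift S \<inter> {W. 0 < W$1$1} \<subseteq> reps"
  proof
    fix W assume "W \<in> (\<lambda>A. Q ** A ** P) ` lift S \<inter> {W. 0 < W$1$1}"
    then obtain A where A: "A \<in> lift S" "W = Q ** A ** P" "0 < W$1$1" by auto
    then have "nonneg2 W" using sector[OF A(1)] by (auto simp: nonneg2_def)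
    then show "W \<in> reps" using A by (auto simp: reps_def nonneg_SL2_def lift_def act_def det_conj[OF PQ] conj_cancel[OF PQ])
  qed
  ultimately show ?thesis by (rule islimpt_subset)
qed

lemma finite_letters:
  assumes "finite T"
  shows "finite {B \<in> reps. act B \<in> T}"
proof (rule finite_imageD)
  show "finite (act ` {B \<in> reps. act B \<in> T})" by (rule finite_subset[OF _ assms]) auto
  show "inj_on act {B \<in> reps. act B \<in> T}" using act_inj reps_subset by (auto simp: inj_on_def)
qed

lemma reps_words:
  assumes T: "generated_by S T" and "B \<in> reps"
  shows "B \<in> msg {B \<in> reps. act B \<in> T}"
proof -
  let ?T = "{B \<in> reps. act B \<in> T}"
  have "\<exists>W\<in>msg ?T. f = act W" if "f \<in> compositions T" for f
    using that
  proof induction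
    case (base f)
    then have "f \<in> S" using T by (auto simp: generated_by_def)
    then obtain B where "B \<in> reps" "f = act B" by (rule sector_representative)
    then show ?case using base by (auto intro: msg.base)
  next
    case (comp f g)
    then have "f \<in> S" using T by (auto simp: generated_by_def)
    then obtain B where B: "B \<in> reps" "f = act B" by (rule sector_representative)
    obtain W where W: "W \<in> msg ?T" "g = act W" using comp by blast
    have "W \<in> nonneg_SL2" by (rule msg_nonneg_SL2[OF _ W(1)]) (use reps_subset in blast)
    then have "act (B ** W) = f \<circ> g" using B W by (simp add: act_mult reps_det nonneg_SL2_def)
    moreover have "B \<in> ?T" using B comp(1) by simp
    then have "B ** W \<in> msg ?T" using W(1) by (rule msg.mult)
    ultimately show ?case by (intro bexI[of _ "B ** W"]) simp_all
  qed
  moreover have "act B \<in> compositions T" using T act_mem[OF assms(2)] by (simp add: generated_by_def)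
  ultimately obtain W where W: "W \<in> msg ?T" "act B = act W" by blast
  have "W \<in> nonneg_SL2" by (rule msg_nonneg_SL2[OF _ W(1)]) (use reps_subset in blast)
  then have "B = W" using act_inj W(2) assms(2) reps_subset by blast
  then show ?thesis using W(1) by simp
qed

lemma msg_reps:
  assumes "W \<in> msg T" "T \<subseteq> reps"
  shows "W \<in> reps"
  using assms(1) by induction (use assms(2) reps_mult in auto)

text \<open>An expanding and a contracting dilation cannot both be positive powers of one dilation,
  so the semigroup they generate really needs two generators and is semidiscrete by hypothesis. This
  forces a relation between them.\<close>

lemma opposite_dilations_commensurable:
  assumes pairs: "\<forall>T. mobius_semigroup T \<and> n_generator 2 T \<and> T \<subseteq> S \<longrightarrow> semidiscrete T"
    and x: "x \<in> dils" "x > 1" and y: "y \<in> dils" "y < 1"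
  obtains i j where "i > 0" "j > 0" "x ^ i * y ^ j = 1"
proof -
  define f where "f = act (diag x)"
  define g where "g = act (diag y)"
  let ?C = "compositions {f, g}"
  have y0: "y > 0" using y by (simp add: dils_def)
  have fg: "f \<in> S" "g \<in> S" using x y by (auto simp: f_def g_def dils_def act_mem)
  have dd: "det (diag z) = 1" if "z > 0" for z using that by (simp add: det_2)
  have cmd: "act (diag (z * w)) = act (diag z) \<circ> act (diag w)" if "z > 0" "w > 0" for z w
    using that by (simp add: diag_mult[symmetric] act_mult dd)
  have sd: "semidiscrete ?C"
  proof (rule two_generator_semidiscrete[OF semigroup pairs fg])
    fix h :: "complex option \<Rightarrow> complex option" and m n :: nat
    assume h: "h \<in> ?C" and m: "m > 0" "f = h ^^ m" and n: "n > 0" "g = h ^^ n"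
    have "\<exists>z>0. h = act (diag z)" using h
    proof induction
      case (base h) then show ?case using x(2) y0 by (auto simp: f_def g_def intro: exI[of _ x] exI[of _ y])
    next
      case (comp h k)
      then obtain w where w: "w > 0" "k = act (diag w)" by blast
      have "h = act (diag x) \<or> h = act (diag y)" using comp(1) by (auto simp: f_def g_def)
      then show ?case
        using w x(2) y0 cmd[of x w] cmd[of y w]
        by (metis less_trans mult_pos_pos zero_less_one)
    qed
    then obtain z where z: "z > 0" "h = act (diag z)" by blast
    have pw: "h ^^ k = act (diag (z ^ k))" for k
    proof (induction k)
      case 0
      have "diag 1 = mat 1" by (simp add: mat2_eq_iff)
      then show ?case by (simp add: act_one)
    next
      case (Suc k)
      then show ?case using z cmd[of z "z ^ k"] by simp
    qed
    have "diag x = diag (z ^ m)"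
      by (rule act_inj) (use m pw z x in \<open>auto simp: diag_nonneg_SL2_iff f_def[symmetric]\<close>)
    then have zm: "x = z ^ m" by (simp add: mat2_eq_iff)
    have "diag y = diag (z ^ n)"
      by (rule act_inj) (use n pw z y0 in \<open>auto simp: diag_nonneg_SL2_iff g_def[symmetric]\<close>)
    then have zn: "y = z ^ n" by (simp add: mat2_eq_iff)
    have "z > 1" using zm x(2) z(1) power_le_one[of z m] by linarith
    then show False using zn y(2) one_le_power[of z n] by linarith
  qed
  have cp: "act (diag (x ^ Suc i * y ^ j)) \<in> ?C" for i j
  proof -
    have "act (diag (x ^ Suc i)) \<in> ?C"
    proof (induction i)
      case 0 show ?case by (auto simp: f_def intro: compositions.base)
    next
      case (Suc i)
      have "act (diag (x ^ Suc (Suc i))) = f \<circ> act (diag (x ^ Suc i))"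
        using cmd[of x "x ^ Suc i"] x(2) by (simp add: f_def)
      moreover have "f \<circ> act (diag (x ^ Suc i)) \<in> ?C"
        by (rule compositions.comp) (use Suc in auto)
      ultimately show ?case by (simp only:)
    qed
    then show ?thesis
    proof (induction j)
      case (Suc j)
      have e: "x ^ Suc i * y ^ Suc j = y * (x ^ Suc i * y ^ j)" by simp
      have "act (diag (x ^ Suc i * y ^ Suc j)) = g \<circ> act (diag (x ^ Suc i * y ^ j))"
        unfolding e g_def by (rule cmd) (use x(2) y0 in auto)
      moreover have "g \<circ> act (diag (x ^ Suc i * y ^ j)) \<in> ?C"
        by (rule compositions.comp) (use Suc in auto)
      ultimately show ?case by (simp only:)
    qed simp
  qed
  have "\<not> mat 1 islimpt {diag (x ^ i * y ^ j) | i j. i > 0}"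
  proof
    assume "mat 1 islimpt {diag (x ^ i * y ^ j) | i j. i > 0}"
    then have "mat 1 islimpt (\<lambda>A. P ** A ** Q) ` {diag (x ^ i * y ^ j) | i j. i > 0}"
      by (rule islimpt_conj[OF PQ])
    moreover have "(\<lambda>A. P ** A ** Q) ` {diag (x ^ i * y ^ j) | i j. i > 0} \<subseteq> lift ?C"
    proof
      fix A assume "A \<in> (\<lambda>A. P ** A ** Q) ` {diag (x ^ i * y ^ j) | i j. i > 0}"
      then obtain i j where ij: "i > 0" "A = P ** diag (x ^ i * y ^ j) ** Q" by blast
      then obtain i' where "i = Suc i'" by (cases i) auto
      then show "A \<in> lift ?C"
        using cp[of i' j] ij x(2) y0 by (simp add: lift_def act_def det_conj[OF QP] dd)
    qed
    ultimately have "mat 1 islimpt lift ?C" by (rule islimpt_subset)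
    then show False using sd not_semidiscrete_iff by blast
  qed
  then show thesis by (rule commensurable_dilations[OF x(2) y0 y(2)]) (rule that)
qed

text \<open>A relation \<open>x ^ i * y ^ j = 1\<close> exhibits \<open>1 / x\<close> as
  \<open>x ^ (i - 1) * y ^ j\<close>. For discreteness, commensurability of pairs is too weak, as
  rational multiples of \<open>ln x0\<close> may be dense. But every dilation is a word in the
  finitely many diagonal letters, so \<open>M\<close> is a common denominator and all logarithms are
  multiples of \<open>ln x0 / M\<close>.\<close>

lemma dilations_discrete_group:
  assumes pairs: "\<forall>T. mobius_semigroup T \<and> n_generator 2 T \<and> T \<subseteq> S \<longrightarrow> semidiscrete T"
    and gen: "finite T" "generated_by S T"
    and x0: "x0 \<in> dils" "x0 > 1" and y0: "y0 \<in> dils" "y0 < 1"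
  shows "\<And>x. x \<in> dils \<Longrightarrow> 1 / x \<in> dils"
    and "\<exists>r>0. \<forall>x\<in>dils. \<bar>ln x\<bar> < r \<longrightarrow> x = 1"
proof -
  have pos: "x > 0" if "x \<in> dils" for x using that by (simp add: dils_def)
  have inv_aux: "1 / x \<in> dils" "1 / y \<in> dils" if x: "x \<in> dils" "x > 1" and y: "y \<in> dils" "y < 1" for x y
  proof -
    obtain i j where ij: "i > 0" "j > 0" "x ^ i * y ^ j = 1"
      by (rule opposite_dilations_commensurable[OF pairs x y]) (rule that)
    then obtain i' j' where s: "i = Suc i'" "j = Suc j'" by (metis Suc_pred)
    have "1 / x = x ^ i' * y ^ Suc j'" using ij(3) pos[OF x(1)] by (simp add: s field_simps)
    then show "1 / x \<in> dils" using dils_power_mult[OF x(1) y(1)] by simp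
    have "1 / y = y ^ j' * x ^ Suc i'" using ij(3) pos[OF y(1)] by (simp add: s field_simps)
    then show "1 / y \<in> dils" using dils_power_mult[OF y(1) x(1)] by simp
  qed
  show inv: "1 / x \<in> dils" if "x \<in> dils" for x
    using inv_aux[OF that _ y0] inv_aux[OF x0 that] that by (cases x "1 :: real" rule: linorder_cases) auto
  let ?T = "{B \<in> reps. act B \<in> T}" and ?D = "{B \<in> {B \<in> reps. act B \<in> T}. B$1$2 = 0 \<and> B$2$1 = 0}"
  have lx0: "ln x0 > 0" using x0 by simp
  define rel where "rel m x \<longleftrightarrow> (\<exists>k::int. real m * ln x = of_int k * ln x0)" for m x
  have commens: "\<exists>m>0. rel m x" if x: "x \<in> dils" for x
  proof (cases x "1 :: real" rule: linorder_cases)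
    case less
    obtain i j where ij: "i > 0" "j > 0" "x0 ^ i * x ^ j = 1"
      by (rule opposite_dilations_commensurable[OF pairs x0 x less]) (rule that)
    have "ln (x0 ^ i * x ^ j) = real i * ln x0 + real j * ln x"
      using pos[OF x] x0 by (simp add: ln_mult ln_realpow)
    then have "real j * ln x = of_int (- int i) * ln x0" using ij(3) by simp
    then show ?thesis using ij(2) unfolding rel_def by blast
  next
    case equal
    then show ?thesis unfolding rel_def by (intro exI[of _ 1] conjI exI[of _ 0]) auto
  next
    case greater
    \<comment> \<open>\<open>x\<close> and \<open>x0\<close> both expand, so they are compared
      through the contracting \<open>y0\<close>.\<close>
    obtain i j where ij: "i > 0" "j > 0" "x ^ i * y0 ^ j = 1"
      by (rule opposite_dilations_commensurable[OF pairs x greater y0]) (rule that)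
    obtain p q where pq: "p > 0" "q > 0" "x0 ^ p * y0 ^ q = 1"
      by (rule opposite_dilations_commensurable[OF pairs x0 y0]) (rule that)
    have "ln (x ^ i * y0 ^ j) = real i * ln x + real j * ln y0"
      "ln (x0 ^ p * y0 ^ q) = real p * ln x0 + real q * ln y0"
      using pos[OF x] pos[OF y0(1)] x0 by (simp_all add: ln_mult ln_realpow)
    then have e: "real i * ln x = - (real j * ln y0)" "real q * ln y0 = - (real p * ln x0)"
      using ij(3) pq(3) by simp_all
    have "real (q * i) * ln x = real q * (real i * ln x)" by simp
    also have "\<dots> = - real j * (real q * ln y0)" unfolding e(1) by (simp add: ac_simps)
    also have "\<dots> = of_int (int (j * p)) * ln x0" unfolding e(2) by simp
    finally have "rel (q * i) x" unfolding rel_def by blast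
    then show ?thesis using ij(1) pq(2) by (intro exI[of _ "q * i"]) simp
  qed
  have D: "B$1$1 \<in> dils" "B = diag (B$1$1)" if "B \<in> ?D" for B
  proof -
    have B: "det B = 1" "nonneg2 B" "B$1$2 = 0" "B$2$1 = 0" "B \<in> reps"
      using that by (auto simp: reps_def nonneg_SL2_def)
    show d: "B = diag (B$1$1)" by (rule nonneg_det_one_diag(2)[OF B(1-4)])
    then show "B$1$1 \<in> dils" using nonneg_det_one_diag(1)[OF B(1-4)] B(5) by (simp add: dils_def)
  qed
  have finD: "finite ?D" by (rule finite_subset[OF _ finite_letters[OF gen(1)]]) blast
  have "\<forall>B\<in>?D. \<exists>n. n > 0 \<and> rel n (B$1$1)" using commens[OF D(1)] by blast
  then obtain m where "\<forall>B\<in>?D. m B > 0 \<and> rel (m B) (B$1$1)" by (rule bchoice[THEN exE])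
  then have m: "m B > 0 \<and> rel (m B) (B$1$1)" if "B \<in> ?D" for B using that by (rule bspec)
  define M where "M = (\<Prod>B\<in>?D. m B)"
  have M: "M > 0" unfolding M_def using m by (intro prod_pos) blast
  have relM: "rel M (B$1$1)" if B: "B \<in> ?D" for B
  proof -
    have "M = m B * (\<Prod>B\<in>?D - {B}. m B)" unfolding M_def by (rule prod.remove[OF finD B])
    then obtain c where c: "M = m B * c" by blast
    obtain k :: int where "real (m B) * ln (B$1$1) = of_int k * ln x0" using m[OF B] by (auto simp: rel_def)
    then have "real M * ln (B$1$1) = of_int (int c * k) * ln x0" by (simp add: c)
    then show ?thesis unfolding rel_def by blast
  qed
  have words: "W$1$1 > 0 \<and> rel M (W$1$1)" if "W \<in> msg ?D" for W
    using that
  proof induction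
    case (base B) then show ?case using relM D(1) pos by blast
  next
    case (mult B W)
    have B: "B$1$1 > 0" "rel M (B$1$1)" "B$1$2 = 0" using mult(1) relM D(1) pos by blast+
    have e: "(B ** W)$1$1 = B$1$1 * W$1$1" using B(3) by simp
    obtain k l :: int where "real M * ln (B$1$1) = of_int k * ln x0" "real M * ln (W$1$1) = of_int l * ln x0"
      using B(2) mult.IH by (auto simp: rel_def)
    then have "real M * ln (B$1$1 * W$1$1) = of_int (k + l) * ln x0"
      using B(1) mult.IH by (simp add: ln_mult algebra_simps)
    then show ?case unfolding e rel_def using B(1) mult.IH by (intro conjI mult_pos_pos) blast+
  qed
  have relL: "rel M x" if x: "x \<in> dils" for x
  proof -
    have "diag x \<in> reps" using x by (simp add: dils_def)
    then have "diag x \<in> msg ?T" by (rule reps_words[OF gen(2)])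
    then have "diag x \<in> msg ?D" by (rule diagonal_word[rotated]) (use reps_subset in auto)
    then show ?thesis using words by fastforce
  qed
  show "\<exists>r>0. \<forall>x\<in>dils. \<bar>ln x\<bar> < r \<longrightarrow> x = 1"
  proof (intro exI[of _ "ln x0 / M"] conjI ballI impI)
    show "ln x0 / real M > 0" using lx0 M by simp
    fix x assume x: "x \<in> dils" "\<bar>ln x\<bar> < ln x0 / real M"
    obtain k :: int where k: "real M * ln x = of_int k * ln x0" using relL[OF x(1)] by (auto simp: rel_def)
    have "\<bar>of_int k\<bar> * ln x0 = real M * \<bar>ln x\<bar>" using k lx0 M by (metis abs_mult abs_of_pos abs_of_nat)
    also have "\<dots> < ln x0" using x(2) M by (simp add: field_simps)
    finally have "\<bar>of_int k\<bar> < (1::real)" using lx0 by simp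
    then have "k = 0" by linarith
    then have "ln x = 0" using k M by simp
    then show "x = 1" using pos[OF x(1)] by simp
  qed
qed

abbreviation "J \<equiv> sector_arc P"

lemma stabilizer_eq: "{h \<in> S. h ` J = J} = (\<lambda>x. act (diag x)) ` dils"
proof (intro equalityI subsetI)
  fix h assume "h \<in> {h \<in> S. h ` J = J}"
  then have h: "h \<in> S" "h ` J = J" by auto
  obtain B where B: "B \<in> reps" "h = act B" by (rule sector_representative[OF h(1)])
  have B': "det B = 1" "nonneg2 B" using B by (auto simp: reps_def nonneg_SL2_def)
  have "B$1$2 = 0" "B$2$1 = 0"
    using nonneg_onto_sector_arc_iff[OF PQ det_P B'] h(2) B(2) by (auto simp: act_def)
  note d = nonneg_det_one_diag[OF B' this]
  have "B$1$1 \<in> dils" using d B(1) by (simp add: dils_def)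
  then show "h \<in> (\<lambda>x. act (diag x)) ` dils" using d(2) B(2) by (metis imageI)
next
  fix h assume "h \<in> (\<lambda>x. act (diag x)) ` dils"
  then obtain x where x: "x \<in> dils" "h = act (diag x)" by blast
  have "diag x \<in> reps" using x by (simp add: dils_def)
  then have "det (diag x) = 1" "nonneg2 (diag x)" "act (diag x) \<in> S" by (auto simp: reps_def nonneg_SL2_def)
  then show "h \<in> {h \<in> S. h ` J = J}"
    using nonneg_onto_sector_arc_iff[OF PQ det_P, of "diag x"] x(2) by (simp add: act_def)
qed

lemma semigroup_maps_into: "S \<subseteq> maps_into J"
proof
  fix h assume "h \<in> S"
  then obtain B where B: "B \<in> reps" "h = act B" by (rule sector_representative)
  then have "det B = 1" "nonneg2 B" by (auto simp: reps_def nonneg_SL2_def)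
  then show "h \<in> maps_into J"
    using nonneg_maps_into_sector_arc[OF PQ det_P] B(2) act_mobius_maps by (simp add: maps_into_def act_def)
qed

lemma stabilizer_subgroup:
  assumes inv: "\<And>x. x \<in> dils \<Longrightarrow> 1 / x \<in> dils" and "x0 \<in> dils"
  shows "subgroup ((\<lambda>x. act (diag x)) ` dils) mobius_group"
proof
  have pos: "x > 0" if "x \<in> dils" for x using that by (simp add: dils_def)
  have dd: "det (diag x) = 1" if "x \<in> dils" for x using pos[OF that] by (simp add: det_2)
  have cmd: "act (diag x) \<circ> act (diag y) = act (diag (x * y))" if "x \<in> dils" "y \<in> dils" for x y
    using that by (simp add: act_mult[symmetric] dd diag_mult)
  have d1: "diag 1 = mat 1" by (simp add: mat2_eq_iff)
  have one: "1 \<in> dils" using dils_mult[OF assms(2) inv[OF assms(2)]] pos[OF assms(2)] by simp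
  show "(\<lambda>x. act (diag x)) ` dils \<subseteq> carrier mobius_group"
    by (auto simp: mobius_group_def act_mobius_maps dd)
  show "f \<otimes>\<^bsub>mobius_group\<^esub> g \<in> (\<lambda>x. act (diag x)) ` dils"
    if "f \<in> (\<lambda>x. act (diag x)) ` dils" "g \<in> (\<lambda>x. act (diag x)) ` dils" for f g
    using that dils_mult by (auto simp: mobius_group_def cmd)
  show "\<one>\<^bsub>mobius_group\<^esub> \<in> (\<lambda>x. act (diag x)) ` dils"
    using one d1 act_one by (auto simp: mobius_group_def intro!: image_eqI[of _ _ 1])
  show "inv\<^bsub>mobius_group\<^esub> f \<in> (\<lambda>x. act (diag x)) ` dils" if "f \<in> (\<lambda>x. act (diag x)) ` dils" for f
  proof -
    obtain x where x: "x \<in> dils" "f = act (diag x)" using \<open>f \<in> (\<lambda>x. act (diag x)) ` dils\<close> by blast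
    have "inv\<^bsub>mobius_group\<^esub> f = act (diag (1 / x))"
    proof (rule group.inv_equality[OF group_mobius_group])
      have "act (diag (1 / x)) \<circ> act (diag x) = id"
        using cmd[OF inv[OF x(1)] x(1)] pos[OF x(1)] d1 act_one by simp
      then show "act (diag (1 / x)) \<otimes>\<^bsub>mobius_group\<^esub> f = \<one>\<^bsub>mobius_group\<^esub>"
        by (simp add: mobius_group_def x(2))
    qed (use x inv in \<open>auto simp: mobius_group_def act_mobius_maps dd\<close>)
    then show ?thesis using inv[OF x(1)] by simp
  qed
qed

text \<open>The modulus of the (1,1) entry in sector coordinates gives the dilation factor
  independently of the sign of the lift. The band of factors within \<open>exp r\<close> of
  \<open>x\<close> isolates \<open>x\<close>: any \<open>z\<close> in it yields \<open>z / x\<close>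
  in \<open>dils\<close> with logarithm below \<open>r\<close> in modulus.\<close>

lemma stabilizer_discrete:
  assumes inv: "\<And>x. x \<in> dils \<Longrightarrow> 1 / x \<in> dils"
    and r: "r > 0" "\<And>x. x \<in> dils \<Longrightarrow> \<bar>ln x\<bar> < r \<Longrightarrow> x = 1"
  shows "subtopology mobius_topology ((\<lambda>x. act (diag x)) ` dils) = discrete_topology ((\<lambda>x. act (diag x)) ` dils)"
proof (rule subtopology_eq_discrete_topology, intro conjI)
  let ?G = "(\<lambda>x. act (diag x)) ` dils"
  have pos: "x > 0" if "x \<in> dils" for x using that by (simp add: dils_def)
  have dd: "det (diag x) = 1" if "x \<in> dils" for x using pos[OF that] by (simp add: det_2)
  show "?G \<subseteq> topspace mobius_topology"
    by (auto simp: topspace_mobius_topology act_mobius_maps dd)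
  have "act (diag x) \<notin> mobius_topology derived_set_of ?G" if x: "x \<in> dils" for x
  proof -
    define V where "V = {A :: real^2^2. x * exp (- r) < \<bar>(Q ** A ** P)$1$1\<bar> \<and> \<bar>(Q ** A ** P)$1$1\<bar> < x * exp r}"
    define U where "U = mobius ` (SL2 \<inter> V)"
    have V_neg: "- A \<in> V \<longleftrightarrow> A \<in> V" for A
      unfolding V_def mem_Collect_eq conj_neg vector_uminus_component abs_minus_cancel ..
    have mem: "mobius A \<in> U \<longleftrightarrow> A \<in> V" if A: "A \<in> SL2" for A
    proof
      assume "mobius A \<in> U"
      then obtain B where "B \<in> SL2" "B \<in> V" "mobius A = mobius B" by (auto simp: U_def)
      then show "A \<in> V" using A mobius_eq_iff[of A B] V_neg by (auto simp: SL2_def)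
    qed (use A U_def in blast)
    then have "{A \<in> SL2. mobius A \<in> U} = SL2 \<inter> V" by blast
    moreover have "open V" unfolding V_def
      by (intro open_Collect_conj open_Collect_less) (auto intro!: continuous_intros)
    ultimately have "openin mobius_topology U"
      unfolding openin_mobius_topology by (auto simp: U_def openin_open_Int)
    moreover have in_U: "act (diag z) \<in> U \<longleftrightarrow> x * exp (- r) < z \<and> z < x * exp r" if z: "z \<in> dils" for z
    proof -
      have "P ** diag z ** Q \<in> SL2" by (simp add: SL2_def det_conj[OF QP] dd z)
      then have "act (diag z) \<in> U \<longleftrightarrow> P ** diag z ** Q \<in> V" unfolding act_def by (rule mem)
      also have "\<dots> \<longleftrightarrow> x * exp (- r) < \<bar>z\<bar> \<and> \<bar>z\<bar> < x * exp r"
        unfolding V_def mem_Collect_eq conj_cancel[OF QP] diag_nth ..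
      finally show ?thesis using pos[OF z] by simp
    qed
    moreover have "act (diag x) \<in> U" unfolding in_U[OF x] using pos[OF x] r(1) by simp
    moreover have "f = act (diag x)" if f: "f \<in> ?G" "f \<in> U" for f
    proof -
      obtain z where z: "z \<in> dils" "f = act (diag z)" using f(1) by blast
      have "x * exp (- r) < z" "z < x * exp r" using in_U[OF z(1)] f(2) z(2) by simp_all
      then have "exp (- r) < z / x" "z / x < exp r" using pos[OF x] by (simp_all add: field_simps)
      moreover have zx: "z / x > 0" using pos[OF x] pos[OF z(1)] by simp
      ultimately have "\<bar>ln (z / x)\<bar> < r" by (intro abs_ln_less)
      moreover have "z / x \<in> dils" using dils_mult[OF z(1) inv[OF x]] by simp
      ultimately have "z / x = 1" using r(2) by blast
      then show ?thesis using z(2) pos[OF x] by simp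
    qed
    ultimately show ?thesis unfolding in_derived_set_of by blast
  qed
  then show "?G \<inter> mobius_topology derived_set_of ?G = {}" by blast
qed

text \<open>Once the stabiliser of \<open>J\<close> is known to be a nontrivial discrete group,
  being nonexceptional says that no element outside it fixes an end point, as a triangular letter
  with a nonzero off-diagonal entry would. Words near the identity are then dilations with factor
  near 1, and discreteness makes them trivial.\<close>

lemma semidiscrete_if_pairwise:
  assumes pairs: "\<forall>T. mobius_semigroup T \<and> n_generator 2 T \<and> T \<subseteq> S \<longrightarrow> semidiscrete T"
    and gen: "finite T" "generated_by S T" and ne: "\<not> exceptional S"
  shows "semidiscrete S"
proof (rule ccontr)
  assume "\<not> semidiscrete S"
  then have limN: "mat 1 islimpt reps" using not_semidiscrete_iff islimpt_reps by blast
  let ?T = "{B \<in> reps. act B \<in> T}"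
  have finT: "finite ?T" by (rule finite_letters[OF gen(1)])
  have TN: "?T \<subseteq> nonneg_SL2" using reps_subset by blast
  have "reps \<subseteq> msg ?T" using reps_words[OF gen(2)] by blast
  then have limT: "mat 1 islimpt msg ?T" by (rule islimpt_subset[OF limN])
  have letter: "B$1$1 \<in> dils" "B = diag (B$1$1)" if "B \<in> reps" "B$1$2 = 0" "B$2$1 = 0" for B
  proof -
    have B: "det B = 1" "nonneg2 B" using that(1) by (auto simp: reps_def nonneg_SL2_def)
    show d: "B = diag (B$1$1)" by (rule nonneg_det_one_diag(2)[OF B that(2,3)])
    then show "B$1$1 \<in> dils" using nonneg_det_one_diag(1)[OF B that(2,3)] that(1) by (simp add: dils_def)
  qed
  obtain y0 where y0: "y0 \<in> dils" "y0 < 1"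
    using expanding_and_contracting_letters(1)[OF finT TN limT] letter by blast
  obtain x0 where x0: "x0 \<in> dils" "x0 > 1"
    using expanding_and_contracting_letters(2)[OF finT TN limT] letter by blast
  have inv: "1 / x \<in> dils" if "x \<in> dils" for x
    using dilations_discrete_group(1)[OF pairs gen x0 y0 that] by blast
  obtain r where r: "r > 0" "\<And>x. x \<in> dils \<Longrightarrow> \<bar>ln x\<bar> < r \<Longrightarrow> x = 1"
    using dilations_discrete_group(2)[OF pairs gen x0 y0] by blast
  let ?G = "{h \<in> S. h ` J = J}"
  let ?u = "pt (P *v axis 2 1)" and ?v = "pt (P *v axis 1 1)"
  have nofix: "\<not> (\<exists>h\<in>S - ?G. h ?u = ?u \<or> h ?v = ?v)"
  proof
    assume fix_end: "\<exists>h\<in>S - ?G. h ?u = ?u \<or> h ?v = ?v"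
    have sub: "subgroup ?G mobius_group"
      unfolding stabilizer_eq by (rule stabilizer_subgroup[OF _ x0(1)]) (rule inv)
    have disc: "subtopology mobius_topology ?G = discrete_topology ?G"
      unfolding stabilizer_eq by (rule stabilizer_discrete[OF _ r(1)]) (erule inv, erule r(2))
    have "?G \<noteq> {id}"
    proof
      assume "?G = {id}"
      then have "act (diag x0) = id" unfolding stabilizer_eq using x0(1) by blast
      then have "diag x0 = mat 1" using x0(2)
        by (intro act_inj) (auto simp: act_one diag_nonneg_SL2_iff nonneg_SL2_def nonneg2_def det_2)
      then show False using x0(2) by (simp add: mat2_eq_iff)
    qed
    then have "exceptional S"
      unfolding exceptional_def Let_def
      using closed_interval_sector_arc[OF det_P] semigroup_maps_into sub disc fix_end by blast
    then show False using ne by blast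
  qed
  have tri: "B$1$2 = 0 \<and> B$2$1 = 0" if B: "B \<in> ?T" "B$1$2 * B$2$1 = 0" for B
  proof (rule ccontr)
    assume n: "\<not> ?thesis"
    have B': "det B = 1" "nonneg2 B" "act B \<in> S" using B(1) by (auto simp: reps_def nonneg_SL2_def)
    have "act B ?u = ?u \<or> act B ?v = ?v"
      using triangular_fixes_endpoint[OF PQ B'(1)] B(2) by (auto simp: act_def)
    moreover have "act B ` J \<noteq> J"
      using nonneg_onto_sector_arc_iff[OF PQ det_P B'(1,2)] n by (simp add: act_def)
    ultimately show False using nofix B'(3) by blast
  qed
  have "mat 1 islimpt msg {B \<in> ?T. B$1$2 * B$2$1 = 0}"
    by (rule triangular_letters_suffice[OF finT TN limT])
  moreover let ?U = "{W :: real^2^2. exp (- r) < W$1$1 \<and> W$1$1 < exp r}"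
  have "open ?U" by (intro open_Collect_conj open_Collect_less continuous_intros)
  moreover have "mat 1 \<in> ?U" using r(1) by simp
  ultimately have "mat 1 islimpt (msg {B \<in> ?T. B$1$2 * B$2$1 = 0} \<inter> ?U)" by (rule islimpt_open_Int)
  then obtain W where W: "W \<in> msg {B \<in> ?T. B$1$2 * B$2$1 = 0}" "W \<in> ?U" "W \<noteq> mat 1"
    unfolding islimpt_def by blast
  have WN: "W \<in> reps" by (rule msg_reps[OF W(1)]) blast
  have "W$1$2 = 0 \<and> W$2$1 = 0" using W(1)
  proof induction
    case (base B)
    then show ?case using tri[of B] by blast
  next
    case (mult B W)
    then have "B$1$2 = 0 \<and> B$2$1 = 0" using tri[of B] by blast
    then show ?case using mult.IH by simp
  qed
  then have WL: "W$1$1 \<in> dils" "W = diag (W$1$1)" using letter[OF WN] by blast+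
  have "W$1$1 > 0" using WL(1) by (simp add: dils_def)
  then have "\<bar>ln (W$1$1)\<bar> < r" using W(2) by (intro abs_ln_less) simp_all
  then have "W$1$1 = 1" by (rule r(2)[OF WL(1)])
  then have "W = mat 1" using WL(2) by (simp add: mat2_eq_iff)
  then show False using W(3) by blast
qed

end

theorem theorem1p9:
  fixes S :: "(complex option \<Rightarrow> complex option) set"
  assumes "mobius_semigroup S"
    and "finitely_generated S"
    and "\<not> exceptional S"
    and "\<not> elementary S"
  shows "semidiscrete S \<longleftrightarrow>
    (\<forall>T. mobius_semigroup T \<and> n_generator 2 T \<and> T \<subseteq> S \<longrightarrow> semidiscrete T)"
proof
  assume "semidiscrete S"
  then show "\<forall>T. mobius_semigroup T \<and> n_generator 2 T \<and> T \<subseteq> S \<longrightarrow> semidiscrete T"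
    unfolding semidiscrete_def using derived_set_of_mono by blast
next
  assume pairs: "\<forall>T. mobius_semigroup T \<and> n_generator 2 T \<and> T \<subseteq> S \<longrightarrow> semidiscrete T"
  interpret nonelementary_pairwise_semidiscrete "lift S"
    by (rule lift_nonelementary[OF assms(1,4) pairs])
  show "semidiscrete S"
  proof (rule ccontr)
    assume ns: "\<not> semidiscrete S"
    then have "mat 1 islimpt lift S" using not_semidiscrete_iff by blast
    then obtain P Q where PQ: "P ** Q = mat 1"
      and nn: "\<And>A. A \<in> lift S \<Longrightarrow> nonneg2 (Q ** A ** P) \<or> nonneg2 (- (Q ** A ** P))"
      by (rule invariant_sector) (rule that)
    have "\<exists>P Q. sector_semigroup S P Q"
    proof (cases "det P > 0")
      case True
      then show ?thesis using sector_semigroup.intro[OF assms(1) PQ _ nn] by blast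
    next
      case False
      \<comment> \<open>The orientation of the arc requires a positive determinant. Exchanging the
        basis vectors reverses its sign and only permutes the entries of the conjugated lifts, so
        nonnegativity is kept.\<close>
      define J where "J = M2 0 1 1 0"
      have J: "J ** J = mat 1" by (simp add: J_def mat2_eq_iff)
      have "sector_semigroup S (P ** J) (J ** Q)"
      proof
        show "mobius_semigroup S" by (rule assms(1))
        show "P ** J ** (J ** Q) = mat 1" using PQ J by (metis matrix_mul_assoc matrix_mul_rid)
        have "det P * det Q = 1" using PQ by (metis det_mul det_I)
        then have "det P < 0" using False by (cases "det P = 0") auto
        then show "det (P ** J) > 0" by (simp add: det_mul J_def)
        show "nonneg2 (J ** Q ** A ** (P ** J)) \<or> nonneg2 (- (J ** Q ** A ** (P ** J)))"
          if "A \<in> lift S" for A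
        proof -
          have "J ** Q ** A ** (P ** J) = J ** (Q ** A ** P) ** J" by (simp add: matrix_mul_assoc)
          then show ?thesis using nn[OF that] by (auto simp: nonneg2_def J_def)
        qed
      qed
      then show ?thesis by blast
    qed
    then obtain P Q where "sector_semigroup S P Q" by blast
    moreover obtain T where "finite T" "generated_by S T"
      using assms(2) by (auto simp: finitely_generated_def)
    ultimately have "semidiscrete S"
      using sector_semigroup.semidiscrete_if_pairwise[OF _ pairs _ _ assms(3)] by blast
    then show False using ns by blast
  qed
qed

end
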